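(* Let $A$ and $B$ be algebras over $k$, let $R:B\otimes A\to A\otimes B$ be an invertible twisting map, let $E$ be a right $A$-module with a right connection $\nabla^E:E\to E\otimes_A\Omega^1A$, and let $F$ be a right $B$-module with a right connection $\nabla^F:F\to F\otimes_B\Omega^1B$. Let $\tau_{F,A}:F\otimes A\to A\otimes F$ be an invertible right module twisting map satisfying $$(A\otimes\nabla^F)\circ\tau_{F,A}=(\tau_{F,A}\otimes\Omega^1B)\circ(F\otimes\widetilde R)\circ(\nabla^F\otimes A).$$ Let $\theta^E$ and $\theta^F$ be the curvatures of $\nabla^E$ and $\nabla^F$. Then the curvature $\theta$ of the (twisted) product connection $\nabla$ of $\nabla^E$ and $\nabla^F$ on $E\otimes B\oplus A\otimes F$ is given by $$\theta(e\otimes b,a\otimes f)=i_E(\theta^E(e))\cdot b+a\cdot i_F(\theta^F(f))$$ for all $e\in E$, $b\in B$, $a\in A$, $f\in F$.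
   Context: All algebras are associative unital over a field $k$; $\otimes=\otimes_k$; an object's name also denotes its identity map; $\mu_D$ is the multiplication of an algebra $D$. $\Omega A=\bigoplus_p\Omega^pA$, with differential $d_A$, is the universal differential graded algebra of $A$ (similarly for $B$). Given a differential calculus $(\Omega D,d)$ over an algebra $D$ (a differential graded algebra generated, as such, by $\Omega^0D=D$), a right connection on a right $D$-module $M$ is a linear map $\nabla:M\to M\otimes_D\Omega^1D$ with $\nabla(m\cdot x)=(\nabla m)\cdot x+m\otimes dx$. It extends uniquely to a degree 1 operator on $M\otimes_D\Omega D$ by $\nabla(m\otimes\omega)=\nabla(m)\,\omega+m\otimes d\omega$; let $\nabla^{[n]}:M\otimes_D\Omega^nD\to M\otimes_D\Omega^{n+1}D$ be its degree $n$ component. The curvature of $\nabla$ is $\theta:=\nabla^{[1]}\circ\nabla^{[0]}:M\to M\otimes_D\Omega^2D$. A twisting map is a linear map $R:B\otimes A\to A\otimes B$ with $R(b\otimes1)=1\otimes b$, $R(1\otimes a)=a\otimes1$, $R\circ(B\otimes\mu_A)=(\mu_A\otimes B)\circ(A\otimes R)\circ(R\otimes A)$ and $R\circ(\mu_B\otimes A)=(A\otimes\mu_B)\circ(R\otimes B)\circ(B\otimes R)$. Write $R(b\otimes a)=a_R\otimes b_R$ (summation omitted). The twisted tensor product $A\otimes_RB$ is $A\otimes B$ with product $(a\otimes b)(a'\otimes b')=aa'_R\otimes b_Rb'$. Any twisting map $R$ extends uniquely to a twisting map $\widetilde R:\Omega B\otimes\Omega A\to\Omega A\otimes\Omega B$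 with $\widetilde R\circ(d_B\otimes\Omega A)=(\varepsilon_A\otimes d_B)\circ\widetilde R$ and $\widetilde R\circ(\Omega B\otimes d_A)=(d_A\otimes\varepsilon_B)\circ\widetilde R$, where $\varepsilon(\omega)=(-1)^{|\omega|}\omega$. Then $\Omega A\otimes_{\widetilde R}\Omega B$, with differential $d(\varphi\otimes\omega)=d_A\varphi\otimes\omega+(-1)^{|\varphi|}\varphi\otimes d_B\omega$, is a differential calculus over $A\otimes_RB$ whose module of 1-forms is $\Omega^1A\otimes B\oplus A\otimes\Omega^1B$. A right module twisting map for a right $B$-module $F$ with action $\rho:F\otimes B\to F$ is a linear map $\tau_{F,A}:F\otimes A\to A\otimes F$, written $\tau_{F,A}(f\otimes a)=a_\tau\otimes f_\tau$, with $\tau_{F,A}\circ(F\otimes\mu_A)=(\mu_A\otimes F)\circ(A\otimes\tau_{F,A})\circ(\tau_{F,A}\otimes A)$ and $\tau_{F,A}\circ(\rho\otimes A)=(A\otimes\rho)\circ(\tau_{F,A}\otimes B)\circ(F\otimes R)$. The right $(A\otimes_RB)$-module structure on $E\otimes B\oplus A\otimes F$ is $(e\otimes b)\cdot(\alpha\otimes\beta)=e\alpha_R\otimes b_R\beta$ and $(a\otimes f)\cdot(\alpha\otimes\beta)=a\alpha_\tau\otimes f_\tau\beta$. The elements $e\otimes b$ and $a\otimes f$ are identified with $(e\otimes b,0)$ and $(0,a\otimes f)$. In the compatibility condition on $\nabla^F$, the composite $(\tau_{F,A}\otimes\Omega^1B)\circ(F\otimes\widetilde R)$ is computed on representatives,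 sending $f\otimes_B\eta\otimes a$ to $(a_{\widetilde R})_\tau\otimes f_\tau\otimes_B\eta_{\widetilde R}$, where $\widetilde R(\eta\otimes a)=a_{\widetilde R}\otimes\eta_{\widetilde R}$. Product connection. Let $\sigma_{A,F}=\tau_{F,A}^{-1}$, written $\sigma_{A,F}(a\otimes f)=\sum f_\sigma\otimes a_\sigma$. The (twisted) product connection is the right connection $\nabla:E\otimes B\oplus A\otimes F\to(E\otimes B\oplus A\otimes F)\otimes_{A\otimes_RB}(\Omega^1A\otimes B\oplus A\otimes\Omega^1B)$, $\nabla(e\otimes b,a\otimes f)=\nabla_1(e\otimes b)+\nabla_2(a\otimes f)$, with $$\nabla_1(e\otimes b)=\sum_i(e_i\otimes1)\otimes(d_Aa_i\otimes b)+(e\otimes1)\otimes(1\otimes d_Bb),\qquad \nabla^E(e)=\sum_ie_i\otimes_Ad_Aa_i,$$ $$\nabla_2(a\otimes f)=\sum_k(a\otimes f_k)\otimes(1\otimes d_Bb_k)+\sum(1\otimes f_\sigma)\otimes(d_A(a_\sigma)\otimes1),\qquad \nabla^F(f)=\sum_kf_k\otimes_Bd_Bb_k,$$ middle tensor products being over $A\otimes_RB$. $i_E$ and $i_F$ are the canonical inclusions (as vector spaces) of $E\otimes_A\Omega^2A$ and $F\otimes_B\Omega^2B$ into $(E\otimes B\oplus A\otimes F)\otimes_{A\otimes_RB}(\Omega A\otimes_{\widetilde R}\Omega B)^2$, namely $i_E(e\otimes_A\omega)=(e\otimes1)\otimes(\omega\otimes1)$ and $i_F(f\otimes_B\eta)=(1\otimes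 f)\otimes(1\otimes\eta)$. Further, $i_E(e\otimes_A\omega)\cdot b=(e\otimes1)\otimes(\omega\otimes b)$ and $a\cdot i_F(f\otimes_B\eta)=(a\otimes f)\otimes(1\otimes\eta)$. *)

theory Defs
  imports "HOL-Algebra.Algebra"
begin

section \<open>Vector spaces, algebras and right modules over a field\<close>

text \<open>
  Vector spaces are \<^locale>\<open>module\<close>s over a field; for a bare vector space the fields \<^const>\<open>monoid.mult\<close>
  and \<^const>\<open>monoid.one\<close> of the record are irrelevant.  The library locale \<^locale>\<open>algebra\<close> is restricted to
  commutative algebras, hence the following predicate.
\<close>

definition algebra_over :: "('k, 'x) ring_scheme \<Rightarrow> ('k, 'a, 'y) module_scheme \<Rightarrow> bool" where
  "algebra_over k A \<longleftrightarrow> ring A \<and> module k A \<and>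
     (\<forall>c \<in> carrier k. \<forall>x \<in> carrier A. \<forall>y \<in> carrier A.
        (c \<odot>\<^bsub>A\<^esub> x) \<otimes>\<^bsub>A\<^esub> y = c \<odot>\<^bsub>A\<^esub> (x \<otimes>\<^bsub>A\<^esub> y) \<and> x \<otimes>\<^bsub>A\<^esub> (c \<odot>\<^bsub>A\<^esub> y) = c \<odot>\<^bsub>A\<^esub> (x \<otimes>\<^bsub>A\<^esub> y))"

definition linear_over ::
  "('k, 'x) ring_scheme \<Rightarrow> ('k, 'm, 'y) module_scheme \<Rightarrow> ('k, 'n, 'z) module_scheme \<Rightarrow> ('m \<Rightarrow> 'n) \<Rightarrow> bool" where
  "linear_over k M N f \<longleftrightarrow> f \<in> carrier M \<rightarrow> carrier N \<and>
     (\<forall>x \<in> carrier M. \<forall>y \<in> carrier M. f (x \<oplus>\<^bsub>M\<^esub> y) = f x \<oplus>\<^bsub>N\<^esub> f y) \<and>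
     (\<forall>c \<in> carrier k. \<forall>x \<in> carrier M. f (c \<odot>\<^bsub>M\<^esub> x) = c \<odot>\<^bsub>N\<^esub> f x)"

definition right_module ::
  "('k, 'x) ring_scheme \<Rightarrow> ('k, 'd, 'y) module_scheme \<Rightarrow> ('k, 'm, 'z) module_scheme \<Rightarrow> ('m \<Rightarrow> 'd \<Rightarrow> 'm) \<Rightarrow> bool" where
  "right_module k D M r \<longleftrightarrow> module k M \<and>
     (\<forall>m \<in> carrier M. linear_over k D M (r m)) \<and>
     (\<forall>x \<in> carrier D. linear_over k M M (\<lambda>m. r m x)) \<and>
     (\<forall>m \<in> carrier M. r m \<one>\<^bsub>D\<^esub> = m) \<and>
     (\<forall>m \<in> carrier M. \<forall>x \<in> carrier D. \<forall>y \<in> carrier D. r m (x \<otimes>\<^bsub>D\<^esub> y) = r (r m x) y)"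

definition direct_sum ::
  "('k, 'm, 'x) module_scheme \<Rightarrow> ('k, 'n, 'y) module_scheme \<Rightarrow> ('k, 'm \<times> 'n) module" where
  "direct_sum M N = \<lparr>carrier = carrier M \<times> carrier N, monoid.mult = undefined, one = undefined,
     ring.zero = (\<zero>\<^bsub>M\<^esub>, \<zero>\<^bsub>N\<^esub>), ring.add = (\<lambda>(m, n) (m', n'). (m \<oplus>\<^bsub>M\<^esub> m', n \<oplus>\<^bsub>N\<^esub> n')),
     smult = (\<lambda>c (m, n). (c \<odot>\<^bsub>M\<^esub> m, c \<odot>\<^bsub>N\<^esub> n))\<rparr>"


section \<open>Tensor products\<close>

text \<open>
  Given a set \<open>S\<close> of scalars acting on \<open>M\<close> from the right by \<open>r\<close> and on \<open>N\<close> from the left by \<open>l\<close>,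
  the tensor product is the free abelian group on \<open>M \<times> N\<close> modulo biadditivity and
  \<open>(m \<cdot> x, n) = (m, x \<cdot> n)\<close>.  Its elements are cosets.  Both the tensor product of vector spaces
  and that of modules over an algebra are instances.
\<close>

type_synonym ('m, 'n) tensor = "('m \<times> 'n \<Rightarrow>\<^sub>0 int) set"

definition tens_rels ::
  "'d set \<Rightarrow> ('k, 'm, 'x) module_scheme \<Rightarrow> ('m \<Rightarrow> 'd \<Rightarrow> 'm) \<Rightarrow> ('k, 'n, 'y) module_scheme \<Rightarrow> ('d \<Rightarrow> 'n \<Rightarrow> 'n)
     \<Rightarrow> ('m, 'n) tensor" where
  "tens_rels S M r N l =
     {frag_of (m \<oplus>\<^bsub>M\<^esub> m', n) - frag_of (m, n) - frag_of (m', n) |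
        m m' n. m \<in> carrier M \<and> m' \<in> carrier M \<and> n \<in> carrier N} \<union>
     {frag_of (m, n \<oplus>\<^bsub>N\<^esub> n') - frag_of (m, n) - frag_of (m, n') |
        m n n'. m \<in> carrier M \<and> n \<in> carrier N \<and> n' \<in> carrier N} \<union>
     {frag_of (r m x, n) - frag_of (m, l x n) |
        m x n. m \<in> carrier M \<and> x \<in> S \<and> n \<in> carrier N}"

definition tens_null ::
  "'d set \<Rightarrow> ('k, 'm, 'x) module_scheme \<Rightarrow> ('m \<Rightarrow> 'd \<Rightarrow> 'm) \<Rightarrow> ('k, 'n, 'y) module_scheme \<Rightarrow> ('d \<Rightarrow> 'n \<Rightarrow> 'n)
     \<Rightarrow> ('m, 'n) tensor" where
  "tens_null S M r N l =
     generate (free_Abelian_group (carrier M \<times> carrier N)) (tens_rels S M r N l)"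

definition tens_pure ::
  "'d set \<Rightarrow> ('k, 'm, 'x) module_scheme \<Rightarrow> ('m \<Rightarrow> 'd \<Rightarrow> 'm) \<Rightarrow> ('k, 'n, 'y) module_scheme \<Rightarrow> ('d \<Rightarrow> 'n \<Rightarrow> 'n)
     \<Rightarrow> 'm \<Rightarrow> 'n \<Rightarrow> ('m, 'n) tensor" where
  "tens_pure S M r N l m n =
     tens_null S M r N l #>\<^bsub>free_Abelian_group (carrier M \<times> carrier N)\<^esub> frag_of (m, n)"

definition tens ::
  "'d set \<Rightarrow> ('k, 'm, 'x) module_scheme \<Rightarrow> ('m \<Rightarrow> 'd \<Rightarrow> 'm) \<Rightarrow> ('k, 'n, 'y) module_scheme \<Rightarrow> ('d \<Rightarrow> 'n \<Rightarrow> 'n)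
     \<Rightarrow> ('k, ('m, 'n) tensor) module" where
  "tens S M r N l =
     (let G = free_Abelian_group (carrier M \<times> carrier N); H = tens_null S M r N l
      in \<lparr>carrier = carrier (G Mod H), monoid.mult = undefined, one = undefined,
          ring.zero = \<one>\<^bsub>G Mod H\<^esub>, ring.add = monoid.mult (G Mod H),
          smult = (\<lambda>c t. H #>\<^bsub>G\<^esub> frag_extend (\<lambda>(m, n). frag_of (c \<odot>\<^bsub>M\<^esub> m, n)) (SOME p. p \<in> t))\<rparr>)"

text \<open>
  \<open>tens_lift T f t\<close> is \<open>\<Sum>\<^sub>i f m\<^sub>i n\<^sub>i\<close>, computed in \<open>T\<close>, for a representative \<open>\<Sum>\<^sub>i m\<^sub>i \<otimes> n\<^sub>i\<close> of the
  tensor \<open>t\<close>: the value at \<open>t\<close> of the additive map induced by a balanced map \<open>f\<close>.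
  Sweedler-type notation such as \<open>R (b \<otimes> a) = \<Sum> a\<^sub>R \<otimes> b\<^sub>R\<close> is rendered by it.
\<close>

definition tens_lift ::
  "('k, 't, 'x) module_scheme \<Rightarrow> ('m \<Rightarrow> 'n \<Rightarrow> 't) \<Rightarrow> ('m, 'n) tensor \<Rightarrow> 't" where
  "tens_lift T f t =
     (let p = SOME p. p \<in> t
      in \<Oplus>\<^bsub>T\<^esub>z \<in> Poly_Mapping.keys p. [Poly_Mapping.lookup p z] \<cdot>\<^bsub>T\<^esub> f (fst z) (snd z))"

definition ktens ::
  "('k, 'z) ring_scheme \<Rightarrow> ('k, 'm, 'x) module_scheme \<Rightarrow> ('k, 'n, 'y) module_scheme
     \<Rightarrow> ('k, ('m, 'n) tensor) module" where
  "ktens k M N = tens (carrier k) M (\<lambda>m c. c \<odot>\<^bsub>M\<^esub> m) N (\<lambda>c n. c \<odot>\<^bsub>N\<^esub> n)"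

definition kpure ::
  "('k, 'z) ring_scheme \<Rightarrow> ('k, 'm, 'x) module_scheme \<Rightarrow> ('k, 'n, 'y) module_scheme
     \<Rightarrow> 'm \<Rightarrow> 'n \<Rightarrow> ('m, 'n) tensor" where
  "kpure k M N = tens_pure (carrier k) M (\<lambda>m c. c \<odot>\<^bsub>M\<^esub> m) N (\<lambda>c n. c \<odot>\<^bsub>N\<^esub> n)"

definition span_in :: "('k, 'm, 'x) module_scheme \<Rightarrow> 'm set \<Rightarrow> 'm set" where
  "span_in T S = generate (add_monoid T) S"


section \<open>Differential calculi, connections and curvature\<close>

text \<open>
  The data of a differential calculus \<open>W = \<Omega>D\<close> over an algebra \<open>D\<close>: the underlying algebra, the
  differential, the homogeneous components \<open>\<Omega>\<^sup>nD\<close> (as subspaces of the whole), and the map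
  \<open>D \<rightarrow> \<Omega>D\<close> which identifies \<open>D\<close> with \<open>\<Omega>\<^sup>0D\<close>.
\<close>

record ('k, 'd, 'w) calculus = "('k, 'w) module" +
  dif :: "'w \<Rightarrow> 'w"
  grade :: "nat \<Rightarrow> 'w set"
  incl :: "'d \<Rightarrow> 'w"

definition sign_map :: "('k, 'z) ring_scheme \<Rightarrow> ('k, 'd, 'w, 'x) calculus_scheme \<Rightarrow> 'w \<Rightarrow> 'w" where
  "sign_map k W = (SOME f. linear_over k W W f \<and>
     (\<forall>n. \<forall>w \<in> grade W n. f w = ((\<ominus>\<^bsub>k\<^esub> \<one>\<^bsub>k\<^esub>) [^]\<^bsub>k\<^esub> n) \<odot>\<^bsub>W\<^esub> w))"

definition degree0_part ::
  "('k, 'z) ring_scheme \<Rightarrow> ('k, 'd, 'x) module_scheme \<Rightarrow> ('k, 'd, 'w, 'y) calculus_scheme \<Rightarrow> 'w \<Rightarrow> 'd" where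
  "degree0_part k D W = (SOME f. linear_over k W D f \<and>
     (\<forall>x \<in> carrier D. f (incl W x) = x) \<and> (\<forall>n > 0. \<forall>w \<in> grade W n. f w = \<zero>\<^bsub>D\<^esub>))"

text \<open>
  \<open>M \<otimes>\<^sub>D \<Omega>D\<close>; the summand \<open>M \<otimes>\<^sub>D \<Omega>\<^sup>nD\<close> is regarded as a subspace of it.
\<close>

definition forms ::
  "('k, 'd, 'y) module_scheme \<Rightarrow> ('k, 'd, 'w, 'z) calculus_scheme \<Rightarrow> ('k, 'm, 'x) module_scheme
     \<Rightarrow> ('m \<Rightarrow> 'd \<Rightarrow> 'm) \<Rightarrow> ('k, ('m, 'w) tensor) module" where
  "forms D W M r = tens (carrier D) M r W (\<lambda>x w. incl W x \<otimes>\<^bsub>W\<^esub> w)"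

definition fpure ::
  "('k, 'd, 'y) module_scheme \<Rightarrow> ('k, 'd, 'w, 'z) calculus_scheme \<Rightarrow> ('k, 'm, 'x) module_scheme
     \<Rightarrow> ('m \<Rightarrow> 'd \<Rightarrow> 'm) \<Rightarrow> 'm \<Rightarrow> 'w \<Rightarrow> ('m, 'w) tensor" where
  "fpure D W M r = tens_pure (carrier D) M r W (\<lambda>x w. incl W x \<otimes>\<^bsub>W\<^esub> w)"

definition forms_comp ::
  "('k, 'd, 'y) module_scheme \<Rightarrow> ('k, 'd, 'w, 'z) calculus_scheme \<Rightarrow> ('k, 'm, 'x) module_scheme
     \<Rightarrow> ('m \<Rightarrow> 'd \<Rightarrow> 'm) \<Rightarrow> nat \<Rightarrow> ('m, 'w) tensor set" where
  "forms_comp D W M r n =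
     span_in (forms D W M r) {fpure D W M r m w | m w. m \<in> carrier M \<and> w \<in> grade W n}"

definition forms_act ::
  "('k, 'd, 'y) module_scheme \<Rightarrow> ('k, 'd, 'w, 'z) calculus_scheme \<Rightarrow> ('k, 'm, 'x) module_scheme
     \<Rightarrow> ('m \<Rightarrow> 'd \<Rightarrow> 'm) \<Rightarrow> ('m, 'w) tensor \<Rightarrow> 'w \<Rightarrow> ('m, 'w) tensor" where
  "forms_act D W M r t w' = tens_lift (forms D W M r) (\<lambda>m w. fpure D W M r m (w \<otimes>\<^bsub>W\<^esub> w')) t"

definition right_connection ::
  "('k, 'v) ring_scheme \<Rightarrow> ('k, 'd, 'y) module_scheme \<Rightarrow> ('k, 'd, 'w, 'z) calculus_scheme
     \<Rightarrow> ('k, 'm, 'x) module_scheme \<Rightarrow> ('m \<Rightarrow> 'd \<Rightarrow> 'm) \<Rightarrow> ('m \<Rightarrow> ('m, 'w) tensor) \<Rightarrow> bool" where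
  "right_connection k D W M r nab \<longleftrightarrow>
     linear_over k M (forms D W M r) nab \<and>
     (\<forall>m \<in> carrier M. nab m \<in> forms_comp D W M r 1) \<and>
     (\<forall>m \<in> carrier M. \<forall>x \<in> carrier D.
        nab (r m x) = forms_act D W M r (nab m) (incl W x)
          \<oplus>\<^bsub>forms D W M r\<^esub> fpure D W M r m (dif W (incl W x)))"

text \<open>
  The extension of a connection is a single operator on \<open>M \<otimes>\<^sub>D \<Omega>D\<close>; the component of degree \<open>n\<close> is its
  restriction to \<^const>\<open>forms_comp\<close> in degree \<open>n\<close>, and in degree \<open>0\<close> it is the connection itself
  (identifying \<open>M \<otimes>\<^sub>D D\<close> with \<open>M\<close>).
\<close>

definition extended_connection ::
  "('k, 'd, 'y) module_scheme \<Rightarrow> ('k, 'd, 'w, 'z) calculus_scheme \<Rightarrow> ('k, 'm, 'x) module_scheme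
     \<Rightarrow> ('m \<Rightarrow> 'd \<Rightarrow> 'm) \<Rightarrow> ('m \<Rightarrow> ('m, 'w) tensor) \<Rightarrow> ('m, 'w) tensor \<Rightarrow> ('m, 'w) tensor" where
  "extended_connection D W M r nab t =
     tens_lift (forms D W M r)
       (\<lambda>m w. forms_act D W M r (nab m) w \<oplus>\<^bsub>forms D W M r\<^esub> fpure D W M r m (dif W w)) t"

definition curvature ::
  "('k, 'd, 'y) module_scheme \<Rightarrow> ('k, 'd, 'w, 'z) calculus_scheme \<Rightarrow> ('k, 'm, 'x) module_scheme
     \<Rightarrow> ('m \<Rightarrow> 'd \<Rightarrow> 'm) \<Rightarrow> ('m \<Rightarrow> ('m, 'w) tensor) \<Rightarrow> 'm \<Rightarrow> ('m, 'w) tensor" where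
  "curvature D W M r nab m = extended_connection D W M r nab (nab m)"


section \<open>The universal differential graded algebra\<close>

text \<open>
  The universal differential graded algebra of \<open>A\<close> is obtained from formal expressions in the
  elements of \<open>A\<close> by imposing exactly the axioms of a differential graded algebra over \<open>k\<close> and
  the requirement that \<open>A\<close> is mapped to degree \<open>0\<close> by a homomorphism of unital algebras.
  \<open>homog k A n t\<close> says that \<open>t\<close> is a homogeneous expression of degree \<open>n\<close>.
\<close>

datatype ('k, 'a) dgterm =
    Gen 'a
  | Zero
  | Plus "('k, 'a) dgterm" "('k, 'a) dgterm"
  | Scal 'k "('k, 'a) dgterm"
  | Times "('k, 'a) dgterm" "('k, 'a) dgterm"
  | Dif "('k, 'a) dgterm"

definition dgterms :: "('k, 'z) ring_scheme \<Rightarrow> ('k, 'a, 'x) module_scheme \<Rightarrow> ('k, 'a) dgterm set" where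
  "dgterms k A = {t. set1_dgterm t \<subseteq> carrier k \<and> set2_dgterm t \<subseteq> carrier A}"

inductive homog :: "('k, 'z) ring_scheme \<Rightarrow> ('k, 'a, 'x) module_scheme \<Rightarrow> nat \<Rightarrow> ('k, 'a) dgterm \<Rightarrow> bool"
  for k A where
  "a \<in> carrier A \<Longrightarrow> homog k A 0 (Gen a)"
| "homog k A n Zero"
| "homog k A n s \<Longrightarrow> homog k A n t \<Longrightarrow> homog k A n (Plus s t)"
| "c \<in> carrier k \<Longrightarrow> homog k A n t \<Longrightarrow> homog k A n (Scal c t)"
| "homog k A m s \<Longrightarrow> homog k A n t \<Longrightarrow> homog k A (m + n) (Times s t)"
| "homog k A n t \<Longrightarrow> homog k A (Suc n) (Dif t)"

inductive dgeq :: "('k, 'z) ring_scheme \<Rightarrow> ('k, 'a, 'x) module_scheme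
    \<Rightarrow> ('k, 'a) dgterm \<Rightarrow> ('k, 'a) dgterm \<Rightarrow> bool"
  for k A where
  dgeq_refl: "t \<in> dgterms k A \<Longrightarrow> dgeq k A t t"
| dgeq_sym: "dgeq k A s t \<Longrightarrow> dgeq k A t s"
| dgeq_trans: "dgeq k A s t \<Longrightarrow> dgeq k A t u \<Longrightarrow> dgeq k A s u"
| cong_Plus: "dgeq k A s s' \<Longrightarrow> dgeq k A t t' \<Longrightarrow> dgeq k A (Plus s t) (Plus s' t')"
| cong_Scal: "c \<in> carrier k \<Longrightarrow> dgeq k A t t' \<Longrightarrow> dgeq k A (Scal c t) (Scal c t')"
| cong_Times: "dgeq k A s s' \<Longrightarrow> dgeq k A t t' \<Longrightarrow> dgeq k A (Times s t) (Times s' t')"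
| cong_Dif: "dgeq k A t t' \<Longrightarrow> dgeq k A (Dif t) (Dif t')"
| Plus_assoc: "\<lbrakk>s \<in> dgterms k A; t \<in> dgterms k A; u \<in> dgterms k A\<rbrakk>
    \<Longrightarrow> dgeq k A (Plus (Plus s t) u) (Plus s (Plus t u))"
| Plus_comm: "\<lbrakk>s \<in> dgterms k A; t \<in> dgterms k A\<rbrakk> \<Longrightarrow> dgeq k A (Plus s t) (Plus t s)"
| Plus_Zero: "t \<in> dgterms k A \<Longrightarrow> dgeq k A (Plus Zero t) t"
| Plus_inv: "t \<in> dgterms k A \<Longrightarrow> dgeq k A (Plus t (Scal (\<ominus>\<^bsub>k\<^esub> \<one>\<^bsub>k\<^esub>) t)) Zero"
| Scal_add: "\<lbrakk>c \<in> carrier k; c' \<in> carrier k; t \<in> dgterms k A\<rbrakk>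
    \<Longrightarrow> dgeq k A (Scal (c \<oplus>\<^bsub>k\<^esub> c') t) (Plus (Scal c t) (Scal c' t))"
| Scal_Plus: "\<lbrakk>c \<in> carrier k; s \<in> dgterms k A; t \<in> dgterms k A\<rbrakk>
    \<Longrightarrow> dgeq k A (Scal c (Plus s t)) (Plus (Scal c s) (Scal c t))"
| Scal_mult: "\<lbrakk>c \<in> carrier k; c' \<in> carrier k; t \<in> dgterms k A\<rbrakk>
    \<Longrightarrow> dgeq k A (Scal (c \<otimes>\<^bsub>k\<^esub> c') t) (Scal c (Scal c' t))"
| Scal_one: "t \<in> dgterms k A \<Longrightarrow> dgeq k A (Scal \<one>\<^bsub>k\<^esub> t) t"
| Times_assoc: "\<lbrakk>s \<in> dgterms k A; t \<in> dgterms k A; u \<in> dgterms k A\<rbrakk>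
    \<Longrightarrow> dgeq k A (Times (Times s t) u) (Times s (Times t u))"
| Times_one_left: "t \<in> dgterms k A \<Longrightarrow> dgeq k A (Times (Gen \<one>\<^bsub>A\<^esub>) t) t"
| Times_one_right: "t \<in> dgterms k A \<Longrightarrow> dgeq k A (Times t (Gen \<one>\<^bsub>A\<^esub>)) t"
| Times_Plus_left: "\<lbrakk>s \<in> dgterms k A; t \<in> dgterms k A; u \<in> dgterms k A\<rbrakk>
    \<Longrightarrow> dgeq k A (Times (Plus s t) u) (Plus (Times s u) (Times t u))"
| Times_Plus_right: "\<lbrakk>s \<in> dgterms k A; t \<in> dgterms k A; u \<in> dgterms k A\<rbrakk>
    \<Longrightarrow> dgeq k A (Times s (Plus t u)) (Plus (Times s t) (Times s u))"
| Times_Scal_left: "\<lbrakk>c \<in> carrier k; s \<in> dgterms k A; t \<in> dgterms k A\<rbrakk>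
    \<Longrightarrow> dgeq k A (Times (Scal c s) t) (Scal c (Times s t))"
| Times_Scal_right: "\<lbrakk>c \<in> carrier k; s \<in> dgterms k A; t \<in> dgterms k A\<rbrakk>
    \<Longrightarrow> dgeq k A (Times s (Scal c t)) (Scal c (Times s t))"
| Gen_add: "\<lbrakk>a \<in> carrier A; a' \<in> carrier A\<rbrakk> \<Longrightarrow> dgeq k A (Gen (a \<oplus>\<^bsub>A\<^esub> a')) (Plus (Gen a) (Gen a'))"
| Gen_smult: "\<lbrakk>c \<in> carrier k; a \<in> carrier A\<rbrakk> \<Longrightarrow> dgeq k A (Gen (c \<odot>\<^bsub>A\<^esub> a)) (Scal c (Gen a))"
| Gen_mult: "\<lbrakk>a \<in> carrier A; a' \<in> carrier A\<rbrakk> \<Longrightarrow> dgeq k A (Gen (a \<otimes>\<^bsub>A\<^esub> a')) (Times (Gen a) (Gen a'))"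
| Dif_Plus: "\<lbrakk>s \<in> dgterms k A; t \<in> dgterms k A\<rbrakk> \<Longrightarrow> dgeq k A (Dif (Plus s t)) (Plus (Dif s) (Dif t))"
| Dif_Scal: "\<lbrakk>c \<in> carrier k; t \<in> dgterms k A\<rbrakk> \<Longrightarrow> dgeq k A (Dif (Scal c t)) (Scal c (Dif t))"
| Dif_Dif: "t \<in> dgterms k A \<Longrightarrow> dgeq k A (Dif (Dif t)) Zero"
| Dif_Times: "\<lbrakk>homog k A n s; t \<in> dgterms k A\<rbrakk> \<Longrightarrow>
    dgeq k A (Dif (Times s t))
      (Plus (Times (Dif s) t) (Scal ((\<ominus>\<^bsub>k\<^esub> \<one>\<^bsub>k\<^esub>) [^]\<^bsub>k\<^esub> n) (Times s (Dif t))))"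

type_synonym ('k, 'a) uform = "('k, 'a) dgterm set"

definition dgclass ::
  "('k, 'z) ring_scheme \<Rightarrow> ('k, 'a, 'x) module_scheme \<Rightarrow> ('k, 'a) dgterm \<Rightarrow> ('k, 'a) uform" where
  "dgclass k A t = {s. dgeq k A t s}"

definition universal_calculus ::
  "('k, 'z) ring_scheme \<Rightarrow> ('k, 'a, 'x) module_scheme \<Rightarrow> ('k, 'a, ('k, 'a) uform) calculus" where
  "universal_calculus k A =
     (let rep = (\<lambda>w. SOME t. t \<in> w)
      in \<lparr>carrier = dgclass k A ` dgterms k A,
          monoid.mult = (\<lambda>v w. dgclass k A (Times (rep v) (rep w))),
          one = dgclass k A (Gen \<one>\<^bsub>A\<^esub>),
          ring.zero = dgclass k A Zero,
          ring.add = (\<lambda>v w. dgclass k A (Plus (rep v) (rep w))),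
          smult = (\<lambda>c w. dgclass k A (Scal c (rep w))),
          dif = (\<lambda>w. dgclass k A (Dif (rep w))),
          grade = (\<lambda>n. dgclass k A ` {t. homog k A n t}),
          incl = (\<lambda>a. dgclass k A (Gen a))\<rparr>)"


section \<open>Twisting maps\<close>

text \<open>
  Equalities between linear maps on tensor products are stated on pure tensors, in Sweedler-type
  notation.  E.g. the third condition on a twisting map reads
  \<open>R (b \<otimes> a a') = \<Sum> a\<^sub>R a'\<^sub>r \<otimes> (b\<^sub>R)\<^sub>r\<close>.
\<close>

definition twisting_map ::
  "('k, 'z) ring_scheme \<Rightarrow> ('k, 'a, 'x) module_scheme \<Rightarrow> ('k, 'b, 'y) module_scheme
     \<Rightarrow> (('b, 'a) tensor \<Rightarrow> ('a, 'b) tensor) \<Rightarrow> bool" where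
  "twisting_map k A B R \<longleftrightarrow>
     linear_over k (ktens k B A) (ktens k A B) R \<and>
     (\<forall>b \<in> carrier B. R (kpure k B A b \<one>\<^bsub>A\<^esub>) = kpure k A B \<one>\<^bsub>A\<^esub> b) \<and>
     (\<forall>a \<in> carrier A. R (kpure k B A \<one>\<^bsub>B\<^esub> a) = kpure k A B a \<one>\<^bsub>B\<^esub>) \<and>
     (\<forall>b \<in> carrier B. \<forall>a \<in> carrier A. \<forall>a' \<in> carrier A.
        R (kpure k B A b (a \<otimes>\<^bsub>A\<^esub> a')) =
        tens_lift (ktens k A B) (\<lambda>aR bR.
          tens_lift (ktens k A B) (\<lambda>ar br. kpure k A B (aR \<otimes>\<^bsub>A\<^esub> ar) br)
            (R (kpure k B A bR a')))
          (R (kpure k B A b a))) \<and>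
     (\<forall>b \<in> carrier B. \<forall>b' \<in> carrier B. \<forall>a \<in> carrier A.
        R (kpure k B A (b \<otimes>\<^bsub>B\<^esub> b') a) =
        tens_lift (ktens k A B) (\<lambda>aR bR.
          tens_lift (ktens k A B) (\<lambda>ar br. kpure k A B ar (br \<otimes>\<^bsub>B\<^esub> bR))
            (R (kpure k B A b aR)))
          (R (kpure k B A b' a)))"

definition twisted_mult ::
  "('k, 'z) ring_scheme \<Rightarrow> ('k, 'a, 'x) module_scheme \<Rightarrow> ('k, 'b, 'y) module_scheme
     \<Rightarrow> (('b, 'a) tensor \<Rightarrow> ('a, 'b) tensor)
     \<Rightarrow> ('a, 'b) tensor \<Rightarrow> ('a, 'b) tensor \<Rightarrow> ('a, 'b) tensor" where
  "twisted_mult k A B R s t =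
     tens_lift (ktens k A B) (\<lambda>a b.
       tens_lift (ktens k A B) (\<lambda>a' b'.
         tens_lift (ktens k A B) (\<lambda>aR bR. kpure k A B (a \<otimes>\<^bsub>A\<^esub> aR) (bR \<otimes>\<^bsub>B\<^esub> b'))
           (R (kpure k B A b a'))) t) s"

definition twisted_algebra ::
  "('k, 'z) ring_scheme \<Rightarrow> ('k, 'a, 'x) module_scheme \<Rightarrow> ('k, 'b, 'y) module_scheme
     \<Rightarrow> (('b, 'a) tensor \<Rightarrow> ('a, 'b) tensor) \<Rightarrow> ('k, ('a, 'b) tensor) module" where
  "twisted_algebra k A B R =
     (ktens k A B)\<lparr>monoid.mult := twisted_mult k A B R, one := kpure k A B \<one>\<^bsub>A\<^esub> \<one>\<^bsub>B\<^esub>\<rparr>"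

text \<open>
  \<open>Rt\<close> is the (unique) extension of \<open>R\<close> to a twisting map on the universal differential graded
  algebras that is compatible with the differentials.
\<close>

definition twisting_extension ::
  "('k, 'z) ring_scheme \<Rightarrow> ('k, 'a, 'x) module_scheme \<Rightarrow> ('k, 'b, 'y) module_scheme
     \<Rightarrow> (('b, 'a) tensor \<Rightarrow> ('a, 'b) tensor)
     \<Rightarrow> ((('k, 'b) uform, ('k, 'a) uform) tensor \<Rightarrow> (('k, 'a) uform, ('k, 'b) uform) tensor) \<Rightarrow> bool" where
  "twisting_extension k A B R Rt \<longleftrightarrow>
     (let WA = universal_calculus k A; WB = universal_calculus k B; T = ktens k WA WB
      in twisting_map k WA WB Rt \<and>
         (\<forall>b \<in> carrier B. \<forall>a \<in> carrier A.
            Rt (kpure k WB WA (incl WB b) (incl WA a)) =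
            tens_lift T (\<lambda>aR bR. kpure k WA WB (incl WA aR) (incl WB bR)) (R (kpure k B A b a))) \<and>
         (\<forall>\<eta> \<in> carrier WB. \<forall>\<phi> \<in> carrier WA.
            Rt (kpure k WB WA (dif WB \<eta>) \<phi>) =
            tens_lift T (\<lambda>\<phi>R \<eta>R. kpure k WA WB (sign_map k WA \<phi>R) (dif WB \<eta>R))
              (Rt (kpure k WB WA \<eta> \<phi>))) \<and>
         (\<forall>\<eta> \<in> carrier WB. \<forall>\<phi> \<in> carrier WA.
            Rt (kpure k WB WA \<eta> (dif WA \<phi>)) =
            tens_lift T (\<lambda>\<phi>R \<eta>R. kpure k WA WB (dif WA \<phi>R) (sign_map k WB \<eta>R))
              (Rt (kpure k WB WA \<eta> \<phi>))))"

definition twisted_calculus ::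
  "('k, 'z) ring_scheme \<Rightarrow> ('k, 'a, 'x) module_scheme \<Rightarrow> ('k, 'b, 'y) module_scheme
     \<Rightarrow> ((('k, 'b) uform, ('k, 'a) uform) tensor \<Rightarrow> (('k, 'a) uform, ('k, 'b) uform) tensor)
     \<Rightarrow> ('k, ('a, 'b) tensor, (('k, 'a) uform, ('k, 'b) uform) tensor) calculus" where
  "twisted_calculus k A B Rt =
     (let WA = universal_calculus k A; WB = universal_calculus k B; T = twisted_algebra k WA WB Rt
      in module.extend T
        \<lparr>dif = tens_lift T (\<lambda>\<phi> \<omega>. kpure k WA WB (dif WA \<phi>) \<omega>
                 \<oplus>\<^bsub>T\<^esub> kpure k WA WB (sign_map k WA \<phi>) (dif WB \<omega>)),
         grade = (\<lambda>n. span_in T {kpure k WA WB \<phi> \<omega> | \<phi> \<omega> p q.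
                        \<phi> \<in> grade WA p \<and> \<omega> \<in> grade WB q \<and> p + q = n}),
         incl = tens_lift T (\<lambda>a b. kpure k WA WB (incl WA a) (incl WB b))\<rparr>)"

definition module_twisting_map ::
  "('k, 'z) ring_scheme \<Rightarrow> ('k, 'a, 'x) module_scheme \<Rightarrow> ('k, 'b, 'y) module_scheme
     \<Rightarrow> (('b, 'a) tensor \<Rightarrow> ('a, 'b) tensor)
     \<Rightarrow> ('k, 'f, 'v) module_scheme \<Rightarrow> ('f \<Rightarrow> 'b \<Rightarrow> 'f)
     \<Rightarrow> (('f, 'a) tensor \<Rightarrow> ('a, 'f) tensor) \<Rightarrow> bool" where
  "module_twisting_map k A B R F rF \<tau> \<longleftrightarrow>
     linear_over k (ktens k F A) (ktens k A F) \<tau> \<and>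
     (\<forall>f \<in> carrier F. \<forall>a \<in> carrier A. \<forall>a' \<in> carrier A.
        \<tau> (kpure k F A f (a \<otimes>\<^bsub>A\<^esub> a')) =
        tens_lift (ktens k A F) (\<lambda>a1 f1.
          tens_lift (ktens k A F) (\<lambda>a2 f2. kpure k A F (a1 \<otimes>\<^bsub>A\<^esub> a2) f2) (\<tau> (kpure k F A f1 a')))
          (\<tau> (kpure k F A f a))) \<and>
     (\<forall>f \<in> carrier F. \<forall>b \<in> carrier B. \<forall>a \<in> carrier A.
        \<tau> (kpure k F A (rF f b) a) =
        tens_lift (ktens k A F) (\<lambda>aR bR.
          tens_lift (ktens k A F) (\<lambda>a1 f1. kpure k A F a1 (rF f1 bR)) (\<tau> (kpure k F A f aR)))
          (R (kpure k B A b a)))"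

text \<open>
  Both sides are evaluated at \<open>f \<otimes> a\<close>, in \<open>A \<otimes> (F \<otimes>\<^sub>B \<Omega>B)\<close>.  Since \<open>Rt (\<eta> \<otimes> a)\<close> has degree \<open>0\<close> in
  \<open>\<Omega>A\<close>, its first tensor factors are elements of \<open>A\<close> via \<^const>\<open>degree0_part\<close>.
\<close>

definition twisting_compatible ::
  "('k, 'z) ring_scheme \<Rightarrow> ('k, 'a, 'x) module_scheme \<Rightarrow> ('k, 'b, 'y) module_scheme
     \<Rightarrow> ((('k, 'b) uform, ('k, 'a) uform) tensor \<Rightarrow> (('k, 'a) uform, ('k, 'b) uform) tensor)
     \<Rightarrow> ('k, 'f, 'v) module_scheme \<Rightarrow> ('f \<Rightarrow> 'b \<Rightarrow> 'f)
     \<Rightarrow> (('f, 'a) tensor \<Rightarrow> ('a, 'f) tensor) \<Rightarrow> ('f \<Rightarrow> ('f, ('k, 'b) uform) tensor) \<Rightarrow> bool" where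
  "twisting_compatible k A B Rt F rF \<tau> nabF \<longleftrightarrow>
     (let WA = universal_calculus k A; WB = universal_calculus k B;
          FW = forms B WB F rF; T = ktens k A FW
      in \<forall>f \<in> carrier F. \<forall>a \<in> carrier A.
           tens_lift T (\<lambda>a' f'. kpure k A FW a' (nabF f')) (\<tau> (kpure k F A f a)) =
           tens_lift T (\<lambda>f' \<eta>.
             tens_lift T (\<lambda>aR \<eta>R.
               tens_lift T (\<lambda>a2 f2. kpure k A FW a2 (fpure B WB F rF f2 \<eta>R))
                 (\<tau> (kpure k F A f' (degree0_part k A WA aR))))
               (Rt (kpure k WB WA \<eta> (incl WA a))))
             (nabF f))"


section \<open>The product connection\<close>

definition prod_module ::
  "('k, 'z) ring_scheme \<Rightarrow> ('k, 'a, 'x) module_scheme \<Rightarrow> ('k, 'b, 'y) module_scheme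
     \<Rightarrow> ('k, 'e, 'u) module_scheme \<Rightarrow> ('k, 'f, 'v) module_scheme
     \<Rightarrow> ('k, ('e, 'b) tensor \<times> ('a, 'f) tensor) module" where
  "prod_module k A B E F = direct_sum (ktens k E B) (ktens k A F)"

definition prod_act ::
  "('k, 'z) ring_scheme \<Rightarrow> ('k, 'a, 'x) module_scheme \<Rightarrow> ('k, 'b, 'y) module_scheme
     \<Rightarrow> (('b, 'a) tensor \<Rightarrow> ('a, 'b) tensor)
     \<Rightarrow> ('k, 'e, 'u) module_scheme \<Rightarrow> ('e \<Rightarrow> 'a \<Rightarrow> 'e)
     \<Rightarrow> ('k, 'f, 'v) module_scheme \<Rightarrow> ('f \<Rightarrow> 'b \<Rightarrow> 'f) \<Rightarrow> (('f, 'a) tensor \<Rightarrow> ('a, 'f) tensor)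
     \<Rightarrow> ('e, 'b) tensor \<times> ('a, 'f) tensor \<Rightarrow> ('a, 'b) tensor
     \<Rightarrow> ('e, 'b) tensor \<times> ('a, 'f) tensor" where
  "prod_act k A B R E rE F rF \<tau> m d =
     (tens_lift (ktens k E B) (\<lambda>e b.
        tens_lift (ktens k E B) (\<lambda>\<alpha> \<beta>.
          tens_lift (ktens k E B) (\<lambda>\<alpha>R bR. kpure k E B (rE e \<alpha>R) (bR \<otimes>\<^bsub>B\<^esub> \<beta>))
            (R (kpure k B A b \<alpha>))) d) (fst m),
      tens_lift (ktens k A F) (\<lambda>a f.
        tens_lift (ktens k A F) (\<lambda>\<alpha> \<beta>.
          tens_lift (ktens k A F) (\<lambda>\<alpha>\<tau> f\<tau>. kpure k A F (a \<otimes>\<^bsub>A\<^esub> \<alpha>\<tau>) (rF f\<tau> \<beta>))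
            (\<tau> (kpure k F A f \<alpha>))) d) (snd m))"

definition elemE ::
  "('k, 'z) ring_scheme \<Rightarrow> ('k, 'a, 'x) module_scheme \<Rightarrow> ('k, 'b, 'y) module_scheme
     \<Rightarrow> ('k, 'e, 'u) module_scheme \<Rightarrow> ('k, 'f, 'v) module_scheme
     \<Rightarrow> 'e \<Rightarrow> 'b \<Rightarrow> ('e, 'b) tensor \<times> ('a, 'f) tensor" where
  "elemE k A B E F e b = (kpure k E B e b, \<zero>\<^bsub>ktens k A F\<^esub>)"

definition elemF ::
  "('k, 'z) ring_scheme \<Rightarrow> ('k, 'a, 'x) module_scheme \<Rightarrow> ('k, 'b, 'y) module_scheme
     \<Rightarrow> ('k, 'e, 'u) module_scheme \<Rightarrow> ('k, 'f, 'v) module_scheme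
     \<Rightarrow> 'a \<Rightarrow> 'f \<Rightarrow> ('e, 'b) tensor \<times> ('a, 'f) tensor" where
  "elemF k A B E F a f = (\<zero>\<^bsub>ktens k E B\<^esub>, kpure k A F a f)"

definition prod_forms ::
  "('k, 'z) ring_scheme \<Rightarrow> ('k, 'a, 'x) module_scheme \<Rightarrow> ('k, 'b, 'y) module_scheme
     \<Rightarrow> (('b, 'a) tensor \<Rightarrow> ('a, 'b) tensor)
     \<Rightarrow> ((('k, 'b) uform, ('k, 'a) uform) tensor \<Rightarrow> (('k, 'a) uform, ('k, 'b) uform) tensor)
     \<Rightarrow> ('k, 'e, 'u) module_scheme \<Rightarrow> ('e \<Rightarrow> 'a \<Rightarrow> 'e)
     \<Rightarrow> ('k, 'f, 'v) module_scheme \<Rightarrow> ('f \<Rightarrow> 'b \<Rightarrow> 'f) \<Rightarrow> (('f, 'a) tensor \<Rightarrow> ('a, 'f) tensor)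
     \<Rightarrow> ('k, (('e, 'b) tensor \<times> ('a, 'f) tensor, (('k, 'a) uform, ('k, 'b) uform) tensor) tensor) module" where
  "prod_forms k A B R Rt E rE F rF \<tau> =
     forms (twisted_algebra k A B R) (twisted_calculus k A B Rt)
       (prod_module k A B E F) (prod_act k A B R E rE F rF \<tau>)"

definition prod_fpure ::
  "('k, 'z) ring_scheme \<Rightarrow> ('k, 'a, 'x) module_scheme \<Rightarrow> ('k, 'b, 'y) module_scheme
     \<Rightarrow> (('b, 'a) tensor \<Rightarrow> ('a, 'b) tensor)
     \<Rightarrow> ((('k, 'b) uform, ('k, 'a) uform) tensor \<Rightarrow> (('k, 'a) uform, ('k, 'b) uform) tensor)
     \<Rightarrow> ('k, 'e, 'u) module_scheme \<Rightarrow> ('e \<Rightarrow> 'a \<Rightarrow> 'e)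
     \<Rightarrow> ('k, 'f, 'v) module_scheme \<Rightarrow> ('f \<Rightarrow> 'b \<Rightarrow> 'f) \<Rightarrow> (('f, 'a) tensor \<Rightarrow> ('a, 'f) tensor)
     \<Rightarrow> ('e, 'b) tensor \<times> ('a, 'f) tensor \<Rightarrow> ('k, 'a) uform \<Rightarrow> ('k, 'b) uform
     \<Rightarrow> (('e, 'b) tensor \<times> ('a, 'f) tensor, (('k, 'a) uform, ('k, 'b) uform) tensor) tensor" where
  "prod_fpure k A B R Rt E rE F rF \<tau> m \<phi> \<omega> =
     fpure (twisted_algebra k A B R) (twisted_calculus k A B Rt)
       (prod_module k A B E F) (prod_act k A B R E rE F rF \<tau>) m
       (kpure k (universal_calculus k A) (universal_calculus k B) \<phi> \<omega>)"

text \<open>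
  \<open>inclE_act \<dots> t b\<close> is \<open>i\<^sub>E(t) \<cdot> b\<close>, i.e. \<open>e \<otimes>\<^sub>A \<omega> \<mapsto> (e \<otimes> 1) \<otimes> (\<omega> \<otimes> b)\<close>, and \<open>act_inclF \<dots> a t\<close> is
  \<open>a \<cdot> i\<^sub>F(t)\<close>, i.e. \<open>f \<otimes>\<^sub>B \<eta> \<mapsto> (a \<otimes> f) \<otimes> (1 \<otimes> \<eta>)\<close>.  In degree \<open>1\<close> they give the first
  summands of \<open>\<nabla>\<^sub>1(e \<otimes> b)\<close> and \<open>\<nabla>\<^sub>2(a \<otimes> f)\<close>, for \<open>t\<close> the value of the given connection at \<open>e\<close> and \<open>f\<close>.
\<close>

definition inclE_act ::
  "('k, 'z) ring_scheme \<Rightarrow> ('k, 'a, 'x) module_scheme \<Rightarrow> ('k, 'b, 'y) module_scheme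
     \<Rightarrow> (('b, 'a) tensor \<Rightarrow> ('a, 'b) tensor)
     \<Rightarrow> ((('k, 'b) uform, ('k, 'a) uform) tensor \<Rightarrow> (('k, 'a) uform, ('k, 'b) uform) tensor)
     \<Rightarrow> ('k, 'e, 'u) module_scheme \<Rightarrow> ('e \<Rightarrow> 'a \<Rightarrow> 'e)
     \<Rightarrow> ('k, 'f, 'v) module_scheme \<Rightarrow> ('f \<Rightarrow> 'b \<Rightarrow> 'f) \<Rightarrow> (('f, 'a) tensor \<Rightarrow> ('a, 'f) tensor)
     \<Rightarrow> ('e, ('k, 'a) uform) tensor \<Rightarrow> 'b
     \<Rightarrow> (('e, 'b) tensor \<times> ('a, 'f) tensor, (('k, 'a) uform, ('k, 'b) uform) tensor) tensor" where
  "inclE_act k A B R Rt E rE F rF \<tau> t b =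
     tens_lift (prod_forms k A B R Rt E rE F rF \<tau>)
       (\<lambda>e \<omega>. prod_fpure k A B R Rt E rE F rF \<tau> (elemE k A B E F e \<one>\<^bsub>B\<^esub>) \<omega>
          (incl (universal_calculus k B) b)) t"

definition act_inclF ::
  "('k, 'z) ring_scheme \<Rightarrow> ('k, 'a, 'x) module_scheme \<Rightarrow> ('k, 'b, 'y) module_scheme
     \<Rightarrow> (('b, 'a) tensor \<Rightarrow> ('a, 'b) tensor)
     \<Rightarrow> ((('k, 'b) uform, ('k, 'a) uform) tensor \<Rightarrow> (('k, 'a) uform, ('k, 'b) uform) tensor)
     \<Rightarrow> ('k, 'e, 'u) module_scheme \<Rightarrow> ('e \<Rightarrow> 'a \<Rightarrow> 'e)
     \<Rightarrow> ('k, 'f, 'v) module_scheme \<Rightarrow> ('f \<Rightarrow> 'b \<Rightarrow> 'f) \<Rightarrow> (('f, 'a) tensor \<Rightarrow> ('a, 'f) tensor)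
     \<Rightarrow> 'a \<Rightarrow> ('f, ('k, 'b) uform) tensor
     \<Rightarrow> (('e, 'b) tensor \<times> ('a, 'f) tensor, (('k, 'a) uform, ('k, 'b) uform) tensor) tensor" where
  "act_inclF k A B R Rt E rE F rF \<tau> a t =
     tens_lift (prod_forms k A B R Rt E rE F rF \<tau>)
       (\<lambda>f \<eta>. prod_fpure k A B R Rt E rE F rF \<tau> (elemF k A B E F a f)
          \<one>\<^bsub>universal_calculus k A\<^esub> \<eta>) t"

definition prod_connection ::
  "('k, 'z) ring_scheme \<Rightarrow> ('k, 'a, 'x) module_scheme \<Rightarrow> ('k, 'b, 'y) module_scheme
     \<Rightarrow> (('b, 'a) tensor \<Rightarrow> ('a, 'b) tensor)
     \<Rightarrow> ((('k, 'b) uform, ('k, 'a) uform) tensor \<Rightarrow> (('k, 'a) uform, ('k, 'b) uform) tensor)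
     \<Rightarrow> ('k, 'e, 'u) module_scheme \<Rightarrow> ('e \<Rightarrow> 'a \<Rightarrow> 'e)
     \<Rightarrow> ('k, 'f, 'v) module_scheme \<Rightarrow> ('f \<Rightarrow> 'b \<Rightarrow> 'f) \<Rightarrow> (('f, 'a) tensor \<Rightarrow> ('a, 'f) tensor)
     \<Rightarrow> ('e \<Rightarrow> ('e, ('k, 'a) uform) tensor) \<Rightarrow> ('f \<Rightarrow> ('f, ('k, 'b) uform) tensor)
     \<Rightarrow> ('e, 'b) tensor \<times> ('a, 'f) tensor
     \<Rightarrow> (('e, 'b) tensor \<times> ('a, 'f) tensor, (('k, 'a) uform, ('k, 'b) uform) tensor) tensor" where
  "prod_connection k A B R Rt E rE F rF \<tau> nabE nabF m =
     (let WA = universal_calculus k A; WB = universal_calculus k B;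
          T = prod_forms k A B R Rt E rE F rF \<tau>;
          pure = prod_fpure k A B R Rt E rE F rF \<tau>;
          \<sigma> = inv_into (carrier (ktens k F A)) \<tau>;
          nab1 = tens_lift T (\<lambda>e b.
             inclE_act k A B R Rt E rE F rF \<tau> (nabE e) b
             \<oplus>\<^bsub>T\<^esub> pure (elemE k A B E F e \<one>\<^bsub>B\<^esub>) \<one>\<^bsub>WA\<^esub> (dif WB (incl WB b)));
          nab2 = tens_lift T (\<lambda>a f.
             act_inclF k A B R Rt E rE F rF \<tau> a (nabF f)
             \<oplus>\<^bsub>T\<^esub> tens_lift T (\<lambda>f\<sigma> a\<sigma>.
                  pure (elemF k A B E F \<one>\<^bsub>A\<^esub> f\<sigma>) (dif WA (incl WA a\<sigma>)) \<one>\<^bsub>WB\<^esub>)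
                (\<sigma> (kpure k A F a f)))
      in nab1 (fst m) \<oplus>\<^bsub>T\<^esub> nab2 (snd m))"

end

theory Submission
  imports Defs
begin

text \<open>
  The module \<open>E \<otimes> B \<oplus> A \<otimes> F\<close> is generated over \<open>A \<otimes>\<^sub>R B\<close> by the elements \<open>e \<otimes> 1\<close> and \<open>1 \<otimes> f\<close>: one has
  \<open>e \<otimes> b = (e \<otimes> 1) \<cdot> (1 \<otimes> b)\<close>, and \<open>\<tau>(f \<otimes> a) = (1 \<otimes> f) \<cdot> (a \<otimes> 1)\<close> with \<open>\<tau>\<close> surjective.  On a generator
  \<open>g\<close> the product connection is \<open>\<nabla>(g \<cdot> y) = \<nabla>(g) \<cdot> y + g \<otimes> dy\<close>, where \<open>\<nabla>(e \<otimes> 1) = i\<^sub>E(\<nabla>\<^sup>E e)\<close> and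
  \<open>\<nabla>(1 \<otimes> f) = i\<^sub>F(\<nabla>\<^sup>F f)\<close>; for \<open>g = 1 \<otimes> f\<close> this is the compatibility condition.  Hence \<open>\<nabla>\<close> satisfies the
  Leibniz rule and extends to all forms.

  Applying the extension to \<open>\<nabla>\<^sub>1(e \<otimes> b)\<close> gives \<open>i\<^sub>E(\<theta>\<^sup>E e) \<cdot> b\<close> and the two cross terms
  \<open>\<plusminus>(e\<^sub>i \<otimes> 1) \<otimes> (d a\<^sub>i \<otimes> d b)\<close>, which cancel because \<open>d a\<^sub>i\<close> has degree \<open>1\<close>.  On \<open>a \<otimes> f = \<tau>(f' \<otimes> a')\<close> the cross
  terms are \<open>(1 \<otimes> f'\<^sub>k) \<otimes> (d a'\<^sub>R \<otimes> \<eta>\<^sub>R)\<close>, from the compatibility condition with \<open>\<nabla>\<^sup>F f' = \<Sum> f'\<^sub>k \<otimes> \<eta>\<^sub>k\<close>, and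
  \<open>(1 \<otimes> f'\<^sub>k) \<otimes> (1 \<otimes> \<eta>\<^sub>k)(d a' \<otimes> 1)\<close>; they cancel because \<open>R\<close> extends to forms compatibly with \<open>d\<close>, which
  introduces the sign of the degree of \<open>\<eta>\<^sub>k\<close>.
\<close>

section \<open>Additive maps\<close>

text \<open>The obstacle throughout is well-definedness. A Sweedler expression is a
  \<open>tens_lift\<close>, evaluated on one chosen representative, so it obeys the expected rules
  only where its integrand is balanced; the sign map and the degree-zero projection in the
  hypotheses are Hilbert choices too, and have to be shown to exist. Hence the recurring pattern:
  prove balancedness, deduce additivity, compare additive maps on generators.

  Invertibility enters as follows. Injectivity of \<tau> makes \<open>\<sigma>\<close> computable on
  the elements \<tau>(f \<otimes> a); surjectivity makes these generate A \<otimes> F and forces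
  \<tau>(f \<otimes> 1) = 1 \<otimes> f. Surjectivity of R is needed for the Leibniz rule at 1
  \<otimes> f: compatibility controls \<nabla> on \<tau>(f \<otimes> a), and replacing f by fb
  reaches only (1 \<otimes> f) \<cdot> R(b \<otimes> a).

  Compatibility is one equation in A \<otimes> (F \<otimes> Omega B), the inner product being over
  B, but it is used twice: for the value of \<nabla> at \<tau>(f \<otimes> a), and for the
  cancellation of cross terms. Both uses apply an additive map, induced by a k-balanced V, to its
  two sides.\<close>

definition additive :: "('a, 'x) ring_scheme \<Rightarrow> ('b, 'y) ring_scheme \<Rightarrow> ('a \<Rightarrow> 'b) \<Rightarrow> bool" where
  "additive M N f \<longleftrightarrow> f \<in> hom (add_monoid M) (add_monoid N)"

lemma additiveI:
  assumes "\<And>x. x \<in> carrier M \<Longrightarrow> f x \<in> carrier N"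
    and "\<And>x y. x \<in> carrier M \<Longrightarrow> y \<in> carrier M \<Longrightarrow> f (x \<oplus>\<^bsub>M\<^esub> y) = f x \<oplus>\<^bsub>N\<^esub> f y"
  shows "additive M N f"
  using assms by (auto simp: additive_def hom_def)

lemma additive_closed: "additive M N f \<Longrightarrow> x \<in> carrier M \<Longrightarrow> f x \<in> carrier N"
  by (auto simp: additive_def hom_def)

lemma additive_add:
  "additive M N f \<Longrightarrow> x \<in> carrier M \<Longrightarrow> y \<in> carrier M \<Longrightarrow> f (x \<oplus>\<^bsub>M\<^esub> y) = f x \<oplus>\<^bsub>N\<^esub> f y"
  by (auto simp: additive_def hom_def)

lemma additive_group_hom:
  assumes "abelian_group M" "abelian_group N" "additive M N f"
  shows "group_hom (add_monoid M) (add_monoid N) f"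
  using assms by (simp add: additive_def group_hom_def group_hom_axioms_def abelian_group.a_group)

lemma additive_zero:
  assumes "abelian_group M" "abelian_group N" "additive M N f"
  shows "f \<zero>\<^bsub>M\<^esub> = \<zero>\<^bsub>N\<^esub>"
  using group_hom.hom_one[OF additive_group_hom[OF assms]] by simp

lemma additive_minus:
  assumes "abelian_group M" "abelian_group N" "additive M N f" "x \<in> carrier M"
  shows "f (\<ominus>\<^bsub>M\<^esub> x) = \<ominus>\<^bsub>N\<^esub> f x"
  using group_hom.hom_inv[OF additive_group_hom[OF assms(1-3)]] assms(4) by (simp add: a_inv_def)

lemma additive_compose:
  "additive M N f \<Longrightarrow> additive N P g \<Longrightarrow> additive M P (\<lambda>x. g (f x))"
  by (auto intro!: additiveI simp: additive_closed additive_add)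

lemma additive_plus:
  assumes "abelian_group N" "additive M N f" "additive M N g"
  shows "additive M N (\<lambda>x. f x \<oplus>\<^bsub>N\<^esub> g x)"
proof -
  interpret N: abelian_group N by fact
  show ?thesis using assms
    by (auto intro!: additiveI simp: additive_closed additive_add N.a_ac)
qed

lemma additive_uminus:
  assumes "abelian_group N" "additive M N f"
  shows "additive M N (\<lambda>x. \<ominus>\<^bsub>N\<^esub> f x)"
proof -
  interpret N: abelian_group N by fact
  show ?thesis using assms
    by (auto intro!: additiveI simp: additive_closed additive_add N.minus_add)
qed

lemma additive_id: "additive M M (\<lambda>x. x)"
  by (auto intro!: additiveI)

lemma additive_cong:
  assumes "additive M N f" "abelian_group M" "\<And>x. x \<in> carrier M \<Longrightarrow> g x = f x"
  shows "additive M N g"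
proof -
  interpret M: abelian_group M by fact
  show ?thesis using assms(1,3) by (intro additiveI) (simp_all add: additive_closed additive_add)
qed

section \<open>Additive spans and the comparison of additive maps on generators\<close>

lemma span_in_incl: "x \<in> S \<Longrightarrow> x \<in> span_in T S"
  by (simp add: span_in_def generate.incl)

lemma span_in_zero: "\<zero>\<^bsub>T\<^esub> \<in> span_in T S"
  using generate.one[of "add_monoid T" S] by (simp add: span_in_def)

lemma span_in_add: "x \<in> span_in T S \<Longrightarrow> y \<in> span_in T S \<Longrightarrow> x \<oplus>\<^bsub>T\<^esub> y \<in> span_in T S"
  using generate.eng[of x "add_monoid T" S y] by (simp add: span_in_def)

lemma span_in_subset:
  assumes "abelian_group T" "S \<subseteq> carrier T"
  shows "span_in T S \<subseteq> carrier T"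
  using group.generate_incl[OF abelian_group.a_group[OF assms(1)], of S] assms(2) by (simp add: span_in_def)

text \<open>A homomorphism carries a generated subgroup to the subgroup generated by the images, so
  a containment need only be checked on \<open>S\<close>. This is how operators are shown to
  preserve subspaces such as the forms of degree zero in one factor.\<close>

lemma span_in_image:
  assumes "abelian_group T" "abelian_group U" "additive T U f" "S \<subseteq> carrier T" "S' \<subseteq> carrier U"
    and "\<And>x. x \<in> S \<Longrightarrow> f x \<in> span_in U S'" and "t \<in> span_in T S"
  shows "f t \<in> span_in U S'"
proof -
  interpret U: abelian_group U by fact
  have "f t \<in> f ` generate (add_monoid T) S"
    using assms(7) by (simp add: span_in_def)
  also have "\<dots> = generate (add_monoid U) (f ` S)"
    using group_hom.generate_img[OF additive_group_hom[OF assms(1-3)], of S] assms(4) by simp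
  also have "\<dots> \<subseteq> generate (add_monoid U) (span_in U S')"
    by (rule group.mono_generate[OF U.a_group]) (use assms(6) in auto)
  also have "\<dots> \<subseteq> span_in U S'"
    unfolding span_in_def
    by (rule group.generate_subgroup_incl[OF U.a_group])
      (use group.generate_is_subgroup[OF U.a_group] assms(5) in auto)
  finally show ?thesis .
qed

text \<open>Induction over the generated subgroup. Membership in the carrier is carried along,
  because additivity says nothing about elements outside it.\<close>

lemma additive_eq_on_span:
  assumes "abelian_group T" "abelian_group U" "additive T U f" "additive T U g" "S \<subseteq> carrier T"
    and "\<And>x. x \<in> S \<Longrightarrow> f x = g x" and "t \<in> span_in T S"
  shows "f t = g t"
proof -
  interpret T: abelian_group T by fact
  interpret U: abelian_group U by fact
  have "t \<in> carrier T \<and> f t = g t"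
    using assms(7) unfolding span_in_def
  proof (induction rule: generate.induct)
    case one
    then show ?case
      using additive_zero[OF assms(1-3)] additive_zero[OF assms(1,2,4)] by simp
  next
    case (incl h)
    then show ?case using assms(5,6) by auto
  next
    case (inv h)
    then have h: "h \<in> carrier T" "f h = g h" using assms(5,6) by auto
    then show ?case
      using additive_minus[OF assms(1-3) h(1)] additive_minus[OF assms(1,2,4) h(1)]
      by (simp flip: a_inv_def)
  next
    case (eng h1 h2)
    then show ?case by (simp add: additive_add[OF assms(3)] additive_add[OF assms(4)])
  qed
  then show ?thesis by simp
qed

section \<open>Universal property of tensor products\<close>

text \<open>The three clauses mirror the three families in \<open>tens_rels\<close>; for such
  integrands the value of \<open>tens_lift\<close> does not depend on the representative.\<close>

definition balanced ::
  "'d set \<Rightarrow> ('k, 'm, 'x) module_scheme \<Rightarrow> ('m \<Rightarrow> 'd \<Rightarrow> 'm) \<Rightarrow> ('k, 'n, 'y) module_scheme \<Rightarrow> ('d \<Rightarrow> 'n \<Rightarrow> 'n)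
    \<Rightarrow> ('t, 'z) ring_scheme \<Rightarrow> ('m \<Rightarrow> 'n \<Rightarrow> 't) \<Rightarrow> bool" where
  "balanced S M r N l T f \<longleftrightarrow>
     (\<forall>m \<in> carrier M. additive N T (f m)) \<and> (\<forall>n \<in> carrier N. additive M T (\<lambda>m. f m n)) \<and>
     (\<forall>m \<in> carrier M. \<forall>x \<in> S. \<forall>n \<in> carrier N. f (r m x) n = f m (l x n))"

lemma balancedI:
  assumes "\<And>m n. m \<in> carrier M \<Longrightarrow> n \<in> carrier N \<Longrightarrow> f m n \<in> carrier T"
    and "\<And>m m' n. m \<in> carrier M \<Longrightarrow> m' \<in> carrier M \<Longrightarrow> n \<in> carrier N \<Longrightarrow> f (m \<oplus>\<^bsub>M\<^esub> m') n = f m n \<oplus>\<^bsub>T\<^esub> f m' n"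
    and "\<And>m n n'. m \<in> carrier M \<Longrightarrow> n \<in> carrier N \<Longrightarrow> n' \<in> carrier N \<Longrightarrow> f m (n \<oplus>\<^bsub>N\<^esub> n') = f m n \<oplus>\<^bsub>T\<^esub> f m n'"
    and "\<And>m x n. m \<in> carrier M \<Longrightarrow> x \<in> S \<Longrightarrow> n \<in> carrier N \<Longrightarrow> f (r m x) n = f m (l x n)"
  shows "balanced S M r N l T f"
  using assms unfolding balanced_def by (auto intro!: additiveI)

text \<open>A lift sees its target only through the additive group. Lifts into
  \<open>twisted_algebra\<close>, where multiplication and unit have been overwritten, can thus be
  read as lifts into the plain tensor product.\<close>

lemma tens_lift_add_monoid_cong:
  fixes T T' :: "('k, 'a, 'x) module_scheme"
  shows "add_monoid T' = add_monoid T \<Longrightarrow> tens_lift T' f = tens_lift T f"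
  unfolding tens_lift_def finsum_def add_pow_def by simp

text \<open>The additive monoid of a module carries a record tail, the quotient group does not; the
  group axioms do not see the difference.\<close>

lemma comm_group_more:
  assumes "comm_group \<lparr>carrier = C, monoid.mult = m, one = e\<rparr>"
  shows "comm_group \<lparr>carrier = C, monoid.mult = m, one = e, \<dots> = u\<rparr>"
proof -
  have "comm_group \<lparr>carrier = C, monoid.mult = m, one = e, \<dots> = u\<rparr> =
      comm_group \<lparr>carrier = C, monoid.mult = m, one = e\<rparr>"
    unfolding comm_group_def comm_monoid_def group_def monoid_def comm_monoid_axioms_def
      group_axioms_def Units_def
    by (simp only: partial_object.simps monoid.simps)
  then show ?thesis using assms by simp
qed

context abelian_group
begin

lemma int_multiple_closed [simp]: "x \<in> carrier G \<Longrightarrow> [(i::int)] \<cdot>\<^bsub>G\<^esub> x \<in> carrier G"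
  using group.int_pow_closed[OF a_group, of x i] by (simp add: add_pow_def)

lemma zero_multiple: "[(0::int)] \<cdot>\<^bsub>G\<^esub> x = \<zero>"
  by (simp add: add_pow_def int_pow_def nat_pow_def)

lemma one_multiple: "x \<in> carrier G \<Longrightarrow> [(1::int)] \<cdot>\<^bsub>G\<^esub> x = x"
  using group.int_pow_1[OF a_group, of x] by (simp add: add_pow_def)

lemma multiple_add: "x \<in> carrier G \<Longrightarrow> [(i + j :: int)] \<cdot>\<^bsub>G\<^esub> x = [i] \<cdot>\<^bsub>G\<^esub> x \<oplus> [j] \<cdot>\<^bsub>G\<^esub> x"
  using group.int_pow_mult[OF a_group, of x i j] by (simp add: add_pow_def)

end

section \<open>Tensor products as quotients of free abelian groups\<close>

locale tensor =
  M: abelian_group M + N: abelian_group N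
  for S :: "'d set" and M :: "('k, 'm, 'x) module_scheme" and r :: "'m \<Rightarrow> 'd \<Rightarrow> 'm"
    and N :: "('k, 'n, 'y) module_scheme" and l :: "'d \<Rightarrow> 'n \<Rightarrow> 'n" +
  assumes r_closed: "m \<in> carrier M \<Longrightarrow> x \<in> S \<Longrightarrow> r m x \<in> carrier M"
    and l_closed: "x \<in> S \<Longrightarrow> n \<in> carrier N \<Longrightarrow> l x n \<in> carrier N"
begin

abbreviation Fr where "Fr \<equiv> free_Abelian_group (carrier M \<times> carrier N)"
abbreviation H where "H \<equiv> tens_null S M r N l"
abbreviation (input) MN :: "('k, ('m, 'n) tensor) module" where "MN \<equiv> tens S M r N l"
abbreviation pure where "pure \<equiv> tens_pure S M r N l"

lemma rels_subset: "tens_rels S M r N l \<subseteq> carrier Fr"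
proof -
  have *: "frag_of z - frag_of z' \<in> carrier Fr" if "z \<in> carrier M \<times> carrier N" "z' \<in> carrier M \<times> carrier N" for z z'
    using that keys_diff[of "frag_of z" "frag_of z'"] by (auto simp: keys_frag_of)
  have **: "p - frag_of z' \<in> carrier Fr" if "p \<in> carrier Fr" "z' \<in> carrier M \<times> carrier N" for p z'
    using that keys_diff[of p "frag_of z'"] by (auto simp: keys_frag_of)
  show ?thesis
    unfolding tens_rels_def
    by (intro Un_least) (auto simp del: carrier_free_Abelian_group_iff intro!: * ** simp: r_closed l_closed)
qed

lemma H_subgroup: "subgroup H Fr"
  unfolding tens_null_def by (rule group.generate_is_subgroup[OF group_free_Abelian_group rels_subset])

lemma H_normal: "normal H Fr"
  by (rule comm_group.subgroup_imp_normal[OF abelian_free_Abelian_group H_subgroup])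

lemma carrier_tens: "carrier MN = (\<lambda>p. H #>\<^bsub>Fr\<^esub> p) ` carrier Fr"
  by (simp add: tens_def Let_def carrier_FactGroup)

lemma add_monoid_tens: "comm_group (add_monoid MN)"
proof -
  have "comm_group (Fr Mod H)"
    by (rule comm_group.abelian_FactGroup[OF abelian_free_Abelian_group H_subgroup])
  then show ?thesis by (simp add: tens_def Let_def FactGroup_def comm_group_more)
qed

sublocale MN: abelian_group MN
  by (rule abelian_group.intro)
    (use add_monoid_tens in \<open>auto simp: abelian_group_axioms_def abelian_monoid_def comm_group_def\<close>)

lemma coset_add:
  assumes "p \<in> carrier Fr" "q \<in> carrier Fr"
  shows "(H #>\<^bsub>Fr\<^esub> p) \<oplus>\<^bsub>MN\<^esub> (H #>\<^bsub>Fr\<^esub> q) = H #>\<^bsub>Fr\<^esub> (p + q)"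
  using normal.rcos_sum[OF H_normal assms] by (simp add: tens_def Let_def)

lemma pure_closed [simp, intro]: "m \<in> carrier M \<Longrightarrow> n \<in> carrier N \<Longrightarrow> pure m n \<in> carrier MN"
  unfolding carrier_tens tens_pure_def by (rule imageI) simp

lemma coset_eqI:
  assumes "p \<in> carrier Fr" "q \<in> carrier Fr" "p - q \<in> H"
  shows "H #>\<^bsub>Fr\<^esub> p = H #>\<^bsub>Fr\<^esub> q"
proof -
  have "p = (p - q) \<otimes>\<^bsub>Fr\<^esub> q" by simp
  then have "p \<in> H #>\<^bsub>Fr\<^esub> q" using assms(3) unfolding r_coset_def by blast
  then show ?thesis
    using group.repr_independence[OF group_free_Abelian_group _ assms(2) H_subgroup] by simp
qed

lemma frag_pair_in: "m \<in> carrier M \<Longrightarrow> n \<in> carrier N \<Longrightarrow> frag_of (m, n) \<in> carrier Fr"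
  by simp

lemma G_add: "p \<in> carrier Fr \<Longrightarrow> q \<in> carrier Fr \<Longrightarrow> p + q \<in> carrier Fr"
  using monoid.m_closed[OF group.is_monoid[OF group_free_Abelian_group], of p "carrier M \<times> carrier N" q] by simp

lemma pure_add_left:
  assumes "m \<in> carrier M" "m' \<in> carrier M" "n \<in> carrier N"
  shows "pure (m \<oplus>\<^bsub>M\<^esub> m') n = pure m n \<oplus>\<^bsub>MN\<^esub> pure m' n"
proof -
  have "pure m n \<oplus>\<^bsub>MN\<^esub> pure m' n = H #>\<^bsub>Fr\<^esub> (frag_of (m, n) + frag_of (m', n))"
    unfolding tens_pure_def using assms by (intro coset_add) simp_all
  moreover have "pure (m \<oplus>\<^bsub>M\<^esub> m') n = H #>\<^bsub>Fr\<^esub> (frag_of (m, n) + frag_of (m', n))"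
    unfolding tens_pure_def
  proof (rule coset_eqI)
    show "frag_of (m \<oplus>\<^bsub>M\<^esub> m', n) - (frag_of (m, n) + frag_of (m', n)) \<in> H"
      unfolding tens_null_def diff_diff_eq[symmetric]
      by (rule generate.incl) (use assms in \<open>auto simp: tens_rels_def\<close>)
  qed (use assms G_add frag_pair_in in auto)
  ultimately show ?thesis by simp
qed

lemma pure_add_right:
  assumes "m \<in> carrier M" "n \<in> carrier N" "n' \<in> carrier N"
  shows "pure m (n \<oplus>\<^bsub>N\<^esub> n') = pure m n \<oplus>\<^bsub>MN\<^esub> pure m n'"
proof -
  have "pure m n \<oplus>\<^bsub>MN\<^esub> pure m n' = H #>\<^bsub>Fr\<^esub> (frag_of (m, n) + frag_of (m, n'))"
    unfolding tens_pure_def using assms by (intro coset_add) simp_all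
  moreover have "pure m (n \<oplus>\<^bsub>N\<^esub> n') = H #>\<^bsub>Fr\<^esub> (frag_of (m, n) + frag_of (m, n'))"
    unfolding tens_pure_def
  proof (rule coset_eqI)
    show "frag_of (m, n \<oplus>\<^bsub>N\<^esub> n') - (frag_of (m, n) + frag_of (m, n')) \<in> H"
      unfolding tens_null_def diff_diff_eq[symmetric]
      by (rule generate.incl) (use assms in \<open>auto simp: tens_rels_def\<close>)
  qed (use assms G_add frag_pair_in in auto)
  ultimately show ?thesis by simp
qed

lemma pure_balanced:
  assumes "m \<in> carrier M" "x \<in> S" "n \<in> carrier N"
  shows "pure (r m x) n = pure m (l x n)"
  unfolding tens_pure_def
proof (rule coset_eqI)
  show "frag_of (r m x, n) - frag_of (m, l x n) \<in> H"
    unfolding tens_null_def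
    by (rule generate.incl) (use assms in \<open>auto simp: tens_rels_def\<close>)
qed (use assms frag_pair_in r_closed l_closed in auto)

lemma pure_additive_right: "m \<in> carrier M \<Longrightarrow> additive N MN (pure m)"
  by (rule additiveI) (auto simp: pure_add_right)

lemma pure_additive_left: "n \<in> carrier N \<Longrightarrow> additive M MN (\<lambda>m. pure m n)"
  by (rule additiveI) (auto simp: pure_add_left)

lemma pure_zero_left [simp]: "n \<in> carrier N \<Longrightarrow> pure \<zero>\<^bsub>M\<^esub> n = \<zero>\<^bsub>MN\<^esub>"
  using additive_zero[OF M.abelian_group_axioms MN.abelian_group_axioms pure_additive_left] by blast

lemma pure_zero_right [simp]: "m \<in> carrier M \<Longrightarrow> pure m \<zero>\<^bsub>N\<^esub> = \<zero>\<^bsub>MN\<^esub>"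
  using additive_zero[OF N.abelian_group_axioms MN.abelian_group_axioms pure_additive_right] by blast

lemma pure_minus_left: "m \<in> carrier M \<Longrightarrow> n \<in> carrier N \<Longrightarrow> pure (\<ominus>\<^bsub>M\<^esub> m) n = \<ominus>\<^bsub>MN\<^esub> pure m n"
  using additive_minus[OF M.abelian_group_axioms MN.abelian_group_axioms pure_additive_left] by blast

lemma pure_minus_right: "m \<in> carrier M \<Longrightarrow> n \<in> carrier N \<Longrightarrow> pure m (\<ominus>\<^bsub>N\<^esub> n) = \<ominus>\<^bsub>MN\<^esub> pure m n"
  using additive_minus[OF N.abelian_group_axioms MN.abelian_group_axioms pure_additive_right] by blast

lemma pures_subset: "{pure m n | m n. m \<in> carrier M \<and> n \<in> carrier N} \<subseteq> carrier MN"
  by auto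

lemma coset_additive: "(\<lambda>p. H #>\<^bsub>Fr\<^esub> p) \<in> hom Fr (add_monoid MN)"
  unfolding hom_def by (auto simp: carrier_tens coset_add)

text \<open>The coset map is a homomorphism onto the tensor product and sends basis elements to pure
  tensors. The induction principle for free abelian groups builds elements by differences, hence the
  case \<open>x - y\<close>.\<close>

lemma carrier_span: "carrier MN = span_in MN {pure m n | m n. m \<in> carrier M \<and> n \<in> carrier N}"
proof
  show "span_in MN {pure m n | m n. m \<in> carrier M \<and> n \<in> carrier N} \<subseteq> carrier MN"
    by (rule span_in_subset[OF MN.abelian_group_axioms pures_subset])
  interpret P: group_hom Fr "add_monoid MN" "\<lambda>p. H #>\<^bsub>Fr\<^esub> p"
    using coset_additive MN.a_group by (simp add: group_hom_def group_hom_axioms_def)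
  show "carrier MN \<subseteq> span_in MN {pure m n | m n. m \<in> carrier M \<and> n \<in> carrier N}" (is "_ \<subseteq> ?S")
  proof
    fix t assume "t \<in> carrier MN"
    then obtain p where p: "p \<in> carrier Fr" "t = H #>\<^bsub>Fr\<^esub> p" by (auto simp: carrier_tens)
    have sub: "subgroup ?S (add_monoid MN)"
      unfolding span_in_def by (rule group.generate_is_subgroup[OF MN.a_group]) (use pures_subset in auto)
    have k: "Poly_Mapping.keys p \<subseteq> carrier M \<times> carrier N" using p by simp
    have "H #>\<^bsub>Fr\<^esub> p \<in> ?S"
    proof (induction rule: free_Abelian_group_induct[OF k])
      case 1
      then show ?case using subgroup.one_closed[OF sub] P.hom_one by simp
    next
      case (2 x y)
      have y: "- y = inv\<^bsub>Fr\<^esub> y" using 2 by simp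
      have "H #>\<^bsub>Fr\<^esub> (x - y) = H #>\<^bsub>Fr\<^esub> (x \<otimes>\<^bsub>Fr\<^esub> inv\<^bsub>Fr\<^esub> y)"
        unfolding y[symmetric] by simp
      also have "\<dots> = (H #>\<^bsub>Fr\<^esub> x) \<otimes>\<^bsub>add_monoid MN\<^esub> inv\<^bsub>add_monoid MN\<^esub> (H #>\<^bsub>Fr\<^esub> y)"
        using P.hom_mult[of x "inv\<^bsub>Fr\<^esub> y"] P.hom_inv[of y] P.G.inv_closed[of y] 2
        by (simp del: inv_free_Abelian_group mult_free_Abelian_group)
      also have "\<dots> \<in> ?S"
        using 2 by (simp only: subgroup.m_closed[OF sub] subgroup.m_inv_closed[OF sub])
      finally show ?case .
    next
      case (3 a)
      then show ?case by (intro span_in_incl) (auto simp: tens_pure_def)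
    qed
    then show "t \<in> ?S" using p by simp
  qed
qed

text \<open>The main method of proof below: both sides of an identity are exhibited as compositions
  of additive maps and then computed on pure tensors, which generate.\<close>

lemma additive_ext:
  assumes "abelian_group U" "additive MN U f" "additive MN U g" "t \<in> carrier MN"
    and "\<And>m n. m \<in> carrier M \<Longrightarrow> n \<in> carrier N \<Longrightarrow> f (pure m n) = g (pure m n)"
  shows "f t = g t"
  by (rule additive_eq_on_span[OF MN.abelian_group_axioms assms(1-3) pures_subset])
    (use assms(4,5) carrier_span in auto)

lemma rep_of:
  assumes "t \<in> carrier MN"
  shows "(SOME p. p \<in> t) \<in> carrier Fr" "t = H #>\<^bsub>Fr\<^esub> (SOME p. p \<in> t)"
proof -
  obtain p where p: "p \<in> carrier Fr" "t = H #>\<^bsub>Fr\<^esub> p" using assms by (auto simp: carrier_tens)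
  have "p \<in> t" using group.rcos_self[OF group_free_Abelian_group p(1) H_subgroup] p(2) by simp
  then have s: "(SOME p. p \<in> t) \<in> t" by (rule someI)
  then show c: "(SOME p. p \<in> t) \<in> carrier Fr"
    using monoid.r_coset_subset_G[OF group.is_monoid[OF group_free_Abelian_group] subgroup.subset[OF H_subgroup] p(1)] p(2)
    by blast
  show "t = H #>\<^bsub>Fr\<^esub> (SOME p. p \<in> t)"
    using group.repr_independence[OF group_free_Abelian_group _ p(1) H_subgroup] s p(2) by simp
qed

lemma rep_diff:
  assumes "p \<in> carrier Fr"
  shows "(SOME q. q \<in> H #>\<^bsub>Fr\<^esub> p) - p \<in> H"
proof -
  have "p \<in> H #>\<^bsub>Fr\<^esub> p" by (rule group.rcos_self[OF group_free_Abelian_group assms H_subgroup])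
  then have "(SOME q. q \<in> H #>\<^bsub>Fr\<^esub> p) \<in> H #>\<^bsub>Fr\<^esub> p" by (rule someI)
  then obtain h where "h \<in> H" "(SOME q. q \<in> H #>\<^bsub>Fr\<^esub> p) = h \<otimes>\<^bsub>Fr\<^esub> p" unfolding r_coset_def by blast
  then show ?thesis by simp
qed

text \<open>Both lifts use the same representative, and its support lies in
  \<open>carrier M \<times> carrier N\<close>; so agreement there suffices and balancedness does not
  enter.\<close>

lemma lift_cong:
  assumes "abelian_group U" "t \<in> carrier MN"
    and "\<And>m n. m \<in> carrier M \<Longrightarrow> n \<in> carrier N \<Longrightarrow> f m n = g m n"
    and "\<And>m n. m \<in> carrier M \<Longrightarrow> n \<in> carrier N \<Longrightarrow> f m n \<in> carrier U"
  shows "tens_lift U f t = tens_lift U g t"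
proof -
  interpret U: abelian_group U by fact
  have k: "Poly_Mapping.keys (SOME p. p \<in> t) \<subseteq> carrier M \<times> carrier N"
    using rep_of(1)[OF assms(2)] by simp
  show ?thesis unfolding tens_lift_def Let_def
    by (rule U.add.finprod_cong') (use k assms(3,4) in \<open>auto simp: subset_iff intro!: U.int_multiple_closed\<close>)
qed

lemma lift_closed:
  assumes "abelian_group U" "t \<in> carrier MN"
    and "\<And>m n. m \<in> carrier M \<Longrightarrow> n \<in> carrier N \<Longrightarrow> f m n \<in> carrier U"
  shows "tens_lift U f t \<in> carrier U"
proof -
  interpret U: abelian_group U by fact
  have k: "Poly_Mapping.keys (SOME p. p \<in> t) \<subseteq> carrier M \<times> carrier N"
    using rep_of(1)[OF assms(2)] by simp
  show ?thesis unfolding tens_lift_def Let_def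
    by (rule U.finsum_closed) (use k assms(3) in \<open>auto simp: subset_iff intro!: U.int_multiple_closed\<close>)
qed

text \<open>Both sides use the same representative of \<open>t\<close>, so that \<open>f\<close> need not be balanced.\<close>

lemma lift_push:
  assumes "abelian_group U" "abelian_group V" "additive U V \<phi>" "t \<in> carrier MN"
    and "\<And>m n. m \<in> carrier M \<Longrightarrow> n \<in> carrier N \<Longrightarrow> f m n \<in> carrier U"
  shows "\<phi> (tens_lift U f t) = tens_lift V (\<lambda>m n. \<phi> (f m n)) t"
proof -
  interpret U: abelian_group U by fact
  interpret V: abelian_group V by fact
  interpret h: group_hom "add_monoid U" "add_monoid V" \<phi>
    by (rule additive_group_hom[OF assms(1-3)])
  define p where "p = (SOME p. p \<in> t)"
  have k: "Poly_Mapping.keys p \<subseteq> carrier M \<times> carrier N"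
    using rep_of(1)[OF assms(4)] by (simp add: p_def)
  have fc: "f (fst z) (snd z) \<in> carrier U" if "z \<in> Poly_Mapping.keys p" for z using k that assms(5) by auto
  have gc: "\<phi> (f (fst z) (snd z)) \<in> carrier V" if "z \<in> Poly_Mapping.keys p" for z
    using fc[OF that] additive_closed[OF assms(3)] by auto
  have s: "[i] \<cdot>\<^bsub>V\<^esub> \<phi> x = \<phi> ([i] \<cdot>\<^bsub>U\<^esub> x)" if "x \<in> carrier U" for x and i :: int
    using h.hom_int_pow[of x i] that by (simp add: add_pow_def)
  have "\<phi> (\<Oplus>\<^bsub>U\<^esub>z\<in>K. [Poly_Mapping.lookup p z] \<cdot>\<^bsub>U\<^esub> f (fst z) (snd z)) = (\<Oplus>\<^bsub>V\<^esub>z\<in>K. [Poly_Mapping.lookup p z] \<cdot>\<^bsub>V\<^esub> \<phi> (f (fst z) (snd z)))"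
    if "finite K" "K \<subseteq> Poly_Mapping.keys p" for K
    using that
  proof (induction K rule: finite_induct)
    case empty
    then show ?case using h.hom_one by simp
  next
    case (insert z K)
    have 1: "(\<lambda>z. [Poly_Mapping.lookup p z] \<cdot>\<^bsub>U\<^esub> f (fst z) (snd z)) \<in> K \<rightarrow> carrier U"
      using insert fc by (auto intro!: U.int_multiple_closed)
    have 2: "(\<lambda>z. [Poly_Mapping.lookup p z] \<cdot>\<^bsub>V\<^esub> \<phi> (f (fst z) (snd z))) \<in> K \<rightarrow> carrier V"
      using insert gc by (auto intro!: V.int_multiple_closed)
    have 3: "[Poly_Mapping.lookup p z] \<cdot>\<^bsub>U\<^esub> f (fst z) (snd z) \<in> carrier U"
      using insert fc by (auto intro!: U.int_multiple_closed)
    have 4: "[Poly_Mapping.lookup p z] \<cdot>\<^bsub>V\<^esub> \<phi> (f (fst z) (snd z)) \<in> carrier V"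
      using insert gc by (auto intro!: V.int_multiple_closed)
    show ?case
      using insert additive_add[OF assms(3) 3 U.finsum_closed[OF 1]]
      by (simp add: U.finsum_insert[OF insert(1,2) 1 3] V.finsum_insert[OF insert(1,2) 2 4] s fc)
  qed
  from this[of "Poly_Mapping.keys p"] show ?thesis by (simp add: tens_lift_def Let_def p_def)
qed

context
  fixes U :: "('k, 'u, 'z) module_scheme" and f
  assumes U: "abelian_group U" and f: "balanced S M r N l U f"
begin

interpretation U: abelian_group U by (rule U)

lemma balanced_closed: "m \<in> carrier M \<Longrightarrow> n \<in> carrier N \<Longrightarrow> f m n \<in> carrier U"
  using f additive_closed unfolding balanced_def by metis

abbreviation (input) "ev p \<equiv> \<Oplus>\<^bsub>U\<^esub>z \<in> Poly_Mapping.keys p. [Poly_Mapping.lookup p z] \<cdot>\<^bsub>U\<^esub> f (fst z) (snd z)"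

text \<open>Coefficients vanish off the support, so the sum may run over any larger finite set. This
  gives two formal sums a common index set when they are added.\<close>

lemma ev_superset:
  fixes p :: "('m \<times> 'n) \<Rightarrow>\<^sub>0 int"
  assumes "finite K" "Poly_Mapping.keys p \<subseteq> K" "K \<subseteq> carrier M \<times> carrier N"
  shows "ev p = (\<Oplus>\<^bsub>U\<^esub>z \<in> K. [Poly_Mapping.lookup p z] \<cdot>\<^bsub>U\<^esub> f (fst z) (snd z))"
  by (rule U.add.finprod_mono_neutral_cong_left[OF assms(1,2)])
    (use assms(3) in \<open>auto simp: in_keys_iff balanced_closed U.zero_multiple\<close>)

lemma ev_hom: "(\<lambda>p. ev p) \<in> hom Fr (add_monoid U)"
proof (rule homI)
  fix p assume "p \<in> carrier Fr"
  then show "ev p \<in> carrier (add_monoid U)"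
    by (auto simp: subset_iff balanced_closed intro!: U.finsum_closed U.int_multiple_closed)
next
  fix p q assume pq: "p \<in> carrier Fr" "q \<in> carrier Fr"
  let ?K = "Poly_Mapping.keys p \<union> Poly_Mapping.keys q"
  have K: "finite ?K" "?K \<subseteq> carrier M \<times> carrier N" using pq by auto
  have c: "z \<in> ?K \<Longrightarrow> f (fst z) (snd z) \<in> carrier U" for z using K(2) by (auto simp: balanced_closed)
  have cc: "(\<lambda>z. [Poly_Mapping.lookup s z] \<cdot>\<^bsub>U\<^esub> f (fst z) (snd z)) \<in> ?K \<rightarrow> carrier U" for s :: "('m \<times> 'n) \<Rightarrow>\<^sub>0 int"
    by (intro Pi_I U.int_multiple_closed c)
  have "ev (p + q) = (\<Oplus>\<^bsub>U\<^esub>z \<in> ?K. [Poly_Mapping.lookup (p + q) z] \<cdot>\<^bsub>U\<^esub> f (fst z) (snd z))"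
    by (rule ev_superset[OF K(1) keys_add K(2)])
  also have "\<dots> = (\<Oplus>\<^bsub>U\<^esub>z \<in> ?K. [Poly_Mapping.lookup p z] \<cdot>\<^bsub>U\<^esub> f (fst z) (snd z) \<oplus>\<^bsub>U\<^esub> [Poly_Mapping.lookup q z] \<cdot>\<^bsub>U\<^esub> f (fst z) (snd z))"
    by (rule U.finsum_cong')
      (use c in \<open>auto simp: lookup_add U.multiple_add intro!: U.int_multiple_closed U.a_closed\<close>)
  also have "\<dots> = ev p \<oplus>\<^bsub>U\<^esub> ev q"
    by (simp add: U.finsum_addf[OF cc cc] ev_superset[OF K(1) _ K(2)])
  finally show "ev (p \<otimes>\<^bsub>Fr\<^esub> q) = ev p \<otimes>\<^bsub>add_monoid U\<^esub> ev q" by simp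
qed

lemma ev_frag_of: "m \<in> carrier M \<Longrightarrow> n \<in> carrier N \<Longrightarrow> ev (frag_of (m, n)) = f m n"
  by (simp add: keys_frag_of balanced_closed U.one_multiple U.add.finprod_singleton_swap)

text \<open>Additivity in each variable kills the first two families of relations and balancedness
  the third; since evaluation is a homomorphism, it kills the subgroup they generate.\<close>

lemma ev_null:
  assumes "p \<in> H"
  shows "ev p = \<zero>\<^bsub>U\<^esub>"
proof -
  define e where "e = (\<lambda>p :: ('m \<times> 'n) \<Rightarrow>\<^sub>0 int. ev p)"
  have e_hom: "e \<in> hom Fr (add_monoid U)" using ev_hom by (simp add: e_def)
  have e_frag: "e (frag_of (m, n)) = f m n" if "m \<in> carrier M" "n \<in> carrier N" for m n
    using ev_frag_of[OF that] by (simp add: e_def)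
  interpret P: group_hom Fr "add_monoid U" e
    using e_hom U.a_group by (simp add: group_hom_def group_hom_axioms_def)
  have e_closed: "e p \<in> carrier U" if "p \<in> carrier Fr" for p
    using P.hom_closed[OF that] by simp
  have diff: "e (p - q) = e p \<ominus>\<^bsub>U\<^esub> e q" if "p \<in> carrier Fr" "q \<in> carrier Fr" for p q
    using P.hom_mult[OF that(1) P.G.inv_closed[OF that(2)]] P.hom_inv[OF that(2)] that
    by (simp add: a_minus_def a_inv_def)
  have G_diff: "x - y \<in> carrier Fr" if "x \<in> carrier Fr" "y \<in> carrier Fr" for x y
    using that keys_diff[of x y] by auto
  have diff3: "e (p - q - q') = \<zero>\<^bsub>U\<^esub>"
    if "p \<in> carrier Fr" "q \<in> carrier Fr" "q' \<in> carrier Fr" "e p = e q \<oplus>\<^bsub>U\<^esub> e q'" for p q q'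
  proof -
    have c: "e q \<in> carrier U" "e q' \<in> carrier U" using that e_closed by auto
    have "e (p - q - q') = (e q \<oplus>\<^bsub>U\<^esub> e q') \<oplus>\<^bsub>U\<^esub> \<ominus>\<^bsub>U\<^esub> e q \<oplus>\<^bsub>U\<^esub> \<ominus>\<^bsub>U\<^esub> e q'"
      using diff[OF G_diff[OF that(1,2)] that(3)] diff[OF that(1,2)] that(4) by (simp add: a_minus_def)
    also have "(e q \<oplus>\<^bsub>U\<^esub> e q') \<oplus>\<^bsub>U\<^esub> \<ominus>\<^bsub>U\<^esub> e q = e q'"
      using c by (simp add: U.a_comm[of "e q" "e q'"] U.a_assoc U.r_neg)
    also have "e q' \<oplus>\<^bsub>U\<^esub> \<ominus>\<^bsub>U\<^esub> e q' = \<zero>\<^bsub>U\<^esub>" using c by (simp add: U.r_neg)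
    finally show ?thesis .
  qed
  have rels: "e p = \<zero>\<^bsub>U\<^esub>" if p: "p \<in> tens_rels S M r N l" for p
  proof -
    have 1: ?thesis if "m \<in> carrier M" "m' \<in> carrier M" "n \<in> carrier N"
        "p = frag_of (m \<oplus>\<^bsub>M\<^esub> m', n) - frag_of (m, n) - frag_of (m', n)" for m m' n
      unfolding that(4)
    proof (rule diff3)
      have "f (m \<oplus>\<^bsub>M\<^esub> m') n = f m n \<oplus>\<^bsub>U\<^esub> f m' n"
        using f that additive_add[of M U "\<lambda>m. f m n"] unfolding balanced_def by blast
      then show "e (frag_of (m \<oplus>\<^bsub>M\<^esub> m', n)) = e (frag_of (m, n)) \<oplus>\<^bsub>U\<^esub> e (frag_of (m', n))"
        using that by (simp add: e_frag)
    qed (use that in auto)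
    have 2: ?thesis if "m \<in> carrier M" "n \<in> carrier N" "n' \<in> carrier N"
        "p = frag_of (m, n \<oplus>\<^bsub>N\<^esub> n') - frag_of (m, n) - frag_of (m, n')" for m n n'
      unfolding that(4)
    proof (rule diff3)
      have "f m (n \<oplus>\<^bsub>N\<^esub> n') = f m n \<oplus>\<^bsub>U\<^esub> f m n'"
        using f that additive_add[of N U "f m"] unfolding balanced_def by blast
      then show "e (frag_of (m, n \<oplus>\<^bsub>N\<^esub> n')) = e (frag_of (m, n)) \<oplus>\<^bsub>U\<^esub> e (frag_of (m, n'))"
        using that by (simp add: e_frag)
    qed (use that in auto)
    have 3: ?thesis if "m \<in> carrier M" "x \<in> S" "n \<in> carrier N"
        "p = frag_of (r m x, n) - frag_of (m, l x n)" for m x n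
    proof -
      have "f (r m x) n = f m (l x n)"
        using f that unfolding balanced_def by blast
      then show ?thesis
        using that diff[of "frag_of (r m x, n)" "frag_of (m, l x n)"]
        by (simp add: r_closed l_closed e_frag a_minus_def U.r_neg balanced_closed)
    qed
    from p consider m m' n where "m \<in> carrier M" "m' \<in> carrier M" "n \<in> carrier N"
        "p = frag_of (m \<oplus>\<^bsub>M\<^esub> m', n) - frag_of (m, n) - frag_of (m', n)"
      | m n n' where "m \<in> carrier M" "n \<in> carrier N" "n' \<in> carrier N"
        "p = frag_of (m, n \<oplus>\<^bsub>N\<^esub> n') - frag_of (m, n) - frag_of (m, n')"
      | m x n where "m \<in> carrier M" "x \<in> S" "n \<in> carrier N"
        "p = frag_of (r m x, n) - frag_of (m, l x n)"
      unfolding tens_rels_def by (elim UnE CollectE exE conjE) simp_all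
    then show ?thesis by cases (fact 1, fact 2, fact 3)
  qed
  have "p \<in> generate Fr (tens_rels S M r N l)" using assms by (simp add: tens_null_def)
  then have "p \<in> carrier Fr \<and> e p = \<zero>\<^bsub>U\<^esub>"
  proof (induction rule: generate.induct)
    case one
    then show ?case using P.hom_one P.G.one_closed by simp
  next
    case (incl h)
    then show ?case using rels rels_subset by blast
  next
    case (inv h)
    then have h: "h \<in> carrier Fr" using rels_subset by blast
    have "e (inv\<^bsub>Fr\<^esub> h) = \<zero>\<^bsub>U\<^esub>" using rels[OF inv] P.hom_inv[OF h] group.inv_closed[OF U.a_group] monoid.inv_one[OF group.is_monoid[OF U.a_group]] by simp
    then show ?case using P.G.inv_closed[OF h] by blast
  next
    case (eng h1 h2)
    then show ?case using P.hom_mult[of h1 h2] P.G.m_closed[of h1 h2]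
      by (simp del: carrier_free_Abelian_group_iff mult_free_Abelian_group)
  qed
  then show ?thesis by (simp add: e_def)
qed

lemma ev_add:
  "p \<in> carrier Fr \<Longrightarrow> q \<in> carrier Fr \<Longrightarrow> ev (p + q) = ev p \<oplus>\<^bsub>U\<^esub> ev q"
  using hom_mult[OF ev_hom, of p q] by (simp only: mult_free_Abelian_group monoid.simps)

lemma ev_closed: "p \<in> carrier Fr \<Longrightarrow> ev p \<in> carrier U"
  by (auto simp: subset_iff balanced_closed intro!: U.finsum_closed)

text \<open>This is the independence of the representative: the chosen one differs from
  \<open>p\<close> by a null element, on which evaluation vanishes.\<close>

lemma lift_coset:
  assumes p: "p \<in> carrier Fr"
  shows "tens_lift U f (H #>\<^bsub>Fr\<^esub> p) = ev p"
proof -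
  define q where "q = (SOME q. q \<in> H #>\<^bsub>Fr\<^esub> p)"
  have qp: "q - p \<in> H" unfolding q_def by (rule rep_diff[OF p])
  then have qpc: "q - p \<in> carrier Fr" using subgroup.subset[OF H_subgroup] by blast
  have "ev q = ev ((q - p) + p)" by (simp only: diff_add_cancel)
  also have "\<dots> = ev (q - p) \<oplus>\<^bsub>U\<^esub> ev p"
    by (rule ev_add[OF qpc p])
  also have "\<dots> = ev p"
    by (simp only: ev_null[OF qp] U.l_zero[OF ev_closed[OF p]])
  finally show ?thesis by (simp only: tens_lift_def Let_def q_def)
qed

lemma lift_pure: "m \<in> carrier M \<Longrightarrow> n \<in> carrier N \<Longrightarrow> tens_lift U f (pure m n) = f m n"
  unfolding tens_pure_def by (simp only: lift_coset frag_pair_in ev_frag_of)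

lemma lift_additive: "additive MN U (tens_lift U f)"
proof (rule additiveI)
  fix s t assume "s \<in> carrier MN" "t \<in> carrier MN"
  then obtain p q where p: "p \<in> carrier Fr" "s = H #>\<^bsub>Fr\<^esub> p" and q: "q \<in> carrier Fr" "t = H #>\<^bsub>Fr\<^esub> q"
    by (auto simp: carrier_tens)
  show "tens_lift U f (s \<oplus>\<^bsub>MN\<^esub> t) = tens_lift U f s \<oplus>\<^bsub>U\<^esub> tens_lift U f t"
    unfolding p(2) q(2) coset_add[OF p(1) q(1)] lift_coset[OF G_add[OF p(1) q(1)]]
      lift_coset[OF p(1)] lift_coset[OF q(1)]
    by (rule ev_add[OF p(1) q(1)])
qed (rule lift_closed[OF U], auto simp: balanced_closed)

lemma lift_unique:
  assumes "additive MN U g" "t \<in> carrier MN"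
    and "\<And>m n. m \<in> carrier M \<Longrightarrow> n \<in> carrier N \<Longrightarrow> g (pure m n) = f m n"
  shows "tens_lift U f t = g t"
  by (rule additive_ext[OF U lift_additive assms(1,2)]) (simp add: assms(3) lift_pure)

end

end

section \<open>Scalar multiplication on tensor products\<close>

context tensor
begin

lemma hom_eq_on_free:
  assumes "abelian_group U" "g \<in> hom Fr (add_monoid U)" "h \<in> hom Fr (add_monoid U)" "p \<in> carrier Fr"
    and "\<And>m n. m \<in> carrier M \<Longrightarrow> n \<in> carrier N \<Longrightarrow> g (frag_of (m, n)) = h (frag_of (m, n))"
  shows "g p = h p"
proof -
  interpret U: abelian_group U by fact
  interpret g: group_hom Fr "add_monoid U" g
    using assms(2) U.a_group by (simp add: group_hom_def group_hom_axioms_def)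
  interpret h: group_hom Fr "add_monoid U" h
    using assms(3) U.a_group by (simp add: group_hom_def group_hom_axioms_def)
  have k: "Poly_Mapping.keys p \<subseteq> carrier M \<times> carrier N" using assms(4) by simp
  show ?thesis
  proof (induction rule: free_Abelian_group_induct[OF k])
    case 1
    then show ?case using g.hom_one h.hom_one by simp
  next
    case (2 x y)
    have x: "x \<in> carrier Fr" and y: "y \<in> carrier Fr" using 2 by auto
    have "x - y = x \<otimes>\<^bsub>Fr\<^esub> inv\<^bsub>Fr\<^esub> y" using y by simp
    moreover have "g (x \<otimes>\<^bsub>Fr\<^esub> inv\<^bsub>Fr\<^esub> y) = h (x \<otimes>\<^bsub>Fr\<^esub> inv\<^bsub>Fr\<^esub> y)"
      using g.hom_mult[OF x g.G.inv_closed[OF y]] h.hom_mult[OF x g.G.inv_closed[OF y]]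
        g.hom_inv[OF y] h.hom_inv[OF y] 2 by (simp only:)
    ultimately show ?case by (simp only:)
  next
    case (3 a)
    then show ?case using assms(5)[of "fst a" "snd a"] by auto
  qed
qed

text \<open>The scalar product of \<open>tens\<close> is defined through a chosen representative and
  acts on the left factor. Since \<open>c\<close> commutes with the right action, the integrand is
  balanced; comparing homomorphisms on the free group shows that the definition is its lift.\<close>

lemma smult_eq_lift:
  assumes "additive M M (\<lambda>m. c \<odot>\<^bsub>M\<^esub> m)"
    and "\<And>m x. m \<in> carrier M \<Longrightarrow> x \<in> S \<Longrightarrow> c \<odot>\<^bsub>M\<^esub> r m x = r (c \<odot>\<^bsub>M\<^esub> m) x"
    and "t \<in> carrier MN"
  shows "c \<odot>\<^bsub>MN\<^esub> t = tens_lift MN (\<lambda>m n. pure (c \<odot>\<^bsub>M\<^esub> m) n) t"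
    and "balanced S M r N l MN (\<lambda>m n. pure (c \<odot>\<^bsub>M\<^esub> m) n)"
proof -
  have cM: "c \<odot>\<^bsub>M\<^esub> m \<in> carrier M" if "m \<in> carrier M" for m
    using additive_closed[OF assms(1) that] .
  show bal: "balanced S M r N l MN (\<lambda>m n. pure (c \<odot>\<^bsub>M\<^esub> m) n)"
    by (rule balancedI)
      (simp_all add: assms(2)[symmetric] additive_add[OF assms(1)] cM pure_add_left pure_add_right pure_balanced[symmetric])
  define g where "g = (\<lambda>z. frag_of (c \<odot>\<^bsub>M\<^esub> fst z, snd z :: 'n))"
  define e where "e = (\<lambda>p :: ('m \<times> 'n) \<Rightarrow>\<^sub>0 int. \<Oplus>\<^bsub>MN\<^esub>z \<in> Poly_Mapping.keys p.
    [Poly_Mapping.lookup p z] \<cdot>\<^bsub>MN\<^esub> pure (c \<odot>\<^bsub>M\<^esub> fst z) (snd z))"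
  have e_hom: "e \<in> hom Fr (add_monoid MN)"
    unfolding e_def by (rule ev_hom[OF MN.abelian_group_axioms bal])
  have g_keys: "Poly_Mapping.keys (g z) \<subseteq> carrier M \<times> carrier N" if "z \<in> carrier M \<times> carrier N" for z
    unfolding g_def keys_frag_of using cM that by (cases z) simp
  have g_closed: "frag_extend g p \<in> carrier Fr" if "p \<in> carrier Fr" for p
  proof -
    have "Poly_Mapping.keys p \<subseteq> carrier M \<times> carrier N" using that by simp
    then have "(\<Union>z \<in> Poly_Mapping.keys p. Poly_Mapping.keys (g z)) \<subseteq> carrier M \<times> carrier N"
      by (intro UN_least g_keys) (rule subsetD)
    then show ?thesis using order_trans[OF keys_frag_extend] by (simp only: carrier_free_Abelian_group_iff)
  qed
  have h_hom: "(\<lambda>p. H #>\<^bsub>Fr\<^esub> frag_extend g p) \<in> hom Fr (add_monoid MN)"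
  proof (rule homI)
    fix p assume "p \<in> carrier Fr"
    then show "H #>\<^bsub>Fr\<^esub> frag_extend g p \<in> carrier (add_monoid MN)"
      using g_closed carrier_tens by (simp del: carrier_free_Abelian_group_iff)
  next
    fix p q assume "p \<in> carrier Fr" "q \<in> carrier Fr"
    then show "H #>\<^bsub>Fr\<^esub> frag_extend g (p \<otimes>\<^bsub>Fr\<^esub> q) =
        (H #>\<^bsub>Fr\<^esub> frag_extend g p) \<otimes>\<^bsub>add_monoid MN\<^esub> (H #>\<^bsub>Fr\<^esub> frag_extend g q)"
      by (simp only: coset_add[OF g_closed g_closed] frag_extend_add mult_free_Abelian_group monoid.simps)
  qed
  have eq: "H #>\<^bsub>Fr\<^esub> frag_extend g p = e p" if "p \<in> carrier Fr" for p
  proof (rule hom_eq_on_free[OF MN.abelian_group_axioms h_hom e_hom that])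
    fix m n assume mn: "m \<in> carrier M" "n \<in> carrier N"
    have "e (frag_of (m, n)) = pure (c \<odot>\<^bsub>M\<^esub> m) n"
      unfolding e_def by (rule ev_frag_of[OF MN.abelian_group_axioms bal mn])
    then show "H #>\<^bsub>Fr\<^esub> frag_extend g (frag_of (m, n)) = e (frag_of (m, n))"
      by (simp add: tens_pure_def g_def)
  qed
  have "c \<odot>\<^bsub>MN\<^esub> t = H #>\<^bsub>Fr\<^esub> frag_extend g (SOME p. p \<in> t)"
    by (simp only: tens_def Let_def module.simps g_def split_def)
  also have "\<dots> = e (SOME p. p \<in> t)" by (rule eq[OF rep_of(1)[OF assms(3)]])
  finally show "c \<odot>\<^bsub>MN\<^esub> t = tens_lift MN (\<lambda>m n. pure (c \<odot>\<^bsub>M\<^esub> m) n) t"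
    by (simp only: e_def tens_lift_def Let_def)
qed

context
  fixes c
  assumes c_add: "additive M M (\<lambda>m. c \<odot>\<^bsub>M\<^esub> m)"
    and c_r: "\<And>m x. m \<in> carrier M \<Longrightarrow> x \<in> S \<Longrightarrow> c \<odot>\<^bsub>M\<^esub> r m x = r (c \<odot>\<^bsub>M\<^esub> m) x"
begin

lemma smult_pure: "m \<in> carrier M \<Longrightarrow> n \<in> carrier N \<Longrightarrow> c \<odot>\<^bsub>MN\<^esub> pure m n = pure (c \<odot>\<^bsub>M\<^esub> m) n"
  using smult_eq_lift[OF c_add c_r, of "pure m n"]
    lift_pure[OF MN.abelian_group_axioms smult_eq_lift(2)[OF c_add c_r MN.zero_closed], of m n]
  by auto

lemma smult_additive: "additive MN MN (\<lambda>t. c \<odot>\<^bsub>MN\<^esub> t)"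
proof -
  have "additive MN MN (tens_lift MN (\<lambda>m n. pure (c \<odot>\<^bsub>M\<^esub> m) n))"
    by (rule lift_additive[OF MN.abelian_group_axioms smult_eq_lift(2)[OF c_add c_r MN.zero_closed]])
  then show ?thesis using smult_eq_lift(1)[OF c_add c_r] by (auto simp: additive_def hom_def)
qed

lemma lift_smult:
  fixes U :: "('k, 'u, 'z) module_scheme"
  assumes "abelian_group U" "balanced S M r N l U f" "balanced S M r N l U g" "t \<in> carrier MN"
    and "\<And>m n. m \<in> carrier M \<Longrightarrow> n \<in> carrier N \<Longrightarrow> f (c \<odot>\<^bsub>M\<^esub> m) n = g m n"
  shows "tens_lift U f (c \<odot>\<^bsub>MN\<^esub> t) = tens_lift U g t"
  by (rule additive_ext[OF assms(1) additive_compose[OF smult_additive lift_additive[OF assms(1,2)]]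
        lift_additive[OF assms(1,3)] assms(4)])
    (simp add: smult_pure lift_pure[OF assms(1,2)] lift_pure[OF assms(1,3)] assms(5) additive_closed[OF c_add])

end

end

abbreviation kbalanced ::
  "('k, 'w) ring_scheme \<Rightarrow> ('k, 'm, 'x) module_scheme \<Rightarrow> ('k, 'n, 'y) module_scheme
    \<Rightarrow> ('t, 'z) ring_scheme \<Rightarrow> ('m \<Rightarrow> 'n \<Rightarrow> 't) \<Rightarrow> bool" where
  "kbalanced k M N \<equiv> balanced (carrier k) M (\<lambda>m c. c \<odot>\<^bsub>M\<^esub> m) N (\<lambda>c n. c \<odot>\<^bsub>N\<^esub> n)"

text \<open>On both factors only closure under scalars is recorded. In this form it also covers A
  \<otimes> (F \<otimes> Omega B), whose right factor appears below just as an abelian group with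
  scalar operators.\<close>

locale ktensor =
  M: abelian_group M + N: abelian_group N
  for k :: "('k, 'w) ring_scheme" and M :: "('k, 'm, 'x) module_scheme" and N :: "('k, 'n, 'y) module_scheme" +
  assumes M_smult_closed: "c \<in> carrier k \<Longrightarrow> m \<in> carrier M \<Longrightarrow> c \<odot>\<^bsub>M\<^esub> m \<in> carrier M"
    and N_smult_closed: "c \<in> carrier k \<Longrightarrow> n \<in> carrier N \<Longrightarrow> c \<odot>\<^bsub>N\<^esub> n \<in> carrier N"
begin

sublocale tensor "carrier k" M "\<lambda>m c. c \<odot>\<^bsub>M\<^esub> m" N "\<lambda>c n. c \<odot>\<^bsub>N\<^esub> n"
  rewrites "tens (carrier k) M (\<lambda>m c. c \<odot>\<^bsub>M\<^esub> m) N (\<lambda>c n. c \<odot>\<^bsub>N\<^esub> n) = ktens k M N"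
    and "tens_pure (carrier k) M (\<lambda>m c. c \<odot>\<^bsub>M\<^esub> m) N (\<lambda>c n. c \<odot>\<^bsub>N\<^esub> n) = kpure k M N"
  by (simp_all add: tensor_def tensor_axioms_def M.abelian_group_axioms N.abelian_group_axioms
      M_smult_closed N_smult_closed ktens_def kpure_def)

end

lemma (in module) smult_additive_module: "c \<in> carrier R \<Longrightarrow> additive M M (\<lambda>m. c \<odot>\<^bsub>M\<^esub> m)"
  by (rule additiveI) (auto simp: smult_r_distr)

locale ktensor_module = ktensor k M N + cring k + module k M
  for k :: "('k, 'w) ring_scheme" and M :: "('k, 'm, 'x) module_scheme" and N :: "('k, 'n, 'y) module_scheme"
begin

lemma c_r: "c \<in> carrier k \<Longrightarrow> m \<in> carrier M \<Longrightarrow> x \<in> carrier k \<Longrightarrow> c \<odot>\<^bsub>M\<^esub> (x \<odot>\<^bsub>M\<^esub> m) = x \<odot>\<^bsub>M\<^esub> (c \<odot>\<^bsub>M\<^esub> m)"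
  by (metis smult_assoc1 m_comm)

lemma ksmult_pure:
  assumes "c \<in> carrier k" "m \<in> carrier M" "n \<in> carrier N"
  shows "c \<odot>\<^bsub>ktens k M N\<^esub> kpure k M N m n = kpure k M N (c \<odot>\<^bsub>M\<^esub> m) n"
  by (rule smult_pure[OF smult_additive_module]) (use assms c_r in auto)

lemma ksmult_additive: "c \<in> carrier k \<Longrightarrow> additive (ktens k M N) (ktens k M N) (\<lambda>t. c \<odot>\<^bsub>ktens k M N\<^esub> t)"
  by (rule smult_additive[OF smult_additive_module]) (use c_r in auto)

lemma ksmult_closed: "c \<in> carrier k \<Longrightarrow> t \<in> carrier (ktens k M N) \<Longrightarrow> c \<odot>\<^bsub>ktens k M N\<^esub> t \<in> carrier (ktens k M N)"
  using additive_closed[OF ksmult_additive] .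

end

section \<open>The universal differential graded algebra\<close>

lemma dgterms_simps [simp]:
  "Gen a \<in> dgterms k A \<longleftrightarrow> a \<in> carrier A"
  "Zero \<in> dgterms k A"
  "Plus s t \<in> dgterms k A \<longleftrightarrow> s \<in> dgterms k A \<and> t \<in> dgterms k A"
  "Scal c t \<in> dgterms k A \<longleftrightarrow> c \<in> carrier k \<and> t \<in> dgterms k A"
  "Times s t \<in> dgterms k A \<longleftrightarrow> s \<in> dgterms k A \<and> t \<in> dgterms k A"
  "Dif t \<in> dgterms k A \<longleftrightarrow> t \<in> dgterms k A"
  by (auto simp: dgterms_def)

lemma homog_dgterms: "homog k A n t \<Longrightarrow> t \<in> dgterms k A"
  by (induction rule: homog.induct) auto

text \<open>Interprets formal expressions in an algebra \<open>Y\<close> with a candidate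
  differential \<open>\<delta>\<close>. Once shown to respect \<open>dgeq\<close>, it yields linear
  maps out of the universal algebra.\<close>

primrec dgeval ::
  "('k, 'x, 'y) module_scheme \<Rightarrow> ('a \<Rightarrow> 'x) \<Rightarrow> ('x \<Rightarrow> 'x) \<Rightarrow> ('k, 'a) dgterm \<Rightarrow> 'x" where
  "dgeval Y \<phi> \<delta> (Gen a) = \<phi> a"
| "dgeval Y \<phi> \<delta> Zero = \<zero>\<^bsub>Y\<^esub>"
| "dgeval Y \<phi> \<delta> (Plus s t) = dgeval Y \<phi> \<delta> s \<oplus>\<^bsub>Y\<^esub> dgeval Y \<phi> \<delta> t"
| "dgeval Y \<phi> \<delta> (Scal c t) = c \<odot>\<^bsub>Y\<^esub> dgeval Y \<phi> \<delta> t"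
| "dgeval Y \<phi> \<delta> (Times s t) = dgeval Y \<phi> \<delta> s \<otimes>\<^bsub>Y\<^esub> dgeval Y \<phi> \<delta> t"
| "dgeval Y \<phi> \<delta> (Dif t) = \<delta> (dgeval Y \<phi> \<delta> t)"

lemma (in module) minus_one_smult: "x \<in> carrier M \<Longrightarrow> (\<ominus>\<^bsub>R\<^esub> \<one>\<^bsub>R\<^esub>) \<odot>\<^bsub>M\<^esub> x = \<ominus>\<^bsub>M\<^esub> x"
  using smult_l_minus[of "\<one>\<^bsub>R\<^esub>" x] by simp

locale universal = cring k + A: ring A + A: module k A
  for k :: "('k, 'z) ring_scheme" (structure) and A :: "('k, 'a, 'y) module_scheme" +
  assumes alg: "algebra_over k A"
begin

abbreviation W where "W \<equiv> universal_calculus k A"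
abbreviation cl where "cl \<equiv> dgclass k A"
abbreviation sg where "sg n \<equiv> (\<ominus>\<^bsub>k\<^esub> \<one>\<^bsub>k\<^esub>) [^]\<^bsub>k\<^esub> (n::nat)"

lemma sg_closed [simp]: "sg n \<in> carrier k"
  by simp

lemma A_smult: "c \<in> carrier k \<Longrightarrow> x \<in> carrier A \<Longrightarrow> y \<in> carrier A \<Longrightarrow> (c \<odot>\<^bsub>A\<^esub> x) \<otimes>\<^bsub>A\<^esub> y = c \<odot>\<^bsub>A\<^esub> (x \<otimes>\<^bsub>A\<^esub> y)"
  "c \<in> carrier k \<Longrightarrow> x \<in> carrier A \<Longrightarrow> y \<in> carrier A \<Longrightarrow> x \<otimes>\<^bsub>A\<^esub> (c \<odot>\<^bsub>A\<^esub> y) = c \<odot>\<^bsub>A\<^esub> (x \<otimes>\<^bsub>A\<^esub> y)"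
  using alg by (auto simp: algebra_over_def)

lemma dgeq_dgterms: "dgeq k A s t \<Longrightarrow> s \<in> dgterms k A \<and> t \<in> dgterms k A"
  by (induction rule: dgeq.induct) (auto dest: homog_dgterms)

lemma cl_eq: "dgeq k A s t \<Longrightarrow> cl s = cl t"
  unfolding dgclass_def by (auto intro: dgeq_sym dgeq_trans)

lemma rep_cl:
  assumes "t \<in> dgterms k A"
  shows "(SOME s. s \<in> cl t) \<in> dgterms k A" "dgeq k A (SOME s. s \<in> cl t) t"
proof -
  have "t \<in> cl t" using dgeq_refl[OF assms] by (simp add: dgclass_def)
  then have "(SOME s. s \<in> cl t) \<in> cl t" by (rule someI)
  then have *: "dgeq k A t (SOME s. s \<in> cl t)" by (simp add: dgclass_def)
  then show "(SOME s. s \<in> cl t) \<in> dgterms k A" by (simp add: dgeq_dgterms)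
  show "dgeq k A (SOME s. s \<in> cl t) t" using * by (rule dgeq_sym)
qed

lemma carrier_W: "carrier W = cl ` dgterms k A"
  by (simp add: universal_calculus_def Let_def)

lemma cl_closed [simp]: "t \<in> dgterms k A \<Longrightarrow> cl t \<in> carrier W"
  by (simp add: carrier_W)

text \<open>The operations on classes are defined through chosen representatives; the congruence
  clauses of \<open>dgeq\<close> make the choice immaterial.\<close>

lemma W_ops:
  "s \<in> dgterms k A \<Longrightarrow> t \<in> dgterms k A \<Longrightarrow> cl s \<oplus>\<^bsub>W\<^esub> cl t = cl (Plus s t)"
  "s \<in> dgterms k A \<Longrightarrow> t \<in> dgterms k A \<Longrightarrow> cl s \<otimes>\<^bsub>W\<^esub> cl t = cl (Times s t)"
  "c \<in> carrier k \<Longrightarrow> t \<in> dgterms k A \<Longrightarrow> c \<odot>\<^bsub>W\<^esub> cl t = cl (Scal c t)"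
  "t \<in> dgterms k A \<Longrightarrow> dif W (cl t) = cl (Dif t)"
  "\<zero>\<^bsub>W\<^esub> = cl Zero" "\<one>\<^bsub>W\<^esub> = cl (Gen \<one>\<^bsub>A\<^esub>)" "incl W a = cl (Gen a)"
  "grade W n = cl ` {t. homog k A n t}"
  by (auto simp: universal_calculus_def Let_def rep_cl intro!: cl_eq
      intro: cong_Plus cong_Times cong_Scal cong_Dif)

lemma W_cases:
  assumes "w \<in> carrier W"
  obtains t where "t \<in> dgterms k A" "w = cl t"
  using assms by (auto simp: carrier_W)

lemma W_abelian: "abelian_group W"
proof (rule abelian_groupI)
  fix x y z assume "x \<in> carrier W" "y \<in> carrier W" "z \<in> carrier W"
  then show "x \<oplus>\<^bsub>W\<^esub> y \<oplus>\<^bsub>W\<^esub> z = x \<oplus>\<^bsub>W\<^esub> (y \<oplus>\<^bsub>W\<^esub> z)"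
    by (elim W_cases) (simp add: W_ops cl_eq[OF Plus_assoc])
next
  fix x y assume "x \<in> carrier W" "y \<in> carrier W"
  then show "x \<oplus>\<^bsub>W\<^esub> y = y \<oplus>\<^bsub>W\<^esub> x"
    by (elim W_cases) (simp add: W_ops, rule cl_eq[OF Plus_comm])
next
  fix x assume "x \<in> carrier W"
  then obtain t where t: "t \<in> dgterms k A" "x = cl t" by (elim W_cases)
  show "\<zero>\<^bsub>W\<^esub> \<oplus>\<^bsub>W\<^esub> x = x" using t by (simp add: W_ops cl_eq[OF Plus_Zero])
  have "cl (Plus (Scal (\<ominus>\<^bsub>k\<^esub> \<one>\<^bsub>k\<^esub>) t) t) = cl Zero"
    using t cl_eq[OF Plus_comm, of "Scal (\<ominus>\<^bsub>k\<^esub> \<one>\<^bsub>k\<^esub>) t" t] cl_eq[OF Plus_inv, of t] by simp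
  then show "\<exists>y\<in>carrier W. y \<oplus>\<^bsub>W\<^esub> x = \<zero>\<^bsub>W\<^esub>"
    using t by (intro bexI[of _ "cl (Scal (\<ominus>\<^bsub>k\<^esub> \<one>\<^bsub>k\<^esub>) t)"]) (simp_all add: W_ops)
qed (auto elim!: W_cases simp: W_ops)

lemma W_ring: "ring W"
proof (rule ringI[OF W_abelian])
  show "monoid W"
  proof (rule monoidI)
    fix x y z assume "x \<in> carrier W" "y \<in> carrier W" "z \<in> carrier W"
    then show "x \<otimes>\<^bsub>W\<^esub> y \<otimes>\<^bsub>W\<^esub> z = x \<otimes>\<^bsub>W\<^esub> (y \<otimes>\<^bsub>W\<^esub> z)"
      by (elim W_cases) (simp add: W_ops cl_eq[OF Times_assoc])
  qed (auto elim!: W_cases simp: W_ops cl_eq[OF Times_one_left] cl_eq[OF Times_one_right])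
next
  fix x y z assume "x \<in> carrier W" "y \<in> carrier W" "z \<in> carrier W"
  then show "(x \<oplus>\<^bsub>W\<^esub> y) \<otimes>\<^bsub>W\<^esub> z = x \<otimes>\<^bsub>W\<^esub> z \<oplus>\<^bsub>W\<^esub> y \<otimes>\<^bsub>W\<^esub> z"
    "z \<otimes>\<^bsub>W\<^esub> (x \<oplus>\<^bsub>W\<^esub> y) = z \<otimes>\<^bsub>W\<^esub> x \<oplus>\<^bsub>W\<^esub> z \<otimes>\<^bsub>W\<^esub> y"
    by (elim W_cases, simp add: W_ops cl_eq[OF Times_Plus_left] cl_eq[OF Times_Plus_right])+
qed

sublocale W: ring W by (rule W_ring)

lemma W_module: "module k W"
proof (rule moduleI[OF is_cring W_abelian])
  fix a x assume "a \<in> carrier k" "x \<in> carrier W"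
  then show "a \<odot>\<^bsub>W\<^esub> x \<in> carrier W" by (elim W_cases) (simp add: W_ops)
next
  fix a b x assume "a \<in> carrier k" "b \<in> carrier k" "x \<in> carrier W"
  then show "(a \<oplus> b) \<odot>\<^bsub>W\<^esub> x = a \<odot>\<^bsub>W\<^esub> x \<oplus>\<^bsub>W\<^esub> b \<odot>\<^bsub>W\<^esub> x"
    "(a \<otimes> b) \<odot>\<^bsub>W\<^esub> x = a \<odot>\<^bsub>W\<^esub> (b \<odot>\<^bsub>W\<^esub> x)"
    by (elim W_cases, simp add: W_ops cl_eq[OF Scal_add] cl_eq[OF Scal_mult])+
next
  fix a x y assume "a \<in> carrier k" "x \<in> carrier W" "y \<in> carrier W"
  then show "a \<odot>\<^bsub>W\<^esub> (x \<oplus>\<^bsub>W\<^esub> y) = a \<odot>\<^bsub>W\<^esub> x \<oplus>\<^bsub>W\<^esub> a \<odot>\<^bsub>W\<^esub> y"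
    by (elim W_cases) (simp add: W_ops cl_eq[OF Scal_Plus])
next
  fix x assume "x \<in> carrier W"
  then show "\<one> \<odot>\<^bsub>W\<^esub> x = x" by (elim W_cases) (simp add: W_ops cl_eq[OF Scal_one])
qed

sublocale W: module k W by (rule W_module)

lemma W_smult:
  "c \<in> carrier k \<Longrightarrow> x \<in> carrier W \<Longrightarrow> y \<in> carrier W \<Longrightarrow> (c \<odot>\<^bsub>W\<^esub> x) \<otimes>\<^bsub>W\<^esub> y = c \<odot>\<^bsub>W\<^esub> (x \<otimes>\<^bsub>W\<^esub> y)"
  "c \<in> carrier k \<Longrightarrow> x \<in> carrier W \<Longrightarrow> y \<in> carrier W \<Longrightarrow> x \<otimes>\<^bsub>W\<^esub> (c \<odot>\<^bsub>W\<^esub> y) = c \<odot>\<^bsub>W\<^esub> (x \<otimes>\<^bsub>W\<^esub> y)"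
  by (elim W_cases, simp add: W_ops cl_eq[OF Times_Scal_left] cl_eq[OF Times_Scal_right])+

lemma W_algebra: "algebra_over k W"
  by (simp add: algebra_over_def W_ring W_module W_smult)

lemma incl_closed [simp]: "a \<in> carrier A \<Longrightarrow> incl W a \<in> carrier W"
  by (simp add: W_ops)

lemma incl_add: "a \<in> carrier A \<Longrightarrow> b \<in> carrier A \<Longrightarrow> incl W (a \<oplus>\<^bsub>A\<^esub> b) = incl W a \<oplus>\<^bsub>W\<^esub> incl W b"
  by (simp add: W_ops cl_eq[OF Gen_add])

lemma incl_mult: "a \<in> carrier A \<Longrightarrow> b \<in> carrier A \<Longrightarrow> incl W (a \<otimes>\<^bsub>A\<^esub> b) = incl W a \<otimes>\<^bsub>W\<^esub> incl W b"
  by (simp add: W_ops cl_eq[OF Gen_mult])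

lemma incl_smult: "c \<in> carrier k \<Longrightarrow> a \<in> carrier A \<Longrightarrow> incl W (c \<odot>\<^bsub>A\<^esub> a) = c \<odot>\<^bsub>W\<^esub> incl W a"
  by (simp add: W_ops cl_eq[OF Gen_smult])

lemma incl_one: "incl W \<one>\<^bsub>A\<^esub> = \<one>\<^bsub>W\<^esub>"
  by (simp add: W_ops)

lemma dif_closed [simp]: "w \<in> carrier W \<Longrightarrow> dif W w \<in> carrier W"
  by (elim W_cases) (simp add: W_ops)

lemma dif_add: "v \<in> carrier W \<Longrightarrow> w \<in> carrier W \<Longrightarrow> dif W (v \<oplus>\<^bsub>W\<^esub> w) = dif W v \<oplus>\<^bsub>W\<^esub> dif W w"
  by (elim W_cases) (simp add: W_ops cl_eq[OF Dif_Plus])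

lemma dif_smult: "c \<in> carrier k \<Longrightarrow> w \<in> carrier W \<Longrightarrow> dif W (c \<odot>\<^bsub>W\<^esub> w) = c \<odot>\<^bsub>W\<^esub> dif W w"
  by (elim W_cases) (simp add: W_ops cl_eq[OF Dif_Scal])

lemma dif_additive: "additive W W (dif W)"
  by (rule additiveI) (auto simp: dif_add)

lemma dif_dif: "w \<in> carrier W \<Longrightarrow> dif W (dif W w) = \<zero>\<^bsub>W\<^esub>"
  by (elim W_cases) (simp add: W_ops cl_eq[OF Dif_Dif])

lemma dif_minus: "w \<in> carrier W \<Longrightarrow> dif W (\<ominus>\<^bsub>W\<^esub> w) = \<ominus>\<^bsub>W\<^esub> dif W w"
  by (rule additive_minus[OF W_abelian W_abelian dif_additive])

lemma dif_homog:
  assumes "homog k A n s" "w \<in> carrier W"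
  shows "dif W (cl s \<otimes>\<^bsub>W\<^esub> w) = dif W (cl s) \<otimes>\<^bsub>W\<^esub> w \<oplus>\<^bsub>W\<^esub> sg n \<odot>\<^bsub>W\<^esub> (cl s \<otimes>\<^bsub>W\<^esub> dif W w)"
  using assms homog_dgterms[OF assms(1)]
  by (elim W_cases) (simp add: W_ops cl_eq[OF Dif_Times[OF assms(1)]])

lemma dif_incl_mult:
  assumes "a \<in> carrier A" "w \<in> carrier W"
  shows "dif W (incl W a \<otimes>\<^bsub>W\<^esub> w) = dif W (incl W a) \<otimes>\<^bsub>W\<^esub> w \<oplus>\<^bsub>W\<^esub> incl W a \<otimes>\<^bsub>W\<^esub> dif W w"
  using dif_homog[OF homog.intros(1)[OF assms(1)] assms(2)] assms
  by (simp add: W_ops(7)[symmetric])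

text \<open>The Leibniz rule at 1 = 1 \<cdot> 1 gives d1 = d1 + d1.\<close>

lemma dif_one: "dif W \<one>\<^bsub>W\<^esub> = \<zero>\<^bsub>W\<^esub>"
proof -
  have "dif W \<one>\<^bsub>W\<^esub> = dif W \<one>\<^bsub>W\<^esub> \<oplus>\<^bsub>W\<^esub> dif W \<one>\<^bsub>W\<^esub>"
    using dif_incl_mult[of "\<one>\<^bsub>A\<^esub>" "\<one>\<^bsub>W\<^esub>"] by (simp add: incl_one)
  then show ?thesis using W.add.l_cancel_one[of "dif W \<one>\<^bsub>W\<^esub>" "dif W \<one>\<^bsub>W\<^esub>"] by simp
qed

text \<open>Forms are classes of expressions, so structural induction descends to them. It serves
  for maps such as \<open>Rt\<close>, which are known only through their behaviour on A, on products
  and on differentials.\<close>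

lemma W_induct [consumes 1, case_names incl zero add smult mult dif]:
  assumes "w \<in> carrier W"
    and "\<And>a. a \<in> carrier A \<Longrightarrow> P (incl W a)" "P \<zero>\<^bsub>W\<^esub>"
    and "\<And>v w. v \<in> carrier W \<Longrightarrow> w \<in> carrier W \<Longrightarrow> P v \<Longrightarrow> P w \<Longrightarrow> P (v \<oplus>\<^bsub>W\<^esub> w)"
    and "\<And>c w. c \<in> carrier k \<Longrightarrow> w \<in> carrier W \<Longrightarrow> P w \<Longrightarrow> P (c \<odot>\<^bsub>W\<^esub> w)"
    and "\<And>v w. v \<in> carrier W \<Longrightarrow> w \<in> carrier W \<Longrightarrow> P v \<Longrightarrow> P w \<Longrightarrow> P (v \<otimes>\<^bsub>W\<^esub> w)"
    and "\<And>w. w \<in> carrier W \<Longrightarrow> P w \<Longrightarrow> P (dif W w)"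
  shows "P w"
proof -
  obtain t where t: "t \<in> dgterms k A" "w = cl t" using assms(1) by (elim W_cases)
  have "P (cl t)" using t(1)
  proof (induction t)
    case (Gen a)
    then show ?case using assms(2)[of a] by (simp add: W_ops)
  next
    case Zero
    then show ?case using assms(3) by (simp add: W_ops)
  next
    case (Plus s t)
    then show ?case using assms(4)[of "cl s" "cl t"] by (simp add: W_ops)
  next
    case (Scal c t)
    then show ?case using assms(5)[of c "cl t"] by (simp add: W_ops)
  next
    case (Times s t)
    then show ?case using assms(6)[of "cl s" "cl t"] by (simp add: W_ops)
  next
    case (Dif t)
    then show ?case using assms(7)[of "cl t"] by (simp add: W_ops)
  qed
  then show ?thesis using t by simp
qed

lemma grade_subset: "grade W n \<subseteq> carrier W"
  by (auto simp: W_ops homog_dgterms)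

abbreviation homs where "homs \<equiv> (\<Union>n. grade W n)"

lemma homs_subset: "homs \<subseteq> carrier W"
  using grade_subset by blast

text \<open>The span of the homogeneous classes contains A and is closed under all operations; for
  products, closure is checked in one factor at a time. Directness of the sum is not
  asserted.\<close>

lemma carrier_homs:
  assumes "w \<in> carrier W"
  shows "w \<in> span_in W homs"
  using assms
proof (induction rule: W_induct)
  case (incl a)
  then have "incl W a \<in> grade W 0" by (auto simp: W_ops intro: homog.intros)
  then show ?case by (blast intro: span_in_incl)
next
  case zero
  have "\<zero>\<^bsub>W\<^esub> \<in> grade W 0" by (auto simp: W_ops intro: homog.intros)
  then show ?case by (blast intro: span_in_incl)
next
  case (add v w)
  then show ?case by (simp add: span_in_add)
next
  case (smult c w)
  show ?case
  proof (rule span_in_image[OF W_abelian W_abelian W.smult_additive_module[OF smult(1)] homs_subset homs_subset _ smult(3)])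
    fix x assume "x \<in> homs"
    then obtain n t where t: "homog k A n t" "x = cl t" by (auto simp: W_ops)
    then have "c \<odot>\<^bsub>W\<^esub> x \<in> grade W n"
      using homog_dgterms[OF t(1)] smult(1) by (auto simp: W_ops intro: homog.intros)
    then show "c \<odot>\<^bsub>W\<^esub> x \<in> span_in W homs" by (blast intro: span_in_incl)
  qed
next
  case (mult v w)
  have *: "x \<otimes>\<^bsub>W\<^esub> w \<in> span_in W homs" if xh: "x \<in> homs" for x
  proof (rule span_in_image[OF W_abelian W_abelian _ homs_subset homs_subset _ mult(4)])
    show "additive W W (\<lambda>w. x \<otimes>\<^bsub>W\<^esub> w)"
      using subsetD[OF homs_subset that] by (intro additiveI) (simp_all add: W.r_distr)
    fix y assume "y \<in> homs"
    then obtain n t where "homog k A n t" "y = cl t" by (auto simp: W_ops)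
    moreover obtain m s where "homog k A m s" "x = cl s" using xh by (auto simp: W_ops)
    ultimately have t: "homog k A m s" "x = cl s" "homog k A n t" "y = cl t" by simp_all
    then have "x \<otimes>\<^bsub>W\<^esub> y \<in> grade W (m + n)"
      using homog_dgterms[OF t(1)] homog_dgterms[OF t(3)] by (auto simp: W_ops intro: homog.intros)
    then show "x \<otimes>\<^bsub>W\<^esub> y \<in> span_in W homs" by (blast intro: span_in_incl)
  qed
  show ?case
    by (rule span_in_image[OF W_abelian W_abelian _ homs_subset homs_subset * mult(3)])
      (use mult(2) in \<open>auto intro!: additiveI simp: W.l_distr\<close>)
next
  case (dif w)
  show ?case
  proof (rule span_in_image[OF W_abelian W_abelian dif_additive homs_subset homs_subset _ dif(2)])
    fix x assume "x \<in> homs"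
    then obtain n t where t: "homog k A n t" "x = cl t" by (auto simp: W_ops)
    then have "dif W x \<in> grade W (Suc n)"
      using homog_dgterms[OF t(1)] by (auto simp: W_ops intro: homog.intros)
    then show "dif W x \<in> span_in W homs" by (blast intro: span_in_incl)
  qed
qed

lemma additive_eq_homog:
  assumes "abelian_group U" "additive W U f" "additive W U g" "w \<in> carrier W"
    and "\<And>n t. homog k A n t \<Longrightarrow> f (cl t) = g (cl t)"
  shows "f w = g w"
  by (rule additive_eq_on_span[OF W_abelian assms(1-3) homs_subset _ carrier_homs[OF assms(4)]])
    (use assms(5) in \<open>auto simp: W_ops\<close>)

section \<open>Maps out of the universal algebra, by evaluation of expressions\<close>

context
  fixes Y :: "('k, 'x, 'v) module_scheme" and \<phi> :: "'a \<Rightarrow> 'x" and \<delta> :: "'x \<Rightarrow> 'x"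
  assumes Y: "algebra_over k Y"
    and \<phi>_closed: "\<And>a. a \<in> carrier A \<Longrightarrow> \<phi> a \<in> carrier Y"
    and \<phi>_hom: "\<And>a b. a \<in> carrier A \<Longrightarrow> b \<in> carrier A \<Longrightarrow> \<phi> (a \<oplus>\<^bsub>A\<^esub> b) = \<phi> a \<oplus>\<^bsub>Y\<^esub> \<phi> b"
      "\<And>a b. a \<in> carrier A \<Longrightarrow> b \<in> carrier A \<Longrightarrow> \<phi> (a \<otimes>\<^bsub>A\<^esub> b) = \<phi> a \<otimes>\<^bsub>Y\<^esub> \<phi> b"
      "\<And>c a. c \<in> carrier k \<Longrightarrow> a \<in> carrier A \<Longrightarrow> \<phi> (c \<odot>\<^bsub>A\<^esub> a) = c \<odot>\<^bsub>Y\<^esub> \<phi> a"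
      "\<phi> \<one>\<^bsub>A\<^esub> = \<one>\<^bsub>Y\<^esub>"
    and \<delta>: "linear_over k Y Y \<delta>" "\<And>y. y \<in> carrier Y \<Longrightarrow> \<delta> (\<delta> y) = \<zero>\<^bsub>Y\<^esub>"
    and leibniz: "\<And>n s y. homog k A n s \<Longrightarrow> dgeval Y \<phi> \<delta> s \<in> carrier Y \<Longrightarrow> y \<in> carrier Y \<Longrightarrow>
      \<delta> (dgeval Y \<phi> \<delta> s \<otimes>\<^bsub>Y\<^esub> y) = \<delta> (dgeval Y \<phi> \<delta> s) \<otimes>\<^bsub>Y\<^esub> y \<oplus>\<^bsub>Y\<^esub> sg n \<odot>\<^bsub>Y\<^esub> (dgeval Y \<phi> \<delta> s \<otimes>\<^bsub>Y\<^esub> \<delta> y)"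
begin

interpretation Y: ring Y using Y by (simp add: algebra_over_def)
interpretation Y: module k Y using Y by (simp add: algebra_over_def)

lemma \<delta>_closed: "y \<in> carrier Y \<Longrightarrow> \<delta> y \<in> carrier Y"
  using \<delta>(1) by (auto simp: linear_over_def)

lemma dgeval_closed: "t \<in> dgterms k A \<Longrightarrow> dgeval Y \<phi> \<delta> t \<in> carrier Y"
  by (induction t) (auto simp: \<phi>_closed \<delta>_closed)

text \<open>Each clause of \<open>dgeq\<close> becomes an identity in \<open>Y\<close>. The graded
  Leibniz rule is the delicate one: \<open>Y\<close> comes with no grading, so the rule is assumed
  for values of homogeneous expressions, where the degree is read off the expression.\<close>

lemma dgeval_cong: "dgeq k A s t \<Longrightarrow> dgeval Y \<phi> \<delta> s = dgeval Y \<phi> \<delta> t"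
proof (induction rule: dgeq.induct)
  case (Dif_Times n s t)
  then show ?case using leibniz[of n s "dgeval Y \<phi> \<delta> t"] by (simp add: dgeval_closed homog_dgterms)
qed (use Y \<delta> in \<open>simp_all add: dgeval_closed \<phi>_hom Y.m_assoc Y.minus_one_smult Y.r_neg
    Y.smult_l_distr Y.smult_r_distr Y.smult_assoc1 Y.l_distr Y.r_distr algebra_over_def linear_over_def Y.a_ac\<close>)

lemma evaluation_exists:
  "\<exists>e. linear_over k W Y e \<and> (\<forall>t \<in> dgterms k A. e (cl t) = dgeval Y \<phi> \<delta> t)"
proof -
  define e where "e w = dgeval Y \<phi> \<delta> (SOME t. t \<in> w)" for w
  have cl: "e (cl t) = dgeval Y \<phi> \<delta> t" if "t \<in> dgterms k A" for t
    unfolding e_def by (rule dgeval_cong[OF rep_cl(2)[OF that]])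
  have "linear_over k W Y e"
    unfolding linear_over_def by (auto elim!: W_cases simp: cl dgeval_closed W_ops)
  then show ?thesis using cl by blast
qed

end

text \<open>Replacing d by -d introduces one sign for each \<open>Dif\<close>, and these signs
  multiply along products just as degrees add.\<close>

lemma homog_sg:
  assumes "homog k A n t" "\<And>a. \<phi> a = incl W a" "\<And>w. w \<in> carrier W \<Longrightarrow> \<delta> w = \<ominus>\<^bsub>W\<^esub> dif W w"
  shows "dgeval W \<phi> \<delta> t = sg n \<odot>\<^bsub>W\<^esub> cl t"
  using assms(1)
proof (induction rule: homog.induct)
  case (1 a)
  then show ?case by (simp add: assms(2) W_ops(7))
next
  case (2 n)
  then show ?case by (simp add: W_ops(5)[symmetric])
next
  case (3 n s t)
  then show ?case by (simp add: W_ops(1)[symmetric] homog_dgterms W.smult_r_distr)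
next
  case (4 c n t)
  then show ?case
    by (simp add: W_ops(3)[symmetric] homog_dgterms W.smult_assoc1[symmetric] m_comm)
next
  case (5 m s n t)
  then show ?case
    by (simp add: W_ops(2)[symmetric] homog_dgterms W_smult W.smult_assoc1[symmetric] nat_pow_mult add.commute)
next
  case (6 n t)
  then show ?case
    by (simp add: W_ops(4)[symmetric] homog_dgterms assms(3) dif_smult nat_pow_Suc W.smult_l_minus r_minus)
qed

text \<open>A definition degree by degree would require the sum of the components to be direct.
  Instead the algebra of forms is evaluated in itself, with A fixed and -d in place of d; by
  \<open>homog_sg\<close> the resulting linear map is the sign in each degree.\<close>

lemma sign_map_exists:
  "\<exists>f. linear_over k W W f \<and> (\<forall>n. \<forall>w \<in> grade W n. f w = sg n \<odot>\<^bsub>W\<^esub> w)"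
proof -
  let ?d = "\<lambda>w. \<ominus>\<^bsub>W\<^esub> dif W w"
  have lin: "linear_over k W W ?d"
    by (simp add: linear_over_def dif_add W.minus_add dif_smult W.smult_r_minus)
  have dd: "?d (?d y) = \<zero>\<^bsub>W\<^esub>" if "y \<in> carrier W" for y
    using that by (simp add: dif_minus dif_dif)
  have lb: "?d (dgeval W (incl W) ?d s \<otimes>\<^bsub>W\<^esub> y) = ?d (dgeval W (incl W) ?d s) \<otimes>\<^bsub>W\<^esub> y
      \<oplus>\<^bsub>W\<^esub> sg n \<odot>\<^bsub>W\<^esub> (dgeval W (incl W) ?d s \<otimes>\<^bsub>W\<^esub> ?d y)"
    if "homog k A n s" "y \<in> carrier W" for n s y
    using that homog_dgterms[OF that(1)]
    by (simp add: homog_sg[OF that(1)] W_smult dif_smult dif_homog W.smult_r_distr W.smult_assoc1[symmetric]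
        W.minus_add W.l_minus W.r_minus W.smult_r_minus)
  obtain e where e: "linear_over k W W e" "\<forall>t \<in> dgterms k A. e (cl t) = dgeval W (incl W) ?d t"
    using evaluation_exists[OF W_algebra incl_closed incl_add incl_mult incl_smult incl_one lin dd lb] by blast
  have "e w = sg n \<odot>\<^bsub>W\<^esub> w" if "w \<in> grade W n" for n w
    using that e(2) homog_sg by (auto simp: W_ops(8) homog_dgterms)
  then show ?thesis using e(1) by blast
qed

text \<open>Evaluation in A itself, with zero differential, fixes A and kills every homogeneous
  expression of positive degree.\<close>

lemma degree0_exists:
  "\<exists>f. linear_over k W A f \<and> (\<forall>x \<in> carrier A. f (incl W x) = x) \<and> (\<forall>n > 0. \<forall>w \<in> grade W n. f w = \<zero>\<^bsub>A\<^esub>)"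
proof -
  let ?d = "\<lambda>a. \<zero>\<^bsub>A\<^esub>"
  have lin: "linear_over k A A ?d" by (simp add: linear_over_def)
  have lb: "?d (dgeval A (\<lambda>a. a) ?d s \<otimes>\<^bsub>A\<^esub> y) = ?d (dgeval A (\<lambda>a. a) ?d s) \<otimes>\<^bsub>A\<^esub> y
      \<oplus>\<^bsub>A\<^esub> sg n \<odot>\<^bsub>A\<^esub> (dgeval A (\<lambda>a. a) ?d s \<otimes>\<^bsub>A\<^esub> ?d y)"
    if "dgeval A (\<lambda>a. a) ?d s \<in> carrier A" "y \<in> carrier A" for n s y
    using that by simp
  obtain e where e: "linear_over k W A e" "\<forall>t \<in> dgterms k A. e (cl t) = dgeval A (\<lambda>a. a) ?d t"
    using evaluation_exists[OF alg, of "\<lambda>a. a" ?d, OF _ refl refl refl refl lin refl lb] by blast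
  have zero: "dgeval A (\<lambda>a. a) ?d t = \<zero>\<^bsub>A\<^esub>" if "homog k A n t" "n > 0" for n t
    using that
  proof (induction rule: homog.induct)
    case (5 m s n t)
    have "s \<in> dgterms k A" "t \<in> dgterms k A" using 5 homog_dgterms by auto
    then have "dgeval A (\<lambda>a. a) ?d s \<in> carrier A" "dgeval A (\<lambda>a. a) ?d t \<in> carrier A"
      using dgeval_closed[OF alg, of "\<lambda>a. a" ?d, OF _ refl refl refl refl lin refl lb] by auto
    \<comment> \<open>A product of positive degree has a factor of positive degree, whose value is
      zero.\<close>
    then show ?case using 5 by (cases "m = 0") auto
  qed auto
  show ?thesis
    by (rule exI[of _ e]) (use e in \<open>auto simp: W_ops(7,8) homog_dgterms zero\<close>)
qed

section \<open>The sign automorphism and the degree-zero projection\<close>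

abbreviation sign where "sign \<equiv> sign_map k W"

lemma sign_spec: "linear_over k W W sign \<and> (\<forall>n. \<forall>w \<in> grade W n. sign w = sg n \<odot>\<^bsub>W\<^esub> w)"
  unfolding sign_map_def by (rule someI_ex[OF sign_map_exists])

lemma sign_linear: "linear_over k W W sign"
  using sign_spec by blast

lemma sign_grade: "w \<in> grade W n \<Longrightarrow> sign w = sg n \<odot>\<^bsub>W\<^esub> w"
  using sign_spec by blast

lemma sign_closed [simp]: "w \<in> carrier W \<Longrightarrow> sign w \<in> carrier W"
  using sign_linear by (auto simp: linear_over_def)

lemma sign_add: "v \<in> carrier W \<Longrightarrow> w \<in> carrier W \<Longrightarrow> sign (v \<oplus>\<^bsub>W\<^esub> w) = sign v \<oplus>\<^bsub>W\<^esub> sign w"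
  using sign_linear by (auto simp: linear_over_def)

lemma sign_smult: "c \<in> carrier k \<Longrightarrow> w \<in> carrier W \<Longrightarrow> sign (c \<odot>\<^bsub>W\<^esub> w) = c \<odot>\<^bsub>W\<^esub> sign w"
  using sign_linear by (auto simp: linear_over_def)

lemma sign_additive: "additive W W sign"
  by (rule additiveI) (auto simp: sign_add)

lemma sign_zero: "sign \<zero>\<^bsub>W\<^esub> = \<zero>\<^bsub>W\<^esub>"
  by (rule additive_zero[OF W_abelian W_abelian sign_additive])

lemma sign_minus: "w \<in> carrier W \<Longrightarrow> sign (\<ominus>\<^bsub>W\<^esub> w) = \<ominus>\<^bsub>W\<^esub> sign w"
  by (rule additive_minus[OF W_abelian W_abelian sign_additive])

lemma sign_homog: "homog k A n t \<Longrightarrow> sign (cl t) = sg n \<odot>\<^bsub>W\<^esub> cl t"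
  by (rule sign_grade) (simp add: W_ops(8))

lemma sign_incl [simp]: "a \<in> carrier A \<Longrightarrow> sign (incl W a) = incl W a"
  using sign_homog[OF homog.intros(1), of a] by (simp add: W_ops(7))

lemma sign_one [simp]: "sign \<one>\<^bsub>W\<^esub> = \<one>\<^bsub>W\<^esub>"
  using sign_incl[of "\<one>\<^bsub>A\<^esub>"] by (simp add: incl_one)

lemma sign_grade1: "w \<in> grade W 1 \<Longrightarrow> sign w = \<ominus>\<^bsub>W\<^esub> w"
  using subsetD[OF grade_subset] by (simp add: sign_grade[of w 1] W.minus_one_smult)

text \<open>Both sides are additive in each argument, and homogeneous forms span; for these the
  exponents of -1 add.\<close>

lemma sign_mult:
  assumes "v \<in> carrier W" "w \<in> carrier W"
  shows "sign (v \<otimes>\<^bsub>W\<^esub> w) = sign v \<otimes>\<^bsub>W\<^esub> sign w"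
proof -
  have 1: "sign (cl s \<otimes>\<^bsub>W\<^esub> w) = sign (cl s) \<otimes>\<^bsub>W\<^esub> sign w" if s: "homog k A m s" for m s
  proof (rule additive_eq_homog[OF W_abelian _ _ assms(2)])
    have s': "s \<in> dgterms k A" by (rule homog_dgterms[OF s])
    show "additive W W (\<lambda>w. sign (cl s \<otimes>\<^bsub>W\<^esub> w))" "additive W W (\<lambda>w. sign (cl s) \<otimes>\<^bsub>W\<^esub> sign w)"
      using s' by (auto intro!: additiveI simp: W.r_distr sign_add)
    fix n t assume t: "homog k A n t"
    show "sign (cl s \<otimes>\<^bsub>W\<^esub> cl t) = sign (cl s) \<otimes>\<^bsub>W\<^esub> sign (cl t)"
      using s' homog_dgterms[OF t] sign_homog[OF homog.intros(5)[OF s t]] W_smult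
      by (simp add: W_ops(2)[symmetric] sign_homog[OF s] sign_homog[OF t]
          W.smult_assoc1[symmetric] nat_pow_mult add.commute)
  qed
  show ?thesis
    by (rule additive_eq_homog[OF W_abelian _ _ assms(1)])
      (use assms(2) 1 in \<open>auto intro!: additiveI simp: W.l_distr sign_add\<close>)
qed

lemma sign_dif:
  assumes "w \<in> carrier W"
  shows "sign (dif W w) = \<ominus>\<^bsub>W\<^esub> dif W (sign w)"
proof (rule additive_eq_homog[OF W_abelian _ _ assms])
  show "additive W W (\<lambda>w. sign (dif W w))" "additive W W (\<lambda>w. \<ominus>\<^bsub>W\<^esub> dif W (sign w))"
    by (auto intro!: additiveI simp: dif_add sign_add W.minus_add)
  fix n t assume t: "homog k A n t"
  show "sign (dif W (cl t)) = \<ominus>\<^bsub>W\<^esub> dif W (sign (cl t))"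
    using homog_dgterms[OF t] sign_homog[OF homog.intros(6)[OF t]]
    by (simp add: W_ops(4)[symmetric] sign_homog[OF t] dif_smult W.smult_l_minus r_minus)
qed

lemma sign_sign:
  assumes "w \<in> carrier W"
  shows "sign (sign w) = w"
  using assms
  by (induction rule: W_induct)
    (simp_all add: sign_zero sign_add sign_smult sign_mult sign_dif sign_minus)

abbreviation deg0 where "deg0 \<equiv> degree0_part k A W"

lemma deg0_spec: "linear_over k W A deg0 \<and> (\<forall>x \<in> carrier A. deg0 (incl W x) = x) \<and>
    (\<forall>n > 0. \<forall>w \<in> grade W n. deg0 w = \<zero>\<^bsub>A\<^esub>)"
  unfolding degree0_part_def by (rule someI_ex[OF degree0_exists])

lemma deg0_linear: "linear_over k W A deg0"
  using deg0_spec by blast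

lemma deg0_closed [simp]: "w \<in> carrier W \<Longrightarrow> deg0 w \<in> carrier A"
  using deg0_linear by (auto simp: linear_over_def)

lemma deg0_add: "v \<in> carrier W \<Longrightarrow> w \<in> carrier W \<Longrightarrow> deg0 (v \<oplus>\<^bsub>W\<^esub> w) = deg0 v \<oplus>\<^bsub>A\<^esub> deg0 w"
  using deg0_linear by (auto simp: linear_over_def)

lemma deg0_smult: "c \<in> carrier k \<Longrightarrow> w \<in> carrier W \<Longrightarrow> deg0 (c \<odot>\<^bsub>W\<^esub> w) = c \<odot>\<^bsub>A\<^esub> deg0 w"
  using deg0_linear by (auto simp: linear_over_def)

lemma deg0_incl [simp]: "a \<in> carrier A \<Longrightarrow> deg0 (incl W a) = a"
  using deg0_spec by blast

end

section \<open>Twisted products\<close>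

definition lmul ::
  "('k, 'z) ring_scheme \<Rightarrow> ('k, 'a, 'x) module_scheme \<Rightarrow> ('k, 'f, 'y) module_scheme \<Rightarrow> 'a \<Rightarrow> ('a, 'f) tensor \<Rightarrow> ('a, 'f) tensor" where
  "lmul k A F a t = tens_lift (ktens k A F) (\<lambda>x f. kpure k A F (a \<otimes>\<^bsub>A\<^esub> x) f) t"

definition rmul ::
  "('k, 'z) ring_scheme \<Rightarrow> ('k, 'a, 'x) module_scheme \<Rightarrow> ('k, 'f, 'y) module_scheme \<Rightarrow> ('f \<Rightarrow> 'b \<Rightarrow> 'f)
    \<Rightarrow> ('a, 'f) tensor \<Rightarrow> 'b \<Rightarrow> ('a, 'f) tensor" where
  "rmul k A F rF t b = tens_lift (ktens k A F) (\<lambda>x f. kpure k A F x (rF f b)) t"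

text \<open>The action on the summand A \<otimes> F of the product module, for arbitrary F. With F =
  B and \<tau> = R it is the multiplication of the twisted tensor product, so one set of lemmas
  serves the algebra, its modules and the algebra of forms.\<close>

definition twisted_act ::
  "('k, 'z) ring_scheme \<Rightarrow> ('k, 'a, 'x) module_scheme \<Rightarrow> ('k, 'f, 'y) module_scheme \<Rightarrow> ('f \<Rightarrow> 'b \<Rightarrow> 'f)
    \<Rightarrow> (('f, 'a) tensor \<Rightarrow> ('a, 'f) tensor) \<Rightarrow> ('a, 'f) tensor \<Rightarrow> ('a, 'b) tensor \<Rightarrow> ('a, 'f) tensor" where
  "twisted_act k A F rF \<tau> u t =
     tens_lift (ktens k A F) (\<lambda>a f.
       tens_lift (ktens k A F) (\<lambda>\<alpha> \<beta>.
         tens_lift (ktens k A F) (\<lambda>\<alpha>' f'. kpure k A F (a \<otimes>\<^bsub>A\<^esub> \<alpha>') (rF f' \<beta>))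
           (\<tau> (kpure k F A f \<alpha>))) t) u"

lemma twisted_mult_eq: "twisted_mult k A B R = twisted_act k A B (\<lambda>b b'. b \<otimes>\<^bsub>B\<^esub> b') R"
  by (intro ext) (simp add: twisted_mult_def twisted_act_def)

section \<open>The outer actions of A and B on A \<otimes> F\<close>

locale bimod = k: cring k + A: ring A + A: module k A + B: ring B + B: module k B + F: module k F
  for k :: "('k, 'z) ring_scheme" and A :: "('k, 'a, 'x) module_scheme" and B :: "('k, 'b, 'y) module_scheme"
    and F :: "('k, 'f, 'v) module_scheme" and rF :: "'f \<Rightarrow> 'b \<Rightarrow> 'f" +
  assumes A_alg: "algebra_over k A" and B_alg: "algebra_over k B" and F_mod: "right_module k B F rF"
begin

lemma A_smult:
  "c \<in> carrier k \<Longrightarrow> x \<in> carrier A \<Longrightarrow> y \<in> carrier A \<Longrightarrow> (c \<odot>\<^bsub>A\<^esub> x) \<otimes>\<^bsub>A\<^esub> y = c \<odot>\<^bsub>A\<^esub> (x \<otimes>\<^bsub>A\<^esub> y)"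
  "c \<in> carrier k \<Longrightarrow> x \<in> carrier A \<Longrightarrow> y \<in> carrier A \<Longrightarrow> x \<otimes>\<^bsub>A\<^esub> (c \<odot>\<^bsub>A\<^esub> y) = c \<odot>\<^bsub>A\<^esub> (x \<otimes>\<^bsub>A\<^esub> y)"
  using A_alg unfolding algebra_over_def by blast+

lemma rF_closed [simp]: "f \<in> carrier F \<Longrightarrow> b \<in> carrier B \<Longrightarrow> rF f b \<in> carrier F"
  using F_mod unfolding right_module_def linear_over_def by blast

lemma rF_add_left: "f \<in> carrier F \<Longrightarrow> f' \<in> carrier F \<Longrightarrow> b \<in> carrier B \<Longrightarrow> rF (f \<oplus>\<^bsub>F\<^esub> f') b = rF f b \<oplus>\<^bsub>F\<^esub> rF f' b"
  using F_mod unfolding right_module_def linear_over_def by blast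

lemma rF_add_right: "f \<in> carrier F \<Longrightarrow> b \<in> carrier B \<Longrightarrow> b' \<in> carrier B \<Longrightarrow> rF f (b \<oplus>\<^bsub>B\<^esub> b') = rF f b \<oplus>\<^bsub>F\<^esub> rF f b'"
  using F_mod unfolding right_module_def linear_over_def by blast

lemma rF_smult_left: "c \<in> carrier k \<Longrightarrow> f \<in> carrier F \<Longrightarrow> b \<in> carrier B \<Longrightarrow> rF (c \<odot>\<^bsub>F\<^esub> f) b = c \<odot>\<^bsub>F\<^esub> rF f b"
  using F_mod unfolding right_module_def linear_over_def by blast

lemma rF_smult_right: "c \<in> carrier k \<Longrightarrow> f \<in> carrier F \<Longrightarrow> b \<in> carrier B \<Longrightarrow> rF f (c \<odot>\<^bsub>B\<^esub> b) = c \<odot>\<^bsub>F\<^esub> rF f b"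
  using F_mod unfolding right_module_def linear_over_def by blast

lemma rF_one: "f \<in> carrier F \<Longrightarrow> rF f \<one>\<^bsub>B\<^esub> = f"
  using F_mod unfolding right_module_def by blast

lemma rF_mult: "f \<in> carrier F \<Longrightarrow> b \<in> carrier B \<Longrightarrow> b' \<in> carrier B \<Longrightarrow> rF f (b \<otimes>\<^bsub>B\<^esub> b') = rF (rF f b) b'"
  using F_mod unfolding right_module_def by blast

sublocale AF: ktensor_module k A F
  by unfold_locales simp_all

abbreviation AF_ten where "AF_ten \<equiv> ktens k A F"
abbreviation q where "q \<equiv> kpure k A F"
abbreviation lm where "lm \<equiv> lmul k A F"
abbreviation rm where "rm \<equiv> rmul k A F rF"

lemmas AF_ab = AF.MN.abelian_group_axioms

lemma lm_bal: "a \<in> carrier A \<Longrightarrow> kbalanced k A F AF_ten (\<lambda>x f. q (a \<otimes>\<^bsub>A\<^esub> x) f)"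
  by (rule balancedI)
    (simp_all add: A.r_distr AF.pure_add_left AF.pure_add_right A_smult AF.pure_balanced)

lemma rm_bal: "b \<in> carrier B \<Longrightarrow> kbalanced k A F AF_ten (\<lambda>x f. q x (rF f b))"
  by (rule balancedI)
    (simp_all add: rF_add_left AF.pure_add_left AF.pure_add_right rF_smult_left AF.pure_balanced)

lemma lm_pure: "a \<in> carrier A \<Longrightarrow> x \<in> carrier A \<Longrightarrow> f \<in> carrier F \<Longrightarrow> lm a (q x f) = q (a \<otimes>\<^bsub>A\<^esub> x) f"
  unfolding lmul_def by (rule AF.lift_pure[OF AF_ab lm_bal])

lemma rm_pure: "b \<in> carrier B \<Longrightarrow> x \<in> carrier A \<Longrightarrow> f \<in> carrier F \<Longrightarrow> rm (q x f) b = q x (rF f b)"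
  unfolding rmul_def by (rule AF.lift_pure[OF AF_ab rm_bal])

lemma lm_additive: "a \<in> carrier A \<Longrightarrow> additive AF_ten AF_ten (lm a)"
  unfolding lmul_def[abs_def] by (rule AF.lift_additive[OF AF_ab lm_bal])

lemma rm_additive: "b \<in> carrier B \<Longrightarrow> additive AF_ten AF_ten (\<lambda>t. rm t b)"
  unfolding rmul_def[abs_def] by (rule AF.lift_additive[OF AF_ab rm_bal])

lemma lm_closed [simp]: "a \<in> carrier A \<Longrightarrow> t \<in> carrier AF_ten \<Longrightarrow> lm a t \<in> carrier AF_ten"
  by (rule additive_closed[OF lm_additive])

lemma rm_closed [simp]: "b \<in> carrier B \<Longrightarrow> t \<in> carrier AF_ten \<Longrightarrow> rm t b \<in> carrier AF_ten"
  by (rule additive_closed[OF rm_additive])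

lemmas lm_add = additive_add[OF lm_additive]
lemmas rm_add = additive_add[OF rm_additive]

lemma lm_add_left:
  assumes "a \<in> carrier A" "a' \<in> carrier A" "t \<in> carrier AF_ten"
  shows "lm (a \<oplus>\<^bsub>A\<^esub> a') t = lm a t \<oplus>\<^bsub>AF_ten\<^esub> lm a' t"
  by (rule AF.additive_ext[OF AF_ab lm_additive additive_plus[OF AF_ab lm_additive lm_additive] assms(3)])
    (use assms in \<open>simp_all add: lm_pure A.l_distr AF.pure_add_left\<close>)

lemma rm_add_right:
  assumes "b \<in> carrier B" "b' \<in> carrier B" "t \<in> carrier AF_ten"
  shows "rm t (b \<oplus>\<^bsub>B\<^esub> b') = rm t b \<oplus>\<^bsub>AF_ten\<^esub> rm t b'"
  by (rule AF.additive_ext[OF AF_ab rm_additive additive_plus[OF AF_ab rm_additive rm_additive] assms(3)])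
    (use assms in \<open>simp_all add: rm_pure rF_add_right AF.pure_add_right\<close>)

lemma lm_lm:
  assumes "a \<in> carrier A" "a' \<in> carrier A" "t \<in> carrier AF_ten"
  shows "lm a (lm a' t) = lm (a \<otimes>\<^bsub>A\<^esub> a') t"
  by (rule AF.additive_ext[OF AF_ab additive_compose[OF lm_additive lm_additive] lm_additive assms(3)])
    (use assms in \<open>simp_all add: lm_pure A.m_assoc\<close>)

lemma rm_rm:
  assumes "b \<in> carrier B" "b' \<in> carrier B" "t \<in> carrier AF_ten"
  shows "rm (rm t b) b' = rm t (b \<otimes>\<^bsub>B\<^esub> b')"
  by (rule AF.additive_ext[OF AF_ab additive_compose[OF rm_additive rm_additive] rm_additive assms(3)])
    (use assms in \<open>simp_all add: rm_pure rF_mult\<close>)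

lemma lm_rm:
  assumes "a \<in> carrier A" "b \<in> carrier B" "t \<in> carrier AF_ten"
  shows "lm a (rm t b) = rm (lm a t) b"
  by (rule AF.additive_ext[OF AF_ab additive_compose[OF rm_additive lm_additive]
        additive_compose[OF lm_additive rm_additive] assms(3)])
    (use assms in \<open>simp_all add: rm_pure lm_pure\<close>)

lemma lm_one [simp]: "t \<in> carrier AF_ten \<Longrightarrow> lm \<one>\<^bsub>A\<^esub> t = t"
  by (rule AF.additive_ext[OF AF_ab lm_additive additive_id]) (simp_all add: lm_pure)

lemma rm_one [simp]: "t \<in> carrier AF_ten \<Longrightarrow> rm t \<one>\<^bsub>B\<^esub> = t"
  by (rule AF.additive_ext[OF AF_ab rm_additive additive_id]) (simp_all add: rm_pure rF_one)

lemma lm_smult: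
  assumes "c \<in> carrier k" "a \<in> carrier A" "t \<in> carrier AF_ten"
  shows "lm (c \<odot>\<^bsub>A\<^esub> a) t = lm a (c \<odot>\<^bsub>AF_ten\<^esub> t)"
  by (rule AF.additive_ext[OF AF_ab lm_additive additive_compose[OF AF.ksmult_additive lm_additive] assms(3)])
    (use assms in \<open>simp_all add: lm_pure AF.ksmult_pure A_smult\<close>)

lemma rm_smult:
  assumes "c \<in> carrier k" "b \<in> carrier B" "t \<in> carrier AF_ten"
  shows "rm (c \<odot>\<^bsub>AF_ten\<^esub> t) b = rm t (c \<odot>\<^bsub>B\<^esub> b)"
  by (rule AF.additive_ext[OF AF_ab additive_compose[OF AF.ksmult_additive rm_additive] rm_additive assms(3)])
    (use assms in \<open>simp_all add: rm_pure AF.ksmult_pure rF_smult_left rF_smult_right AF.pure_balanced\<close>)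

lemma rm_smult_left:
  assumes "c \<in> carrier k" "b \<in> carrier B" "t \<in> carrier AF_ten"
  shows "rm (c \<odot>\<^bsub>AF_ten\<^esub> t) b = c \<odot>\<^bsub>AF_ten\<^esub> rm t b"
  by (rule AF.additive_ext[OF AF_ab additive_compose[OF AF.ksmult_additive rm_additive]
        additive_compose[OF rm_additive AF.ksmult_additive] assms(3)])
    (use assms in \<open>simp_all add: rm_pure AF.ksmult_pure rF_smult_left\<close>)

text \<open>Turns the innermost lift of \<open>twisted_act\<close> into the operators
  \<open>lm\<close> and \<open>rm\<close>, whose calculus replaces nested sums from here on.\<close>

lemma lmrm_unique:
  assumes "a \<in> carrier A" "b \<in> carrier B" "t \<in> carrier AF_ten"
  shows "tens_lift AF_ten (\<lambda>x f. q (a \<otimes>\<^bsub>A\<^esub> x) (rF f b)) t = lm a (rm t b)"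
proof (rule AF.lift_unique[OF AF_ab _ additive_compose[OF rm_additive lm_additive] assms(3)])
  show "kbalanced k A F AF_ten (\<lambda>x f. q (a \<otimes>\<^bsub>A\<^esub> x) (rF f b))"
    by (rule balancedI)
      (use assms in \<open>simp_all add: A.r_distr rF_add_left AF.pure_add_left AF.pure_add_right A_smult
        rF_smult_left AF.pure_balanced\<close>)
qed (use assms in \<open>simp_all add: rm_pure lm_pure\<close>)

end

lemma right_module_self:
  assumes "algebra_over k B"
  shows "right_module k B B (\<lambda>b b'. b \<otimes>\<^bsub>B\<^esub> b')"
proof -
  interpret B: ring B using assms by (simp add: algebra_over_def)
  interpret m: module k B using assms by (simp add: algebra_over_def)
  show ?thesis using assms
    by (simp add: right_module_def linear_over_def algebra_over_def B.l_distr B.r_distr B.m_assoc)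
qed

section \<open>The twisted action defined by a module twisting map\<close>

locale twisted_module_pre = bimod k A B F rF + AB: bimod k A B B "\<lambda>b b'. b \<otimes>\<^bsub>B\<^esub> b'"
  for k :: "('k, 'z) ring_scheme" and A :: "('k, 'a, 'x) module_scheme" and B :: "('k, 'b, 'y) module_scheme"
    and F :: "('k, 'f, 'v) module_scheme" and rF :: "'f \<Rightarrow> 'b \<Rightarrow> 'f" +
  fixes R :: "('b, 'a) tensor \<Rightarrow> ('a, 'b) tensor" and \<tau> :: "('f, 'a) tensor \<Rightarrow> ('a, 'f) tensor"
  assumes R_twist: "twisting_map k A B R" and \<tau>_twist: "module_twisting_map k A B R F rF \<tau>"
begin

sublocale BA: ktensor_module k B A
  by unfold_locales simp_all

sublocale FA: ktensor_module k F A
  by unfold_locales simp_all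

abbreviation D where "D \<equiv> ktens k A B"
abbreviation p where "p \<equiv> kpure k A B"
abbreviation \<rho> where "\<rho> b a \<equiv> R (kpure k B A b a)"
abbreviation tw where "tw f a \<equiv> \<tau> (kpure k F A f a)"
abbreviation lD where "lD \<equiv> lmul k A B"
abbreviation rD where "rD \<equiv> rmul k A B (\<lambda>b b'. b \<otimes>\<^bsub>B\<^esub> b')"

lemma R_additive: "additive (ktens k B A) D R"
  using R_twist by (auto simp: twisting_map_def linear_over_def intro!: additiveI)

lemma \<rho>_closed [simp]: "b \<in> carrier B \<Longrightarrow> a \<in> carrier A \<Longrightarrow> \<rho> b a \<in> carrier D"
  by (rule additive_closed[OF R_additive]) simp

lemma \<rho>_add:
  "b \<in> carrier B \<Longrightarrow> b' \<in> carrier B \<Longrightarrow> a \<in> carrier A \<Longrightarrow> \<rho> (b \<oplus>\<^bsub>B\<^esub> b') a = \<rho> b a \<oplus>\<^bsub>D\<^esub> \<rho> b' a"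
  "b \<in> carrier B \<Longrightarrow> a \<in> carrier A \<Longrightarrow> a' \<in> carrier A \<Longrightarrow> \<rho> b (a \<oplus>\<^bsub>A\<^esub> a') = \<rho> b a \<oplus>\<^bsub>D\<^esub> \<rho> b a'"
  by (simp_all add: BA.pure_add_left BA.pure_add_right additive_add[OF R_additive])

lemma \<rho>_smult:
  assumes "c \<in> carrier k" "b \<in> carrier B" "a \<in> carrier A"
  shows "\<rho> (c \<odot>\<^bsub>B\<^esub> b) a = c \<odot>\<^bsub>D\<^esub> \<rho> b a" "\<rho> b (c \<odot>\<^bsub>A\<^esub> a) = c \<odot>\<^bsub>D\<^esub> \<rho> b a"
proof -
  have *: "R (c \<odot>\<^bsub>ktens k B A\<^esub> kpure k B A b a) = c \<odot>\<^bsub>D\<^esub> \<rho> b a"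
    using R_twist assms unfolding twisting_map_def linear_over_def by blast
  then show "\<rho> (c \<odot>\<^bsub>B\<^esub> b) a = c \<odot>\<^bsub>D\<^esub> \<rho> b a" using assms by (simp add: BA.ksmult_pure)
  then show "\<rho> b (c \<odot>\<^bsub>A\<^esub> a) = c \<odot>\<^bsub>D\<^esub> \<rho> b a" using assms by (simp add: BA.pure_balanced)
qed

lemma \<rho>_one: "b \<in> carrier B \<Longrightarrow> \<rho> b \<one>\<^bsub>A\<^esub> = p \<one>\<^bsub>A\<^esub> b" "a \<in> carrier A \<Longrightarrow> \<rho> \<one>\<^bsub>B\<^esub> a = p a \<one>\<^bsub>B\<^esub>"
  using R_twist unfolding twisting_map_def by blast+

lemma \<tau>_additive: "additive (ktens k F A) AF_ten \<tau>"
  using \<tau>_twist by (auto simp: module_twisting_map_def linear_over_def intro!: additiveI)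

lemma tw_closed [simp]: "f \<in> carrier F \<Longrightarrow> a \<in> carrier A \<Longrightarrow> tw f a \<in> carrier AF_ten"
  by (rule additive_closed[OF \<tau>_additive]) simp

lemma tw_add:
  "f \<in> carrier F \<Longrightarrow> f' \<in> carrier F \<Longrightarrow> a \<in> carrier A \<Longrightarrow> tw (f \<oplus>\<^bsub>F\<^esub> f') a = tw f a \<oplus>\<^bsub>AF_ten\<^esub> tw f' a"
  "f \<in> carrier F \<Longrightarrow> a \<in> carrier A \<Longrightarrow> a' \<in> carrier A \<Longrightarrow> tw f (a \<oplus>\<^bsub>A\<^esub> a') = tw f a \<oplus>\<^bsub>AF_ten\<^esub> tw f a'"
  by (simp_all add: FA.pure_add_left FA.pure_add_right additive_add[OF \<tau>_additive])

lemma tw_smult: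
  assumes "c \<in> carrier k" "f \<in> carrier F" "a \<in> carrier A"
  shows "tw (c \<odot>\<^bsub>F\<^esub> f) a = c \<odot>\<^bsub>AF_ten\<^esub> tw f a" "tw f (c \<odot>\<^bsub>A\<^esub> a) = c \<odot>\<^bsub>AF_ten\<^esub> tw f a"
proof -
  have *: "\<tau> (c \<odot>\<^bsub>ktens k F A\<^esub> kpure k F A f a) = c \<odot>\<^bsub>AF_ten\<^esub> tw f a"
    using \<tau>_twist assms unfolding module_twisting_map_def linear_over_def by blast
  then show "tw (c \<odot>\<^bsub>F\<^esub> f) a = c \<odot>\<^bsub>AF_ten\<^esub> tw f a" using assms by (simp add: FA.ksmult_pure)
  then show "tw f (c \<odot>\<^bsub>A\<^esub> a) = c \<odot>\<^bsub>AF_ten\<^esub> tw f a" using assms by (simp add: FA.pure_balanced)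
qed

lemma tw_mult:
  assumes "f \<in> carrier F" "a \<in> carrier A" "a' \<in> carrier A"
  shows "tw f (a \<otimes>\<^bsub>A\<^esub> a') = tens_lift AF_ten (\<lambda>a1 f1. lm a1 (tw f1 a')) (tw f a)"
  using \<tau>_twist assms unfolding module_twisting_map_def lmul_def by blast

lemma tw_act:
  assumes "f \<in> carrier F" "b \<in> carrier B" "a \<in> carrier A"
  shows "tw (rF f b) a = tens_lift AF_ten (\<lambda>a1 b1. rm (tw f a1) b1) (\<rho> b a)"
  using \<tau>_twist assms unfolding module_twisting_map_def rmul_def by blast

abbreviation act where "act \<equiv> twisted_act k A F rF \<tau>"

lemma act_inner_bal:
  assumes "a \<in> carrier A" "f \<in> carrier F"
  shows "kbalanced k A B AF_ten (\<lambda>\<alpha> \<beta>. lm a (rm (tw f \<alpha>) \<beta>))"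
  by (rule balancedI)
    (use assms in \<open>simp_all add: tw_add rm_add rm_add_right lm_add tw_smult rm_smult\<close>)

lemma act_inner_eq:
  assumes "a \<in> carrier A" "f \<in> carrier F" "t \<in> carrier D"
  shows "tens_lift AF_ten (\<lambda>\<alpha> \<beta>. tens_lift AF_ten (\<lambda>\<alpha>' f'. q (a \<otimes>\<^bsub>A\<^esub> \<alpha>') (rF f' \<beta>)) (tw f \<alpha>)) t
    = tens_lift AF_ten (\<lambda>\<alpha> \<beta>. lm a (rm (tw f \<alpha>) \<beta>)) t"
  by (rule AB.AF.lift_cong[OF AF_ab assms(3)]) (use assms in \<open>simp_all add: lmrm_unique\<close>)

text \<open>The inner lift is already additive in \<open>t\<close>; hence each condition on the
  outer integrand is an identity of additive maps in \<open>t\<close>, and is checked at t =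
  \<alpha> \<otimes> \<beta>.\<close>

lemma act_outer_bal:
  assumes t: "t \<in> carrier D"
  shows "kbalanced k A F AF_ten (\<lambda>a f. tens_lift AF_ten (\<lambda>\<alpha> \<beta>. lm a (rm (tw f \<alpha>) \<beta>)) t)"
proof -
  note add = AB.AF.lift_additive[OF AF_ab act_inner_bal]
  note pure = AB.AF.lift_pure[OF AF_ab act_inner_bal]
  show ?thesis
  proof (rule balancedI)
    fix a f assume "a \<in> carrier A" "f \<in> carrier F"
    then show "tens_lift AF_ten (\<lambda>\<alpha> \<beta>. lm a (rm (tw f \<alpha>) \<beta>)) t \<in> carrier AF_ten"
      by (rule additive_closed[OF add t])
  next
    fix a a' f assume h: "a \<in> carrier A" "a' \<in> carrier A" "f \<in> carrier F"
    show "tens_lift AF_ten (\<lambda>\<alpha> \<beta>. lm (a \<oplus>\<^bsub>A\<^esub> a') (rm (tw f \<alpha>) \<beta>)) t =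
      tens_lift AF_ten (\<lambda>\<alpha> \<beta>. lm a (rm (tw f \<alpha>) \<beta>)) t \<oplus>\<^bsub>AF_ten\<^esub> tens_lift AF_ten (\<lambda>\<alpha> \<beta>. lm a' (rm (tw f \<alpha>) \<beta>)) t"
      by (rule AB.AF.additive_ext[OF AF_ab add additive_plus[OF AF_ab add add] t])
        (use h in \<open>simp_all add: pure lm_add_left\<close>)
  next
    fix a f f' assume h: "a \<in> carrier A" "f \<in> carrier F" "f' \<in> carrier F"
    show "tens_lift AF_ten (\<lambda>\<alpha> \<beta>. lm a (rm (tw (f \<oplus>\<^bsub>F\<^esub> f') \<alpha>) \<beta>)) t =
      tens_lift AF_ten (\<lambda>\<alpha> \<beta>. lm a (rm (tw f \<alpha>) \<beta>)) t \<oplus>\<^bsub>AF_ten\<^esub> tens_lift AF_ten (\<lambda>\<alpha> \<beta>. lm a (rm (tw f' \<alpha>) \<beta>)) t"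
      by (rule AB.AF.additive_ext[OF AF_ab add additive_plus[OF AF_ab add add] t])
        (use h in \<open>simp_all add: pure lm_add rm_add tw_add\<close>)
  next
    fix a c f assume h: "a \<in> carrier A" "c \<in> carrier k" "f \<in> carrier F"
    show "tens_lift AF_ten (\<lambda>\<alpha> \<beta>. lm (c \<odot>\<^bsub>A\<^esub> a) (rm (tw f \<alpha>) \<beta>)) t =
      tens_lift AF_ten (\<lambda>\<alpha> \<beta>. lm a (rm (tw (c \<odot>\<^bsub>F\<^esub> f) \<alpha>) \<beta>)) t"
      by (rule AB.AF.additive_ext[OF AF_ab add add t])
        (use h in \<open>simp_all add: pure lm_smult tw_smult rm_smult_left\<close>)
  qed
qed

lemma act_eq:
  assumes "u \<in> carrier AF_ten" "t \<in> carrier D"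
  shows "act u t = tens_lift AF_ten (\<lambda>a f. tens_lift AF_ten (\<lambda>\<alpha> \<beta>. lm a (rm (tw f \<alpha>) \<beta>)) t) u"
  unfolding twisted_act_def
  by (rule AF.lift_cong[OF AF_ab assms(1)])
    (use assms act_inner_eq additive_closed[OF AB.AF.lift_additive[OF AF_ab act_inner_bal]] in simp_all)

lemma act_additive_left:
  assumes "t \<in> carrier D"
  shows "additive AF_ten AF_ten (\<lambda>u. act u t)"
  by (rule additive_cong[OF AF.lift_additive[OF AF_ab act_outer_bal[OF assms]] AF_ab act_eq[OF _ assms]])

lemma act_pure_left:
  assumes "a \<in> carrier A" "f \<in> carrier F" "t \<in> carrier D"
  shows "act (q a f) t = tens_lift AF_ten (\<lambda>\<alpha> \<beta>. lm a (rm (tw f \<alpha>) \<beta>)) t"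
  using AF.lift_pure[OF AF_ab act_outer_bal[OF assms(3)] assms(1,2)] assms by (simp add: act_eq)

lemma act_pure:
  assumes "a \<in> carrier A" "f \<in> carrier F" "\<alpha> \<in> carrier A" "\<beta> \<in> carrier B"
  shows "act (q a f) (p \<alpha> \<beta>) = lm a (rm (tw f \<alpha>) \<beta>)"
  using AB.AF.lift_pure[OF AF_ab act_inner_bal[OF assms(1,2)] assms(3,4)] assms by (simp add: act_pure_left)

lemma act_closed [simp]: "u \<in> carrier AF_ten \<Longrightarrow> t \<in> carrier D \<Longrightarrow> act u t \<in> carrier AF_ten"
  by (rule additive_closed[OF act_additive_left])

lemma act_additive_right:
  assumes "u \<in> carrier AF_ten"
  shows "additive D AF_ten (act u)"
proof (rule additiveI)
  fix s t assume st: "s \<in> carrier D" "t \<in> carrier D"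
  then have "s \<oplus>\<^bsub>D\<^esub> t \<in> carrier D" by simp
  note addl = act_additive_left[OF this] additive_plus[OF AF_ab act_additive_left[OF st(1)] act_additive_left[OF st(2)]]
  show "act u (s \<oplus>\<^bsub>D\<^esub> t) = act u s \<oplus>\<^bsub>AF_ten\<^esub> act u t"
    by (rule AF.additive_ext[OF AF_ab addl assms])
      (use st in \<open>simp add: act_pure_left additive_add[OF AB.AF.lift_additive[OF AF_ab act_inner_bal]]\<close>)
qed (use assms in simp)

lemmas act_add_left = additive_add[OF act_additive_left]
lemmas act_add_right = additive_add[OF act_additive_right]

lemma act_lm:
  assumes "a \<in> carrier A" "u \<in> carrier AF_ten" "t \<in> carrier D"
  shows "act (lm a u) t = lm a (act u t)"
proof (rule AF.additive_ext[OF AF_ab additive_compose[OF lm_additive act_additive_left]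
      additive_compose[OF act_additive_left lm_additive] assms(2)])
  fix m n assume h: "m \<in> carrier A" "n \<in> carrier F"
  show "act (lm a (q m n)) t = lm a (act (q m n) t)"
    by (rule AB.AF.additive_ext[OF AF_ab act_additive_right additive_compose[OF act_additive_right lm_additive] assms(3)])
      (use h assms in \<open>simp_all add: lm_pure act_pure lm_lm\<close>)
qed (use assms in simp_all)

lemma act_rD:
  assumes "b \<in> carrier B" "u \<in> carrier AF_ten" "t \<in> carrier D"
  shows "act u (rD t b) = rm (act u t) b"
proof (rule AF.additive_ext[OF AF_ab act_additive_left
      additive_compose[OF act_additive_left rm_additive] assms(2)])
  fix m n assume h: "m \<in> carrier A" "n \<in> carrier F"
  show "act (q m n) (rD t b) = rm (act (q m n) t) b"
    by (rule AB.AF.additive_ext[OF AF_ab additive_compose[OF AB.rm_additive act_additive_right]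
          additive_compose[OF act_additive_right rm_additive] assms(3)])
      (use h assms in \<open>simp_all add: AB.rm_pure act_pure lm_rm rm_rm\<close>)
qed (use assms in simp_all)

text \<open>The twisting axiom for the B-action on F, extended from \<open>tw\<close> to all of A
  \<otimes> F: acting by b and then by a is acting by R(b \<otimes> a).\<close>

lemma act_rm:
  assumes "b \<in> carrier B" "u \<in> carrier AF_ten" "a \<in> carrier A"
  shows "act (rm u b) (p a \<one>\<^bsub>B\<^esub>) = act u (\<rho> b a)"
proof (rule AF.additive_ext[OF AF_ab additive_compose[OF rm_additive act_additive_left]
      act_additive_left assms(2)])
  fix m n assume h: "m \<in> carrier A" "n \<in> carrier F"
  have "act (rm (q m n) b) (p a \<one>\<^bsub>B\<^esub>) = lm m (tw (rF n b) a)"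
    using h assms by (simp add: rm_pure act_pure)
  also have "\<dots> = lm m (tens_lift AF_ten (\<lambda>a1 b1. rm (tw n a1) b1) (\<rho> b a))"
    by (simp only: tw_act[OF h(2) assms(1,3)])
  also have "\<dots> = tens_lift AF_ten (\<lambda>a1 b1. lm m (rm (tw n a1) b1)) (\<rho> b a)"
    by (rule AB.AF.lift_push[OF AF_ab AF_ab lm_additive]) (use h assms in simp_all)
  also have "\<dots> = act (q m n) (\<rho> b a)" using h assms by (simp add: act_pure_left)
  finally show "act (rm (q m n) b) (p a \<one>\<^bsub>B\<^esub>) = act (q m n) (\<rho> b a)" .
qed (use assms in simp_all)

text \<open>The twisting axiom for products in A, read as (1 \<otimes> f) \<cdot> (a t) = \<tau>(f
  \<otimes> a) \<cdot> t. For t = m \<otimes> 1 it is the axiom itself, and a right factor in B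
  passes through by \<open>act_rD\<close>.\<close>

lemma act_lD:
  assumes "a \<in> carrier A" "f \<in> carrier F" "t \<in> carrier D"
  shows "act (q \<one>\<^bsub>A\<^esub> f) (lD a t) = act (tw f a) t"
proof (rule AB.AF.additive_ext[OF AF_ab additive_compose[OF AB.lm_additive act_additive_right]
      act_additive_right assms(3)])
  fix m n assume h: "m \<in> carrier A" "n \<in> carrier B"
  have bal: "kbalanced k A F AF_ten (\<lambda>a1 f1. lm a1 (tw f1 m))"
    by (rule balancedI) (use h in \<open>simp_all add: lm_add_left lm_add tw_add lm_smult tw_smult\<close>)
  have "tens_lift AF_ten (\<lambda>a1 f1. lm a1 (tw f1 m)) (tw f a) = act (tw f a) (p m \<one>\<^bsub>B\<^esub>)"
    by (rule AF.lift_unique[OF AF_ab bal act_additive_left]) (use h assms in \<open>simp_all add: act_pure\<close>)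
  then have "tw f (a \<otimes>\<^bsub>A\<^esub> m) = act (tw f a) (p m \<one>\<^bsub>B\<^esub>)"
    by (simp only: tw_mult[OF assms(2,1) h(1)])
  then show "act (q \<one>\<^bsub>A\<^esub> f) (lD a (p m n)) = act (tw f a) (p m n)"
    using h assms act_rD[of n "tw f a" "p m \<one>\<^bsub>B\<^esub>"] by (simp add: AB.lm_pure act_pure[of "\<one>\<^bsub>A\<^esub>"] AB.rm_pure)
qed (use assms in simp_all)

end

text \<open>The unit rule is kept apart because for F it has to be derived inside the weaker locale,
  from surjectivity of \<tau>, whereas for F = B it belongs to the definition of a twisting
  map.\<close>

locale twisted_module = twisted_module_pre +
  assumes tw_one: "f \<in> carrier F \<Longrightarrow> tw f \<one>\<^bsub>A\<^esub> = q \<one>\<^bsub>A\<^esub> f"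
begin

lemma act_one_right:
  assumes "u \<in> carrier AF_ten" "b \<in> carrier B"
  shows "act u (p \<one>\<^bsub>A\<^esub> b) = rm u b"
  by (rule AF.additive_ext[OF AF_ab act_additive_left rm_additive assms(1)])
    (use assms in \<open>simp_all add: act_pure tw_one rm_pure lm_pure\<close>)

lemma act_gen: "f \<in> carrier F \<Longrightarrow> a \<in> carrier A \<Longrightarrow> act (q \<one>\<^bsub>A\<^esub> f) (p a \<one>\<^bsub>B\<^esub>) = tw f a"
  by (simp add: act_pure)

end

text \<open>The unit condition on \<open>\<tau>\<close> is not part of the definition of a module twisting map.  The map
  \<open>\<Phi>(a \<otimes> f) = a \<tau>(f \<otimes> 1)\<close> satisfies \<open>\<Phi> \<circ> \<tau> = \<tau>\<close>, so it is the identity when \<open>\<tau>\<close> is surjective.\<close>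

lemma (in twisted_module_pre) surj_tw_one:
  assumes "\<tau> ` carrier (ktens k F A) = carrier AF_ten" "f \<in> carrier F"
  shows "tw f \<one>\<^bsub>A\<^esub> = q \<one>\<^bsub>A\<^esub> f"
proof -
  have bal: "kbalanced k A F AF_ten (\<lambda>a1 f1. lm a1 (tw f1 \<one>\<^bsub>A\<^esub>))"
    by (rule balancedI) (simp_all add: lm_add_left lm_add tw_add lm_smult tw_smult)
  define \<Phi> where "\<Phi> = tens_lift AF_ten (\<lambda>a1 f1. lm a1 (tw f1 \<one>\<^bsub>A\<^esub>))"
  have \<Phi>: "additive AF_ten AF_ten \<Phi>" unfolding \<Phi>_def by (rule AF.lift_additive[OF AF_ab bal])
  have fix_image: "\<Phi> (\<tau> s) = \<tau> s" if s: "s \<in> carrier (ktens k F A)" for s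
  proof (rule FA.additive_ext[OF AF_ab additive_compose[OF \<tau>_additive \<Phi>] \<tau>_additive s])
    fix m n assume "m \<in> carrier F" "n \<in> carrier A"
    then show "\<Phi> (tw m n) = tw m n"
      unfolding \<Phi>_def using tw_mult[of m n "\<one>\<^bsub>A\<^esub>", symmetric] by simp
  qed
  have q1: "q \<one>\<^bsub>A\<^esub> f \<in> carrier AF_ten" using assms(2) by simp
  then obtain s where s: "s \<in> carrier (ktens k F A)" "q \<one>\<^bsub>A\<^esub> f = \<tau> s"
    unfolding assms(1)[symmetric] by (rule imageE)
  have "tw f \<one>\<^bsub>A\<^esub> = lm \<one>\<^bsub>A\<^esub> (tw f \<one>\<^bsub>A\<^esub>)" using assms(2) by simp
  also have "\<dots> = \<Phi> (q \<one>\<^bsub>A\<^esub> f)"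
    unfolding \<Phi>_def by (rule AF.lift_pure[OF AF_ab bal A.one_closed assms(2), symmetric])
  also have "\<dots> = q \<one>\<^bsub>A\<^esub> f" unfolding s(2) by (rule fix_image[OF s(1)])
  finally show ?thesis .
qed

context twisted_module
begin

lemma tw_mult_act:
  assumes "f \<in> carrier F" "a \<in> carrier A" "a' \<in> carrier A"
  shows "tw f (a \<otimes>\<^bsub>A\<^esub> a') = act (tw f a) (p a' \<one>\<^bsub>B\<^esub>)"
proof -
  have "tw f (a \<otimes>\<^bsub>A\<^esub> a') = act (q \<one>\<^bsub>A\<^esub> f) (lD a (p a' \<one>\<^bsub>B\<^esub>))"
    using assms by (simp add: AB.lm_pure act_pure[of "\<one>\<^bsub>A\<^esub>"])
  then show ?thesis using assms by (simp add: act_lD)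
qed

lemma tw_act_act:
  assumes "f \<in> carrier F" "b \<in> carrier B" "a \<in> carrier A"
  shows "tw (rF f b) a = act (q \<one>\<^bsub>A\<^esub> f) (\<rho> b a)"
  using act_rm[of b "q \<one>\<^bsub>A\<^esub> f" a] assms by (simp add: rm_pure act_pure[of "\<one>\<^bsub>A\<^esub>"])

end

text \<open>R is itself a module twisting map for the right regular module B, so statements about A
  \<otimes> F specialise to the twisted algebra.\<close>

lemma twisted_module_self:
  fixes k :: "('k, 'z) ring_scheme" and A :: "('k, 'a, 'x) module_scheme" and B :: "('k, 'b, 'y) module_scheme"
  assumes "cring k" "algebra_over k A" "algebra_over k B" "twisting_map k A B R"
  shows "twisted_module k A B B (\<lambda>b b'. b \<otimes>\<^bsub>B\<^esub> b') R R"
proof -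
  have mt: "module_twisting_map k A B R B (\<lambda>b b'. b \<otimes>\<^bsub>B\<^esub> b') R"
    using assms(4) unfolding module_twisting_map_def twisting_map_def by blast
  interpret bimod k A B B "\<lambda>b b'. b \<otimes>\<^bsub>B\<^esub> b'"
    using assms right_module_self[OF assms(3)]
    by (simp add: bimod_def bimod_axioms_def algebra_over_def)
  interpret twisted_module_pre k A B B "\<lambda>b b'. b \<otimes>\<^bsub>B\<^esub> b'" R R
    by unfold_locales (rule assms(4), rule mt)
  show ?thesis by unfold_locales (rule \<rho>_one(1))
qed

locale twisted_action = twisted_module k A B F rF R \<tau> + D: twisted_module k A B B "\<lambda>b b'. b \<otimes>\<^bsub>B\<^esub> b'" R R
  for k :: "('k, 'z) ring_scheme" and A :: "('k, 'a, 'x) module_scheme" and B :: "('k, 'b, 'y) module_scheme"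
    and F :: "('k, 'f, 'v) module_scheme" and rF :: "'f \<Rightarrow> 'b \<Rightarrow> 'f"
    and R :: "('b, 'a) tensor \<Rightarrow> ('a, 'b) tensor" and \<tau> :: "('f, 'a) tensor \<Rightarrow> ('a, 'f) tensor"
begin

text \<open>The product of a \<otimes> b and a' \<otimes> b' is a R(b \<otimes> a') b'. The outer
  factors x and b' commute with everything in between, and what remains is \<open>act_rm\<close> for
  b past a' followed by \<open>act_lD\<close> for a.\<close>

lemma act_assoc_pure:
  assumes "x \<in> carrier A" "f \<in> carrier F" "a \<in> carrier A" "b \<in> carrier B" "a' \<in> carrier A" "b' \<in> carrier B"
  shows "act (act (q x f) (p a b)) (p a' b') = act (q x f) (D.act (p a b) (p a' b'))"
proof -
  have "act (act (q x f) (p a b)) (p a' b') = lm x (act (rm (tw f a) b) (p a' b'))"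
    using assms by (simp add: act_pure act_lm)
  also have "p a' b' = rD (p a' \<one>\<^bsub>B\<^esub>) b'" using assms by (simp add: AB.rm_pure)
  also have "act (rm (tw f a) b) \<dots> = rm (act (tw f a) (\<rho> b a')) b'"
    using assms by (simp only: act_rD[OF assms(6)] rm_closed tw_closed AB.AF.pure_closed B.one_closed act_rm[OF assms(4) _ assms(5)])
  also have "\<dots> = act (q \<one>\<^bsub>A\<^esub> f) (lD a (rD (\<rho> b a') b'))"
    using assms by (simp add: act_lD act_rD)
  also have "lm x \<dots> = act (lm x (q \<one>\<^bsub>A\<^esub> f)) (lD a (rD (\<rho> b a') b'))"
    using assms by (simp add: act_lm)
  finally show ?thesis using assms by (simp add: lm_pure D.act_pure AB.rm_pure)
qed

lemma act_assoc:
  assumes "u \<in> carrier AF_ten" "s \<in> carrier D" "t \<in> carrier D"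
  shows "act (act u s) t = act u (D.act s t)"
proof -
  have 1: "act (act (q x f) (p a b)) t = act (q x f) (D.act (p a b) t)"
    if "x \<in> carrier A" "f \<in> carrier F" "a \<in> carrier A" "b \<in> carrier B" for x f a b
    by (rule AB.AF.additive_ext[OF AF_ab act_additive_right additive_compose[OF D.act_additive_right act_additive_right] assms(3)])
      (use that in \<open>simp_all add: act_assoc_pure\<close>)
  have 2: "act (act (q x f) s) t = act (q x f) (D.act s t)" if "x \<in> carrier A" "f \<in> carrier F" for x f
    by (rule AB.AF.additive_ext[OF AF_ab additive_compose[OF act_additive_right act_additive_left]
          additive_compose[OF D.act_additive_left act_additive_right] assms(2)])
      (use that assms 1 in simp_all)
  show ?thesis
    by (rule AF.additive_ext[OF AF_ab additive_compose[OF act_additive_left act_additive_left]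
          act_additive_left assms(1)])
      (use assms 2 in simp_all)
qed

end

lemma twisted_action_self:
  fixes k :: "('k, 'z) ring_scheme" and A :: "('k, 'a, 'x) module_scheme" and B :: "('k, 'b, 'y) module_scheme"
  assumes "cring k" "algebra_over k A" "algebra_over k B" "twisting_map k A B R"
  shows "twisted_action k A B B (\<lambda>b b'. b \<otimes>\<^bsub>B\<^esub> b') R R"
  using twisted_module_self[OF assms] by (simp add: twisted_action_def)

lemma universal_intro: "cring k \<Longrightarrow> algebra_over k A \<Longrightarrow> universal k A"
  by (simp add: universal_def universal_axioms_def algebra_over_def)

section \<open>The differential calculus on a twisted tensor product\<close>

locale twisted_dga =
  UA: universal k A + UB: universal k B
  for k :: "('k, 'z) ring_scheme" and A :: "('k, 'a, 'x) module_scheme" and B :: "('k, 'b, 'y) module_scheme" +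
  fixes R :: "('b, 'a) tensor \<Rightarrow> ('a, 'b) tensor"
    and Rt :: "(('k, 'b) uform, ('k, 'a) uform) tensor \<Rightarrow> (('k, 'a) uform, ('k, 'b) uform) tensor"
  assumes R_map: "twisting_map k A B R" and R_ext: "twisting_extension k A B R Rt"
begin

abbreviation WA where "WA \<equiv> universal_calculus k A"
abbreviation WB where "WB \<equiv> universal_calculus k B"
abbreviation W where "W \<equiv> ktens k WA WB"
abbreviation iA where "iA \<equiv> incl WA"
abbreviation iB where "iB \<equiv> incl WB"
abbreviation dA where "dA \<equiv> dif WA"
abbreviation dB where "dB \<equiv> dif WB"

sublocale D: twisted_action k A B B "\<lambda>b b'. b \<otimes>\<^bsub>B\<^esub> b'" R R
  by (rule twisted_action_self[OF UA.is_cring UA.alg UB.alg R_map])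

lemma Rt_map: "twisting_map k WA WB Rt"
  using R_ext by (simp add: twisting_extension_def Let_def)

sublocale W: twisted_action k WA WB WB "\<lambda>b b'. b \<otimes>\<^bsub>WB\<^esub> b'" Rt Rt
  by (rule twisted_action_self[OF UA.is_cring UA.W_algebra UB.W_algebra Rt_map])

abbreviation w where "w \<equiv> kpure k WA WB"
abbreviation wm where "wm \<equiv> twisted_act k WA WB (\<lambda>b b'. b \<otimes>\<^bsub>WB\<^esub> b') Rt"
abbreviation rt where "rt \<eta> \<phi> \<equiv> Rt (kpure k WB WA \<eta> \<phi>)"
abbreviation TC where "TC \<equiv> twisted_calculus k A B Rt"

lemmas W_ab = W.AF_ab

lemma TC_simps [simp]:
  "carrier TC = carrier W" "ring.add TC = ring.add W" "\<zero>\<^bsub>TC\<^esub> = \<zero>\<^bsub>W\<^esub>" "monoid.mult TC = wm"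
  by (simp_all add: twisted_calculus_def Let_def twisted_algebra_def module.extend_def twisted_mult_eq)

text \<open>The tensor product of two linear maps, without Koszul sign; the signs of the extension
  axioms are supplied by putting the sign map in one of the slots.\<close>

definition tmap where "tmap f g = tens_lift W (\<lambda>\<phi> \<omega>. w (f \<phi>) (g \<omega>))"

context
  fixes f g
  assumes f: "linear_over k WA WA f" and g: "linear_over k WB WB g"
begin

lemma fg_simps:
  "x \<in> carrier WA \<Longrightarrow> f x \<in> carrier WA" "y \<in> carrier WB \<Longrightarrow> g y \<in> carrier WB"
  "x \<in> carrier WA \<Longrightarrow> x' \<in> carrier WA \<Longrightarrow> f (x \<oplus>\<^bsub>WA\<^esub> x') = f x \<oplus>\<^bsub>WA\<^esub> f x'"
  "y \<in> carrier WB \<Longrightarrow> y' \<in> carrier WB \<Longrightarrow> g (y \<oplus>\<^bsub>WB\<^esub> y') = g y \<oplus>\<^bsub>WB\<^esub> g y'"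
  "c \<in> carrier k \<Longrightarrow> x \<in> carrier WA \<Longrightarrow> f (c \<odot>\<^bsub>WA\<^esub> x) = c \<odot>\<^bsub>WA\<^esub> f x"
  "c \<in> carrier k \<Longrightarrow> y \<in> carrier WB \<Longrightarrow> g (c \<odot>\<^bsub>WB\<^esub> y) = c \<odot>\<^bsub>WB\<^esub> g y"
  using f g unfolding linear_over_def by blast+

lemma tmap_bal: "kbalanced k WA WB W (\<lambda>\<phi> \<omega>. w (f \<phi>) (g \<omega>))"
  by (rule balancedI)
    (simp_all add: fg_simps W.AF.pure_add_left W.AF.pure_add_right W.AF.pure_balanced)

lemma tmap_additive: "additive W W (tmap f g)"
  unfolding tmap_def by (rule W.AF.lift_additive[OF W_ab tmap_bal])

lemma tmap_pure: "\<phi> \<in> carrier WA \<Longrightarrow> \<omega> \<in> carrier WB \<Longrightarrow> tmap f g (w \<phi> \<omega>) = w (f \<phi>) (g \<omega>)"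
  unfolding tmap_def by (rule W.AF.lift_pure[OF W_ab tmap_bal])

lemma tmap_closed: "t \<in> carrier W \<Longrightarrow> tmap f g t \<in> carrier W"
  by (rule additive_closed[OF tmap_additive])

lemma tmap_smult:
  assumes "c \<in> carrier k" "t \<in> carrier W"
  shows "tmap f g (c \<odot>\<^bsub>W\<^esub> t) = c \<odot>\<^bsub>W\<^esub> tmap f g t"
  by (rule W.AF.additive_ext[OF W_ab additive_compose[OF W.AF.ksmult_additive tmap_additive]
        additive_compose[OF tmap_additive W.AF.ksmult_additive] assms(2)])
    (use assms in \<open>simp_all add: tmap_pure W.AF.ksmult_pure fg_simps\<close>)

end

abbreviation idf :: "'q \<Rightarrow> 'q" where "idf \<equiv> (\<lambda>x. x)"

lemma lin_id: "linear_over k M M (\<lambda>x. x)"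
  by (simp add: linear_over_def)

lemma lin_dA: "linear_over k WA WA dA"
  by (auto simp: linear_over_def UA.dif_add UA.dif_smult)

lemma lin_dB: "linear_over k WB WB dB"
  by (auto simp: linear_over_def UB.dif_add UB.dif_smult)

lemmas lin = lin_id lin_dA lin_dB UA.sign_linear UB.sign_linear

lemma dif_TC_fun:
  "dif TC = tens_lift W (\<lambda>\<phi> \<omega>. w (dA \<phi>) \<omega> \<oplus>\<^bsub>W\<^esub> w (UA.sign \<phi>) (dB \<omega>))"
proof -
  have "tens_lift (twisted_algebra k WA WB Rt) f = tens_lift W f"
    for f :: "('k, 'a) uform \<Rightarrow> ('k, 'b) uform \<Rightarrow> (('k, 'a) uform, ('k, 'b) uform) tensor"
    by (rule tens_lift_add_monoid_cong) (simp add: twisted_algebra_def)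
  then show ?thesis
    by (simp add: twisted_calculus_def Let_def module.extend_def) (simp add: twisted_algebra_def)
qed

lemma incl_TC_fun: "incl TC = tens_lift W (\<lambda>a b. w (iA a) (iB b))"
proof -
  have "tens_lift (twisted_algebra k WA WB Rt) f = tens_lift W f" for f :: "'a \<Rightarrow> 'b \<Rightarrow> _"
    by (rule tens_lift_add_monoid_cong) (simp add: twisted_algebra_def)
  then show ?thesis
    by (simp add: twisted_calculus_def Let_def module.extend_def)
qed

abbreviation dW where "dW \<equiv> dif TC"
abbreviation iD where "iD \<equiv> incl TC"

lemma dW_bal: "kbalanced k WA WB W (\<lambda>\<phi> \<omega>. w (dA \<phi>) \<omega> \<oplus>\<^bsub>W\<^esub> w (UA.sign \<phi>) (dB \<omega>))"
proof (rule balancedI)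
  fix m m' n assume "m \<in> carrier WA" "m' \<in> carrier WA" "n \<in> carrier WB"
  then show "w (dA (m \<oplus>\<^bsub>WA\<^esub> m')) n \<oplus>\<^bsub>W\<^esub> w (UA.sign (m \<oplus>\<^bsub>WA\<^esub> m')) (dB n) =
      (w (dA m) n \<oplus>\<^bsub>W\<^esub> w (UA.sign m) (dB n)) \<oplus>\<^bsub>W\<^esub> (w (dA m') n \<oplus>\<^bsub>W\<^esub> w (UA.sign m') (dB n))"
    by (simp add: UA.dif_add UA.sign_add W.AF.pure_add_left W.AF.MN.a_ac)
next
  fix m n n' assume "m \<in> carrier WA" "n \<in> carrier WB" "n' \<in> carrier WB"
  then show "w (dA m) (n \<oplus>\<^bsub>WB\<^esub> n') \<oplus>\<^bsub>W\<^esub> w (UA.sign m) (dB (n \<oplus>\<^bsub>WB\<^esub> n')) =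
      (w (dA m) n \<oplus>\<^bsub>W\<^esub> w (UA.sign m) (dB n)) \<oplus>\<^bsub>W\<^esub> (w (dA m) n' \<oplus>\<^bsub>W\<^esub> w (UA.sign m) (dB n'))"
    by (simp add: UB.dif_add W.AF.pure_add_right W.AF.MN.a_ac)
next
  fix m c n assume "m \<in> carrier WA" "c \<in> carrier k" "n \<in> carrier WB"
  then show "w (dA (c \<odot>\<^bsub>WA\<^esub> m)) n \<oplus>\<^bsub>W\<^esub> w (UA.sign (c \<odot>\<^bsub>WA\<^esub> m)) (dB n) =
      w (dA m) (c \<odot>\<^bsub>WB\<^esub> n) \<oplus>\<^bsub>W\<^esub> w (UA.sign m) (dB (c \<odot>\<^bsub>WB\<^esub> n))"
    by (simp add: UA.dif_smult UB.dif_smult UA.sign_smult W.AF.pure_balanced)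
qed simp

lemma dW_additive: "additive W W dW"
  unfolding dif_TC_fun by (rule W.AF.lift_additive[OF W_ab dW_bal])

lemma dW_pure: "\<phi> \<in> carrier WA \<Longrightarrow> \<omega> \<in> carrier WB \<Longrightarrow> dW (w \<phi> \<omega>) = w (dA \<phi>) \<omega> \<oplus>\<^bsub>W\<^esub> w (UA.sign \<phi>) (dB \<omega>)"
  unfolding dif_TC_fun by (rule W.AF.lift_pure[OF W_ab dW_bal])

lemma dW_closed [simp]: "t \<in> carrier W \<Longrightarrow> dW t \<in> carrier W"
  by (rule additive_closed[OF dW_additive])

lemma iD_bal: "kbalanced k A B W (\<lambda>a b. w (iA a) (iB b))"
  by (rule balancedI)
    (simp_all add: UA.incl_add UB.incl_add UA.incl_smult UB.incl_smult
      W.AF.pure_add_left W.AF.pure_add_right W.AF.pure_balanced)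

lemma iD_additive: "additive D.AF_ten W iD"
  unfolding incl_TC_fun by (rule D.AF.lift_additive[OF W_ab iD_bal])

lemma iD_pure: "a \<in> carrier A \<Longrightarrow> b \<in> carrier B \<Longrightarrow> iD (D.q a b) = w (iA a) (iB b)"
  unfolding incl_TC_fun by (rule D.AF.lift_pure[OF W_ab iD_bal])

lemma iD_closed [simp]: "t \<in> carrier D.AF_ten \<Longrightarrow> iD t \<in> carrier W"
  by (rule additive_closed[OF iD_additive])

lemma rt_incl: "b \<in> carrier B \<Longrightarrow> a \<in> carrier A \<Longrightarrow> rt (iB b) (iA a) = iD (D.\<rho> b a)"
  using R_ext by (simp add: twisting_extension_def Let_def incl_TC_fun)

lemma rt_dB: "\<eta> \<in> carrier WB \<Longrightarrow> \<phi> \<in> carrier WA \<Longrightarrow> rt (dB \<eta>) \<phi> = tmap UA.sign dB (rt \<eta> \<phi>)"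
  using R_ext by (simp add: twisting_extension_def Let_def tmap_def)

lemma rt_dA: "\<eta> \<in> carrier WB \<Longrightarrow> \<phi> \<in> carrier WA \<Longrightarrow> rt \<eta> (dA \<phi>) = tmap dA UB.sign (rt \<eta> \<phi>)"
  using R_ext by (simp add: twisting_extension_def Let_def tmap_def)

lemma iD_lm_rm:
  assumes "a \<in> carrier A" "b \<in> carrier B" "t \<in> carrier D.AF_ten"
  shows "iD (D.lm a (D.rm t b)) = W.lm (iA a) (W.rm (iD t) (iB b))"
  by (rule D.AF.additive_ext[OF W_ab
        additive_compose[OF D.rm_additive additive_compose[OF D.lm_additive iD_additive]]
        additive_compose[OF iD_additive additive_compose[OF W.rm_additive W.lm_additive]] assms(3)])
    (use assms in \<open>simp_all add: D.rm_pure D.lm_pure W.rm_pure W.lm_pure iD_pure UA.incl_mult UB.incl_mult\<close>)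

text \<open>On pure tensors both products are governed by the twisting, and \<open>Rt\<close>
  restricts to R on degree-zero arguments by \<open>rt_incl\<close>.\<close>

lemma iD_mult:
  assumes "s \<in> carrier D.AF_ten" "t \<in> carrier D.AF_ten"
  shows "iD (D.act s t) = wm (iD s) (iD t)"
proof -
  have 1: "iD (D.act (D.q a b) t) = wm (iD (D.q a b)) (iD t)" if "a \<in> carrier A" "b \<in> carrier B" for a b
    by (rule D.AF.additive_ext[OF W_ab additive_compose[OF D.act_additive_right iD_additive]
          additive_compose[OF iD_additive W.act_additive_right] assms(2)])
      (use that in \<open>simp_all add: D.act_pure W.act_pure iD_pure iD_lm_rm rt_incl\<close>)
  show ?thesis
    by (rule D.AF.additive_ext[OF W_ab additive_compose[OF D.act_additive_left iD_additive]
          additive_compose[OF iD_additive W.act_additive_left] assms(1)])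
      (use assms 1 in simp_all)
qed

end

section \<open>Degrees and signs under the extended twisting map\<close>

context twisted_dga
begin

text \<open>\<open>\<Omega>\<^sup>0A \<otimes> \<Omega>B\<close> and \<open>\<Omega>A \<otimes> \<Omega>\<^sup>0B\<close> are the additive spans of \<open>SA\<close> and \<open>SB\<close>.\<close>

definition SA where "SA = {w (iA a) \<eta> | a \<eta>. a \<in> carrier A \<and> \<eta> \<in> carrier WB}"
definition SB where "SB = {w \<phi> (iB b) | \<phi> b. \<phi> \<in> carrier WA \<and> b \<in> carrier B}"

lemma SA_subset: "SA \<subseteq> carrier W" by (auto simp: SA_def)
lemma SB_subset: "SB \<subseteq> carrier W" by (auto simp: SB_def)

lemma SA_I: "a \<in> carrier A \<Longrightarrow> \<eta> \<in> carrier WB \<Longrightarrow> w (iA a) \<eta> \<in> span_in W SA"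
  by (rule span_in_incl) (auto simp: SA_def)

lemma SB_I: "\<phi> \<in> carrier WA \<Longrightarrow> b \<in> carrier B \<Longrightarrow> w \<phi> (iB b) \<in> span_in W SB"
  by (rule span_in_incl) (auto simp: SB_def)

lemma SA_image:
  assumes "additive W W f" "t \<in> span_in W SA"
    and "\<And>a \<eta>. a \<in> carrier A \<Longrightarrow> \<eta> \<in> carrier WB \<Longrightarrow> f (w (iA a) \<eta>) \<in> span_in W SA"
  shows "f t \<in> span_in W SA"
  by (rule span_in_image[OF W_ab W_ab assms(1) SA_subset SA_subset _ assms(2)])
    (use assms(3) in \<open>auto simp: SA_def\<close>)

lemma SB_image:
  assumes "additive W W f" "t \<in> span_in W SB"
    and "\<And>\<phi> b. \<phi> \<in> carrier WA \<Longrightarrow> b \<in> carrier B \<Longrightarrow> f (w \<phi> (iB b)) \<in> span_in W SB"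
  shows "f t \<in> span_in W SB"
  by (rule span_in_image[OF W_ab W_ab assms(1) SB_subset SB_subset _ assms(2)])
    (use assms(3) in \<open>auto simp: SB_def\<close>)

lemma SA_eq:
  assumes "abelian_group U" "additive W U f" "additive W U g" "t \<in> span_in W SA"
    and "\<And>a \<eta>. a \<in> carrier A \<Longrightarrow> \<eta> \<in> carrier WB \<Longrightarrow> f (w (iA a) \<eta>) = g (w (iA a) \<eta>)"
  shows "f t = g t"
  by (rule additive_eq_on_span[OF W_ab assms(1-3) SA_subset _ assms(4)])
    (use assms(5) in \<open>auto simp: SA_def\<close>)

lemma SB_eq:
  assumes "abelian_group U" "additive W U f" "additive W U g" "t \<in> span_in W SB"
    and "\<And>\<phi> b. \<phi> \<in> carrier WA \<Longrightarrow> b \<in> carrier B \<Longrightarrow> f (w \<phi> (iB b)) = g (w \<phi> (iB b))"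
  shows "f t = g t"
  by (rule additive_eq_on_span[OF W_ab assms(1-3) SB_subset _ assms(4)])
    (use assms(5) in \<open>auto simp: SB_def\<close>)

lemma iD_span:
  assumes "u \<in> carrier D.AF_ten"
  shows "iD u \<in> span_in W SA" "iD u \<in> span_in W SB"
proof -
  note h = span_in_image[OF D.AF_ab W_ab iD_additive D.AF.pures_subset _ _ assms[unfolded D.AF.carrier_span]]
  show "iD u \<in> span_in W SA"
    by (rule h[OF SA_subset]) (auto simp: iD_pure intro!: SA_I)
  show "iD u \<in> span_in W SB"
    by (rule h[OF SB_subset]) (auto simp: iD_pure intro!: SB_I)
qed

lemma Rt_zero: "Rt \<zero>\<^bsub>ktens k WB WA\<^esub> = \<zero>\<^bsub>W\<^esub>"
  by (rule additive_zero[OF W.BA.MN.abelian_group_axioms W_ab W.R_additive])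

lemma rt_minus_left: "\<eta> \<in> carrier WB \<Longrightarrow> \<phi> \<in> carrier WA \<Longrightarrow> rt (\<ominus>\<^bsub>WB\<^esub> \<eta>) \<phi> = \<ominus>\<^bsub>W\<^esub> rt \<eta> \<phi>"
  using additive_minus[OF W.BA.MN.abelian_group_axioms W_ab W.R_additive, of "kpure k WB WA \<eta> \<phi>"]
  by (simp add: W.BA.pure_minus_left)

lemma rt_minus_right: "\<eta> \<in> carrier WB \<Longrightarrow> \<phi> \<in> carrier WA \<Longrightarrow> rt \<eta> (\<ominus>\<^bsub>WA\<^esub> \<phi>) = \<ominus>\<^bsub>W\<^esub> rt \<eta> \<phi>"
  using additive_minus[OF W.BA.MN.abelian_group_axioms W_ab W.R_additive, of "kpure k WB WA \<eta> \<phi>"]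
  by (simp add: W.BA.pure_minus_right)

lemma wm_one_left: "\<eta> \<in> carrier WB \<Longrightarrow> \<phi> \<in> carrier WA \<Longrightarrow> \<omega> \<in> carrier WB \<Longrightarrow>
    wm (w \<one>\<^bsub>WA\<^esub> \<eta>) (w \<phi> \<omega>) = W.rm (rt \<eta> \<phi>) \<omega>"
  by (simp add: W.act_pure)

lemma wm_one_right: "\<eta> \<in> carrier WB \<Longrightarrow> \<phi> \<in> carrier WA \<Longrightarrow> \<phi>' \<in> carrier WA \<Longrightarrow>
    wm (w \<phi>' \<eta>) (w \<phi> \<one>\<^bsub>WB\<^esub>) = W.lm \<phi>' (rt \<eta> \<phi>)"
  by (simp add: W.act_pure)

text \<open>Moving an element of A past a form on B produces no differentials on the A side.
  Induction on \<eta>: in a product, a first passes the right factor and leaves new elements of A,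
  which is why a is arbitrary in the induction; for a differential, the sign map fixes A. This makes
  the degree-zero projection in the compatibility condition lossless.\<close>

lemma rt_span_A:
  assumes "\<eta> \<in> carrier WB" "a \<in> carrier A"
  shows "rt \<eta> (iA a) \<in> span_in W SA"
  using assms
proof (induction arbitrary: a rule: UB.W_induct)
  case (incl b)
  then show ?case by (simp add: rt_incl iD_span)
next
  case zero
  then show ?case by (simp add: Rt_zero span_in_zero)
next
  case (add v w)
  then show ?case by (simp add: W.\<rho>_add span_in_add)
next
  case (smult c \<eta>)
  have "c \<odot>\<^bsub>W\<^esub> rt \<eta> (iA a) \<in> span_in W SA"
    by (rule SA_image[OF W.AF.ksmult_additive[OF smult(1)] smult(3)[OF smult(4)]])
      (use smult(1) in \<open>simp add: W.AF.ksmult_pure W.AF.pure_balanced SA_I\<close>)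
  then show ?case using smult by (simp add: W.\<rho>_smult)
next
  case (mult \<eta> \<eta>')
  have "wm (w \<one>\<^bsub>WA\<^esub> \<eta>) (rt \<eta>' (iA a)) \<in> span_in W SA"
  proof (rule SA_image[OF W.act_additive_right mult(4)[OF mult(5)]])
    fix a' \<omega> assume h: "a' \<in> carrier A" "\<omega> \<in> carrier WB"
    have "W.rm (rt \<eta> (iA a')) \<omega> \<in> span_in W SA"
      by (rule SA_image[OF W.rm_additive[OF h(2)] mult(3)[OF h(1)]])
        (use h in \<open>simp add: W.rm_pure SA_I\<close>)
    then show "wm (w \<one>\<^bsub>WA\<^esub> \<eta>) (w (iA a') \<omega>) \<in> span_in W SA"
      using h mult by (simp add: wm_one_left)
  qed (use mult in simp)
  then show ?case using mult by (simp add: W.tw_act_act)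
next
  case (dif \<eta>)
  have "tmap UA.sign dB (rt \<eta> (iA a)) \<in> span_in W SA"
    by (rule SA_image[OF tmap_additive[OF lin(4) lin(3)] dif(2)[OF dif(3)]])
      (simp add: tmap_pure[OF lin(4) lin(3)] SA_I)
  then show ?case using dif by (simp add: rt_dB)
qed

text \<open>The mirror image, by induction on \<phi>. It keeps the B side in degree zero, where the
  Leibniz rule of d carries no sign.\<close>

lemma rt_span_B:
  assumes "\<phi> \<in> carrier WA" "b \<in> carrier B"
  shows "rt (iB b) \<phi> \<in> span_in W SB"
  using assms
proof (induction arbitrary: b rule: UA.W_induct)
  case (incl a)
  then show ?case by (simp add: rt_incl iD_span)
next
  case zero
  then show ?case by (simp add: Rt_zero span_in_zero)
next
  case (add v w)
  then show ?case by (simp add: W.\<rho>_add span_in_add)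
next
  case (smult c \<phi>)
  have "c \<odot>\<^bsub>W\<^esub> rt (iB b) \<phi> \<in> span_in W SB"
    by (rule SB_image[OF W.AF.ksmult_additive[OF smult(1)] smult(3)[OF smult(4)]])
      (use smult(1) in \<open>simp add: W.AF.ksmult_pure SB_I\<close>)
  then show ?case using smult by (simp add: W.\<rho>_smult)
next
  case (mult \<phi> \<phi>')
  have "wm (rt (iB b) \<phi>) (w \<phi>' \<one>\<^bsub>WB\<^esub>) \<in> span_in W SB"
  proof (rule SB_image[OF W.act_additive_left mult(3)[OF mult(5)]])
    fix \<psi> b' assume h: "\<psi> \<in> carrier WA" "b' \<in> carrier B"
    have "W.lm \<psi> (rt (iB b') \<phi>') \<in> span_in W SB"
      by (rule SB_image[OF W.lm_additive[OF h(1)] mult(4)[OF h(2)]])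
        (use h in \<open>simp add: W.lm_pure SB_I\<close>)
    then show "wm (w \<psi> (iB b')) (w \<phi>' \<one>\<^bsub>WB\<^esub>) \<in> span_in W SB"
      using h mult by (simp add: wm_one_right)
  qed (use mult in simp)
  then show ?case using mult by (simp add: W.tw_mult_act)
next
  case (dif \<phi>)
  have "tmap dA UB.sign (rt (iB b) \<phi>) \<in> span_in W SB"
    by (rule SB_image[OF tmap_additive[OF lin(2) lin(5)] dif(2)[OF dif(3)]])
      (simp add: tmap_pure[OF lin(2) lin(5)] SB_I)
  then show ?case using dif by (simp add: rt_dA)
qed

abbreviation S1 where "S1 \<equiv> tmap UA.sign idf"
abbreviation S2 where "S2 \<equiv> tmap idf UB.sign"

lemmas S1_additive = tmap_additive[OF lin(4) lin(1)]
lemmas S2_additive = tmap_additive[OF lin(1) lin(5)]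
lemmas S1_pure = tmap_pure[OF lin(4) lin(1)]
lemmas S2_pure = tmap_pure[OF lin(1) lin(5)]

lemma S1_lm:
  assumes "\<phi> \<in> carrier WA" "t \<in> carrier W"
  shows "S1 (W.lm \<phi> t) = W.lm (UA.sign \<phi>) (S1 t)"
  by (rule W.AF.additive_ext[OF W_ab additive_compose[OF W.lm_additive S1_additive]
        additive_compose[OF S1_additive W.lm_additive] assms(2)])
    (use assms in \<open>simp_all add: S1_pure W.lm_pure UA.sign_mult\<close>)

lemma S2_rm:
  assumes "\<omega> \<in> carrier WB" "t \<in> carrier W"
  shows "S2 (W.rm t \<omega>) = W.rm (S2 t) (UB.sign \<omega>)"
  by (rule W.AF.additive_ext[OF W_ab additive_compose[OF W.rm_additive S2_additive]
        additive_compose[OF S2_additive W.rm_additive] assms(2)])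
    (use assms in \<open>simp_all add: S2_pure W.rm_pure UB.sign_mult\<close>)

lemma S1_iD: "t \<in> carrier D.AF_ten \<Longrightarrow> S1 (iD t) = iD t"
  by (rule D.AF.additive_ext[OF W_ab additive_compose[OF iD_additive S1_additive] iD_additive])
    (simp_all add: iD_pure S1_pure)

lemma S2_iD: "t \<in> carrier D.AF_ten \<Longrightarrow> S2 (iD t) = iD t"
  by (rule D.AF.additive_ext[OF W_ab additive_compose[OF iD_additive S2_additive] iD_additive])
    (simp_all add: iD_pure S2_pure)

lemma S1_d:
  assumes "t \<in> carrier W"
  shows "S1 (tmap dA UB.sign t) = \<ominus>\<^bsub>W\<^esub> tmap dA UB.sign (S1 t)"
  by (rule W.AF.additive_ext[OF W_ab additive_compose[OF tmap_additive[OF lin(2) lin(5)] S1_additive]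
        additive_uminus[OF W_ab additive_compose[OF S1_additive tmap_additive[OF lin(2) lin(5)]]] assms])
    (simp_all add: S1_pure tmap_pure[OF lin(2) lin(5)] UA.sign_dif W.AF.pure_minus_left)

lemma S2_d:
  assumes "t \<in> carrier W"
  shows "S2 (tmap UA.sign dB t) = \<ominus>\<^bsub>W\<^esub> tmap UA.sign dB (S2 t)"
  by (rule W.AF.additive_ext[OF W_ab additive_compose[OF tmap_additive[OF lin(4) lin(3)] S2_additive]
        additive_uminus[OF W_ab additive_compose[OF S2_additive tmap_additive[OF lin(4) lin(3)]]] assms])
    (simp_all add: S2_pure tmap_pure[OF lin(4) lin(3)] UB.sign_dif W.AF.pure_minus_right)

text \<open>For b in B the degree on the A side is preserved by the twisting. In the product step
  \<open>rt_span_B\<close> is essential: all terms have their B component in degree zero, so the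
  induction hypothesis for the second factor applies to each of them.\<close>

lemma rt_sign_right:
  assumes "\<phi> \<in> carrier WA" "b \<in> carrier B"
  shows "rt (iB b) (UA.sign \<phi>) = S1 (rt (iB b) \<phi>)"
  using assms
proof (induction arbitrary: b rule: UA.W_induct)
  case (incl a)
  then show ?case by (simp add: rt_incl S1_iD)
next
  case zero
  then show ?case using additive_zero[OF W_ab W_ab S1_additive] by (simp add: UA.sign_zero Rt_zero)
next
  case (add v w)
  then show ?case by (simp add: UA.sign_add W.\<rho>_add additive_add[OF S1_additive])
next
  case (smult c \<phi>)
  then show ?case by (simp add: UA.sign_smult W.\<rho>_smult tmap_smult[OF lin(4) lin(1)])
next
  case (mult \<phi> \<phi>')
  have "S1 (wm (rt (iB b) \<phi>) (w \<phi>' \<one>\<^bsub>WB\<^esub>)) = wm (S1 (rt (iB b) \<phi>)) (w (UA.sign \<phi>') \<one>\<^bsub>WB\<^esub>)"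
    by (rule SB_eq[OF W_ab additive_compose[OF W.act_additive_left S1_additive]
          additive_compose[OF S1_additive W.act_additive_left] rt_span_B[OF mult(1) mult(5)]])
      (use mult in \<open>simp_all add: wm_one_right S1_lm S1_pure\<close>)
  then show ?case using mult by (simp add: UA.sign_mult W.tw_mult_act)
next
  case (dif \<phi>)
  then show ?case
    by (simp add: UA.sign_dif rt_minus_right rt_dA S1_d)
qed

lemma rt_sign_left:
  assumes "\<eta> \<in> carrier WB" "a \<in> carrier A"
  shows "rt (UB.sign \<eta>) (iA a) = S2 (rt \<eta> (iA a))"
  using assms
proof (induction arbitrary: a rule: UB.W_induct)
  case (incl a)
  then show ?case by (simp add: rt_incl S2_iD)
next
  case zero
  then show ?case using additive_zero[OF W_ab W_ab S2_additive] by (simp add: UB.sign_zero Rt_zero)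
next
  case (add v w)
  then show ?case by (simp add: UB.sign_add W.\<rho>_add additive_add[OF S2_additive])
next
  case (smult c \<phi>)
  then show ?case by (simp add: UB.sign_smult W.\<rho>_smult tmap_smult[OF lin(1) lin(5)])
next
  case (mult \<eta> \<eta>')
  have "S2 (wm (w \<one>\<^bsub>WA\<^esub> \<eta>) (rt \<eta>' (iA a))) = wm (w \<one>\<^bsub>WA\<^esub> (UB.sign \<eta>)) (S2 (rt \<eta>' (iA a)))"
    by (rule SA_eq[OF W_ab additive_compose[OF W.act_additive_right S2_additive]
          additive_compose[OF S2_additive W.act_additive_right] rt_span_A[OF mult(2) mult(5)]])
      (use mult in \<open>simp_all add: wm_one_left S2_rm S2_pure\<close>)
  then show ?case using mult by (simp add: UB.sign_mult W.tw_act_act)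
next
  case (dif \<eta>)
  then show ?case
    by (simp add: UB.sign_dif rt_minus_left rt_dB S2_d)
qed

text \<open>With u = \<open>rt (iB b) \<phi>\<close> the product is a u \<omega>, and d falls in
  four places: on a, on either tensor factor of u, and on \<omega>. Those on a and on the B factor
  of u form d(a \<otimes> b) \<cdot> (\<phi> \<otimes> \<omega>), the other two form (a \<otimes> b)
  \<cdot> d(\<phi> \<otimes> \<omega>). By \<open>rt_span_B\<close> the B factor of u has degree
  zero, so no further sign arises.\<close>

lemma dW_iD_mult_pure:
  assumes "a \<in> carrier A" "b \<in> carrier B" "\<phi> \<in> carrier WA" "\<omega> \<in> carrier WB"
  shows "dW (wm (w (iA a) (iB b)) (w \<phi> \<omega>)) =
    wm (dW (w (iA a) (iB b))) (w \<phi> \<omega>) \<oplus>\<^bsub>W\<^esub> wm (w (iA a) (iB b)) (dW (w \<phi> \<omega>))"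
proof -
  define u where "u = rt (iB b) \<phi>"
  have u: "u \<in> carrier W" "u \<in> span_in W SB" using assms rt_span_B by (auto simp: u_def)
  let ?dA = "tmap dA UB.sign" and ?dB = "tmap UA.sign dB"
  note dA_add = tmap_additive[OF lin(2) lin(5)] and dB_add = tmap_additive[OF lin(4) lin(3)]
  have "dW (W.lm (iA a) (W.rm u \<omega>)) =
      (W.lm (dA (iA a)) (W.rm u \<omega>) \<oplus>\<^bsub>W\<^esub> W.lm (iA a) (W.rm (?dB u) \<omega>)) \<oplus>\<^bsub>W\<^esub>
      (W.lm (iA a) (W.rm (?dA u) \<omega>) \<oplus>\<^bsub>W\<^esub> W.lm (iA a) (W.rm (S1 u) (dB \<omega>)))"
  proof (rule SB_eq[OF W_ab _ _ u(2)])
    show "additive W W (\<lambda>u. dW (W.lm (iA a) (W.rm u \<omega>)))"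
      using assms by (intro additive_compose[OF W.rm_additive additive_compose[OF W.lm_additive dW_additive]]) simp_all
    show "additive W W (\<lambda>u. (W.lm (dA (iA a)) (W.rm u \<omega>) \<oplus>\<^bsub>W\<^esub> W.lm (iA a) (W.rm (?dB u) \<omega>)) \<oplus>\<^bsub>W\<^esub>
      (W.lm (iA a) (W.rm (?dA u) \<omega>) \<oplus>\<^bsub>W\<^esub> W.lm (iA a) (W.rm (S1 u) (dB \<omega>))))"
      using assms
      by (intro additive_plus[OF W_ab] additive_compose[OF W.rm_additive W.lm_additive]
          additive_compose[OF dA_add additive_compose[OF W.rm_additive W.lm_additive]]
          additive_compose[OF dB_add additive_compose[OF W.rm_additive W.lm_additive]]
          additive_compose[OF S1_additive additive_compose[OF W.rm_additive W.lm_additive]]) simp_all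
  next
    fix \<psi> b' assume h: "\<psi> \<in> carrier WA" "b' \<in> carrier B"
    let ?x = "w (dA (iA a) \<otimes>\<^bsub>WA\<^esub> \<psi>) (iB b' \<otimes>\<^bsub>WB\<^esub> \<omega>)"
    let ?y = "w (iA a \<otimes>\<^bsub>WA\<^esub> UA.sign \<psi>) (dB (iB b') \<otimes>\<^bsub>WB\<^esub> \<omega>)"
    let ?z = "w (iA a \<otimes>\<^bsub>WA\<^esub> dA \<psi>) (iB b' \<otimes>\<^bsub>WB\<^esub> \<omega>)"
    let ?v = "w (iA a \<otimes>\<^bsub>WA\<^esub> UA.sign \<psi>) (iB b' \<otimes>\<^bsub>WB\<^esub> dB \<omega>)"
    have c: "?x \<in> carrier W" "?y \<in> carrier W" "?z \<in> carrier W" "?v \<in> carrier W" using h assms by simp_all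
    have "dW (W.lm (iA a) (W.rm (w \<psi> (iB b')) \<omega>)) = (?x \<oplus>\<^bsub>W\<^esub> ?z) \<oplus>\<^bsub>W\<^esub> (?y \<oplus>\<^bsub>W\<^esub> ?v)"
      using h assms by (simp add: W.rm_pure W.lm_pure dW_pure UA.dif_incl_mult UB.dif_incl_mult UA.sign_mult
          W.AF.pure_add_left W.AF.pure_add_right)
    also have "\<dots> = (?x \<oplus>\<^bsub>W\<^esub> ?y) \<oplus>\<^bsub>W\<^esub> (?z \<oplus>\<^bsub>W\<^esub> ?v)" using c by (simp add: W.AF.MN.a_ac)
    finally show "dW (W.lm (iA a) (W.rm (w \<psi> (iB b')) \<omega>)) =
        (W.lm (dA (iA a)) (W.rm (w \<psi> (iB b')) \<omega>) \<oplus>\<^bsub>W\<^esub> W.lm (iA a) (W.rm (?dB (w \<psi> (iB b'))) \<omega>)) \<oplus>\<^bsub>W\<^esub>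
        (W.lm (iA a) (W.rm (?dA (w \<psi> (iB b'))) \<omega>) \<oplus>\<^bsub>W\<^esub> W.lm (iA a) (W.rm (S1 (w \<psi> (iB b'))) (dB \<omega>)))"
      using h assms by (simp add: W.rm_pure W.lm_pure S1_pure tmap_pure[OF lin(2) lin(5)] tmap_pure[OF lin(4) lin(3)])
  qed
  moreover have "wm (dW (w (iA a) (iB b))) (w \<phi> \<omega>) =
      W.lm (dA (iA a)) (W.rm u \<omega>) \<oplus>\<^bsub>W\<^esub> W.lm (iA a) (W.rm (?dB u) \<omega>)"
    using assms by (simp add: dW_pure W.act_add_left W.act_pure u_def rt_dB)
  moreover have "wm (w (iA a) (iB b)) (dW (w \<phi> \<omega>)) =
      W.lm (iA a) (W.rm (?dA u) \<omega>) \<oplus>\<^bsub>W\<^esub> W.lm (iA a) (W.rm (S1 u) (dB \<omega>))"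
    using assms by (simp add: dW_pure W.act_add_right W.act_pure u_def rt_dA rt_sign_right)
  ultimately show ?thesis using assms by (simp add: W.act_pure u_def)
qed

lemma dW_iD_mult:
  assumes "x \<in> carrier D.AF_ten" "t \<in> carrier W"
  shows "dW (wm (iD x) t) = wm (dW (iD x)) t \<oplus>\<^bsub>W\<^esub> wm (iD x) (dW t)"
proof -
  have 1: "dW (wm (iD (D.q a b)) t) = wm (dW (iD (D.q a b))) t \<oplus>\<^bsub>W\<^esub> wm (iD (D.q a b)) (dW t)"
    if "a \<in> carrier A" "b \<in> carrier B" for a b
    by (rule W.AF.additive_ext[OF W_ab additive_compose[OF W.act_additive_right dW_additive]
          additive_plus[OF W_ab W.act_additive_right additive_compose[OF dW_additive W.act_additive_right]] assms(2)])
      (use that in \<open>simp_all add: iD_pure dW_iD_mult_pure\<close>)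
  show ?thesis
    by (rule D.AF.additive_ext[OF W_ab
          additive_compose[OF iD_additive additive_compose[OF W.act_additive_left dW_additive]]
          additive_plus[OF W_ab additive_compose[OF iD_additive additive_compose[OF dW_additive W.act_additive_left]]
            additive_compose[OF iD_additive W.act_additive_left]] assms(1)])
      (use assms 1 in simp_all)
qed

end

section \<open>Connections and their extensions\<close>

text \<open>Collects the properties of a calculus that make M \<otimes> Omega D a right module over
  the forms, so that the universal calculi and the twisted calculus are treated alike.\<close>

locale form_space =
  M: abelian_group M + W: abelian_group W
  for D :: "('k, 'd, 'y) module_scheme" and W :: "('k, 'd, 'w, 'z) calculus_scheme"
    and M :: "('k, 'm, 'x) module_scheme" and r :: "'m \<Rightarrow> 'd \<Rightarrow> 'm" +
  assumes act_closed: "m \<in> carrier M \<Longrightarrow> x \<in> carrier D \<Longrightarrow> r m x \<in> carrier M"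
    and incl_closed: "x \<in> carrier D \<Longrightarrow> incl W x \<in> carrier W"
    and mult_closed: "v \<in> carrier W \<Longrightarrow> w \<in> carrier W \<Longrightarrow> v \<otimes>\<^bsub>W\<^esub> w \<in> carrier W"
    and mult_add_left: "u \<in> carrier W \<Longrightarrow> v \<in> carrier W \<Longrightarrow> w \<in> carrier W \<Longrightarrow>
      (u \<oplus>\<^bsub>W\<^esub> v) \<otimes>\<^bsub>W\<^esub> w = u \<otimes>\<^bsub>W\<^esub> w \<oplus>\<^bsub>W\<^esub> v \<otimes>\<^bsub>W\<^esub> w"
    and mult_add_right: "u \<in> carrier W \<Longrightarrow> v \<in> carrier W \<Longrightarrow> w \<in> carrier W \<Longrightarrow>
      u \<otimes>\<^bsub>W\<^esub> (v \<oplus>\<^bsub>W\<^esub> w) = u \<otimes>\<^bsub>W\<^esub> v \<oplus>\<^bsub>W\<^esub> u \<otimes>\<^bsub>W\<^esub> w"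
    and mult_assoc: "u \<in> carrier W \<Longrightarrow> v \<in> carrier W \<Longrightarrow> w \<in> carrier W \<Longrightarrow>
      (u \<otimes>\<^bsub>W\<^esub> v) \<otimes>\<^bsub>W\<^esub> w = u \<otimes>\<^bsub>W\<^esub> (v \<otimes>\<^bsub>W\<^esub> w)"
begin

sublocale tensor "carrier D" M r W "\<lambda>x w. incl W x \<otimes>\<^bsub>W\<^esub> w"
  rewrites "tens (carrier D) M r W (\<lambda>x w. incl W x \<otimes>\<^bsub>W\<^esub> w) = forms D W M r"
    and "tens_pure (carrier D) M r W (\<lambda>x w. incl W x \<otimes>\<^bsub>W\<^esub> w) = fpure D W M r"
  by (simp_all add: tensor_def tensor_axioms_def M.abelian_group_axioms W.abelian_group_axioms
      act_closed incl_closed mult_closed forms_def fpure_def)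

abbreviation FT where "FT \<equiv> forms D W M r"
abbreviation fp where "fp \<equiv> fpure D W M r"
abbreviation fact where "fact \<equiv> forms_act D W M r"

lemmas FT_ab = MN.abelian_group_axioms

lemma fact_bal: "w' \<in> carrier W \<Longrightarrow>
    balanced (carrier D) M r W (\<lambda>x w. incl W x \<otimes>\<^bsub>W\<^esub> w) FT (\<lambda>m w. fp m (w \<otimes>\<^bsub>W\<^esub> w'))"
  by (rule balancedI)
    (simp_all add: mult_closed pure_add_left mult_add_left pure_add_right pure_balanced mult_assoc incl_closed)

lemma fact_additive: "w \<in> carrier W \<Longrightarrow> additive FT FT (\<lambda>t. fact t w)"
  unfolding forms_act_def by (rule lift_additive[OF FT_ab fact_bal])

lemma fact_pure: "m \<in> carrier M \<Longrightarrow> v \<in> carrier W \<Longrightarrow> w \<in> carrier W \<Longrightarrow> fact (fp m v) w = fp m (v \<otimes>\<^bsub>W\<^esub> w)"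
  unfolding forms_act_def by (rule lift_pure[OF FT_ab fact_bal])

lemma fact_closed [simp]: "t \<in> carrier FT \<Longrightarrow> w \<in> carrier W \<Longrightarrow> fact t w \<in> carrier FT"
  by (rule additive_closed[OF fact_additive])

lemmas fact_add_left = additive_add[OF fact_additive]

lemma fact_add_right:
  assumes "t \<in> carrier FT" "v \<in> carrier W" "w \<in> carrier W"
  shows "fact t (v \<oplus>\<^bsub>W\<^esub> w) = fact t v \<oplus>\<^bsub>FT\<^esub> fact t w"
  by (rule additive_ext[OF FT_ab fact_additive additive_plus[OF FT_ab fact_additive fact_additive] assms(1)])
    (use assms in \<open>simp_all add: fact_pure mult_add_right pure_add_right mult_closed\<close>)

lemma fact_fact:
  assumes "t \<in> carrier FT" "v \<in> carrier W" "w \<in> carrier W"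
  shows "fact (fact t v) w = fact t (v \<otimes>\<^bsub>W\<^esub> w)"
  by (rule additive_ext[OF FT_ab additive_compose[OF fact_additive fact_additive] fact_additive assms(1)])
    (use assms in \<open>simp_all add: fact_pure mult_assoc mult_closed\<close>)

lemma fp_act: "m \<in> carrier M \<Longrightarrow> x \<in> carrier D \<Longrightarrow> w \<in> carrier W \<Longrightarrow> fp (r m x) w = fp m (incl W x \<otimes>\<^bsub>W\<^esub> w)"
  by (rule pure_balanced)

end

text \<open>Of the differential, only additivity and the Leibniz rule with left factor in D are
  required; for the twisted calculus the latter is \<open>dW_iD_mult\<close>.\<close>

locale connection = form_space +
  fixes nab
  assumes nab_additive: "additive M FT nab"
    and nab_act: "m \<in> carrier M \<Longrightarrow> x \<in> carrier D \<Longrightarrow>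
      nab (r m x) = fact (nab m) (incl W x) \<oplus>\<^bsub>FT\<^esub> fp m (dif W (incl W x))"
    and d_additive: "additive W W (dif W)"
    and d_incl: "x \<in> carrier D \<Longrightarrow> w \<in> carrier W \<Longrightarrow>
      dif W (incl W x \<otimes>\<^bsub>W\<^esub> w) = dif W (incl W x) \<otimes>\<^bsub>W\<^esub> w \<oplus>\<^bsub>W\<^esub> incl W x \<otimes>\<^bsub>W\<^esub> dif W w"
begin

abbreviation ext where "ext \<equiv> extended_connection D W M r nab"

lemma nab_closed [simp]: "m \<in> carrier M \<Longrightarrow> nab m \<in> carrier FT"
  by (rule additive_closed[OF nab_additive])

lemma d_closed [simp]: "w \<in> carrier W \<Longrightarrow> dif W w \<in> carrier W"
  by (rule additive_closed[OF d_additive])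

text \<open>The Leibniz rule of \<nabla> is what permits the extension: at (mx, n) and at (m, xn)
  one gets the same three terms, \<nabla>(m) x n, m \<otimes> dx n and m \<otimes> x dn.\<close>

lemma ext_bal: "balanced (carrier D) M r W (\<lambda>x w. incl W x \<otimes>\<^bsub>W\<^esub> w) FT
    (\<lambda>m w. fact (nab m) w \<oplus>\<^bsub>FT\<^esub> fp m (dif W w))"
proof (rule balancedI)
  fix m m' n assume "m \<in> carrier M" "m' \<in> carrier M" "n \<in> carrier W"
  then show "fact (nab (m \<oplus>\<^bsub>M\<^esub> m')) n \<oplus>\<^bsub>FT\<^esub> fp (m \<oplus>\<^bsub>M\<^esub> m') (dif W n) =
      (fact (nab m) n \<oplus>\<^bsub>FT\<^esub> fp m (dif W n)) \<oplus>\<^bsub>FT\<^esub> (fact (nab m') n \<oplus>\<^bsub>FT\<^esub> fp m' (dif W n))"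
    by (simp add: additive_add[OF nab_additive] fact_add_left pure_add_left MN.a_ac)
next
  fix m n n' assume "m \<in> carrier M" "n \<in> carrier W" "n' \<in> carrier W"
  then show "fact (nab m) (n \<oplus>\<^bsub>W\<^esub> n') \<oplus>\<^bsub>FT\<^esub> fp m (dif W (n \<oplus>\<^bsub>W\<^esub> n')) =
      (fact (nab m) n \<oplus>\<^bsub>FT\<^esub> fp m (dif W n)) \<oplus>\<^bsub>FT\<^esub> (fact (nab m) n' \<oplus>\<^bsub>FT\<^esub> fp m (dif W n'))"
    by (simp add: additive_add[OF d_additive] fact_add_right pure_add_right MN.a_ac)
next
  fix m x n assume "m \<in> carrier M" "x \<in> carrier D" "n \<in> carrier W"
  then show "fact (nab (r m x)) n \<oplus>\<^bsub>FT\<^esub> fp (r m x) (dif W n) =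
      fact (nab m) (incl W x \<otimes>\<^bsub>W\<^esub> n) \<oplus>\<^bsub>FT\<^esub> fp m (dif W (incl W x \<otimes>\<^bsub>W\<^esub> n))"
    by (simp add: nab_act fact_add_left incl_closed mult_closed fact_fact fact_pure fp_act d_incl pure_add_right MN.a_assoc)
qed simp

lemma ext_additive: "additive FT FT ext"
  unfolding extended_connection_def[abs_def] by (rule lift_additive[OF FT_ab ext_bal])

lemma ext_pure: "m \<in> carrier M \<Longrightarrow> w \<in> carrier W \<Longrightarrow> ext (fp m w) = fact (nab m) w \<oplus>\<^bsub>FT\<^esub> fp m (dif W w)"
  unfolding extended_connection_def by (rule lift_pure[OF FT_ab ext_bal])

lemma ext_closed [simp]: "t \<in> carrier FT \<Longrightarrow> ext t \<in> carrier FT"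
  by (rule additive_closed[OF ext_additive])

end

context universal
begin

lemma form_space_module:
  assumes "right_module k A M r"
  shows "form_space A W M r"
proof -
  interpret M: module k M using assms by (simp add: right_module_def)
  have "r m x \<in> carrier M" if "m \<in> carrier M" "x \<in> carrier A" for m x
    using assms that unfolding right_module_def linear_over_def by blast
  then show ?thesis
    by (unfold_locales) (simp_all add: W.l_distr W.r_distr W.m_assoc)
qed

lemma connection_universal:
  assumes "right_module k A M r" "right_connection k A W M r nab"
  shows "connection A W M r nab"
proof -
  interpret form_space A W M r by (rule form_space_module[OF assms(1)])
  have lin: "linear_over k M FT nab" using assms(2) by (simp add: right_connection_def)
  have "additive M FT nab"
    by (rule additiveI) (use lin in \<open>unfold linear_over_def, blast+\<close>)
  moreover have "nab (r m x) = fact (nab m) (incl W x) \<oplus>\<^bsub>FT\<^esub> fp m (dif W (incl W x))"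
    if "m \<in> carrier M" "x \<in> carrier A" for m x
    using assms(2) that unfolding right_connection_def by blast
  ultimately show ?thesis
    by unfold_locales (simp_all add: dif_additive dif_incl_mult)
qed

end

section \<open>The module of the product connection\<close>

lemma direct_sum_abelian:
  fixes M :: "('k, 'm, 'x) module_scheme" and N :: "('k, 'n, 'y) module_scheme"
  assumes "abelian_group M" "abelian_group N"
  shows "abelian_group (direct_sum M N)"
proof -
  interpret M: abelian_group M by fact
  interpret N: abelian_group N by fact
  show ?thesis
  proof (rule abelian_groupI)
    fix x assume "x \<in> carrier (direct_sum M N)"
    then show "\<exists>y\<in>carrier (direct_sum M N). y \<oplus>\<^bsub>direct_sum M N\<^esub> x = \<zero>\<^bsub>direct_sum M N\<^esub>"
      by (intro bexI[of _ "(\<ominus>\<^bsub>M\<^esub> fst x, \<ominus>\<^bsub>N\<^esub> snd x)"]) (auto simp: direct_sum_def M.l_neg N.l_neg)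
  qed (auto simp: direct_sum_def M.a_ac N.a_ac)
qed

locale product_setting =
  twisted_dga k A B R Rt + F: twisted_action k A B F rF R \<tau> + E: module k E
  for k :: "('k, 'z) ring_scheme" and A :: "('k, 'a, 'x) module_scheme" and B :: "('k, 'b, 'y) module_scheme"
    and R :: "('b, 'a) tensor \<Rightarrow> ('a, 'b) tensor"
    and Rt :: "(('k, 'b) uform, ('k, 'a) uform) tensor \<Rightarrow> (('k, 'a) uform, ('k, 'b) uform) tensor"
    and E :: "('k, 'e, 'u) module_scheme" and rE :: "'e \<Rightarrow> 'a \<Rightarrow> 'e"
    and F :: "('k, 'f, 'v) module_scheme" and rF :: "'f \<Rightarrow> 'b \<Rightarrow> 'f"
    and \<tau> :: "('f, 'a) tensor \<Rightarrow> ('a, 'f) tensor" +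
  assumes E_mod: "right_module k A E rE"
    and R_surj: "R ` carrier (ktens k B A) = carrier (ktens k A B)"
    and \<tau>_bij: "bij_betw \<tau> (carrier (ktens k F A)) (carrier (ktens k A F))"
begin

lemma rE_closed [simp]: "e \<in> carrier E \<Longrightarrow> a \<in> carrier A \<Longrightarrow> rE e a \<in> carrier E"
  using E_mod unfolding right_module_def linear_over_def by blast

lemma rE_add_left: "e \<in> carrier E \<Longrightarrow> e' \<in> carrier E \<Longrightarrow> a \<in> carrier A \<Longrightarrow> rE (e \<oplus>\<^bsub>E\<^esub> e') a = rE e a \<oplus>\<^bsub>E\<^esub> rE e' a"
  using E_mod unfolding right_module_def linear_over_def by blast

lemma rE_add_right: "e \<in> carrier E \<Longrightarrow> a \<in> carrier A \<Longrightarrow> a' \<in> carrier A \<Longrightarrow> rE e (a \<oplus>\<^bsub>A\<^esub> a') = rE e a \<oplus>\<^bsub>E\<^esub> rE e a'"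
  using E_mod unfolding right_module_def linear_over_def by blast

lemma rE_smult_left: "c \<in> carrier k \<Longrightarrow> e \<in> carrier E \<Longrightarrow> a \<in> carrier A \<Longrightarrow> rE (c \<odot>\<^bsub>E\<^esub> e) a = c \<odot>\<^bsub>E\<^esub> rE e a"
  using E_mod unfolding right_module_def linear_over_def by blast

lemma rE_smult_right: "c \<in> carrier k \<Longrightarrow> e \<in> carrier E \<Longrightarrow> a \<in> carrier A \<Longrightarrow> rE e (c \<odot>\<^bsub>A\<^esub> a) = c \<odot>\<^bsub>E\<^esub> rE e a"
  using E_mod unfolding right_module_def linear_over_def by blast

lemma rE_one: "e \<in> carrier E \<Longrightarrow> rE e \<one>\<^bsub>A\<^esub> = e"
  using E_mod unfolding right_module_def by blast

lemma rE_mult: "e \<in> carrier E \<Longrightarrow> a \<in> carrier A \<Longrightarrow> a' \<in> carrier A \<Longrightarrow> rE e (a \<otimes>\<^bsub>A\<^esub> a') = rE (rE e a) a'"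
  using E_mod unfolding right_module_def by blast

section \<open>The summand E \<otimes> B as a module over the twisted tensor product\<close>

sublocale EB: ktensor_module k E B
  by unfold_locales simp_all

abbreviation DD where "DD \<equiv> ktens k A B"
abbreviation EBt where "EBt \<equiv> ktens k E B"
abbreviation AFt where "AFt \<equiv> ktens k A F"

lemmas EB_ab = EB.MN.abelian_group_axioms

text \<open>\<open>eta e t\<close> is \<open>(e \<otimes> 1) \<cdot> t\<close> for \<open>t \<in> A \<otimes>\<^sub>R B\<close>.\<close>

definition eta where "eta e t = tens_lift EBt (\<lambda>\<alpha> \<beta>. kpure k E B (rE e \<alpha>) \<beta>) t"

lemma eta_bal: "e \<in> carrier E \<Longrightarrow> kbalanced k A B EBt (\<lambda>\<alpha> \<beta>. kpure k E B (rE e \<alpha>) \<beta>)"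
  by (rule balancedI)
    (simp_all add: rE_add_right rE_smult_right EB.pure_add_left EB.pure_add_right EB.pure_balanced)

lemma eta_additive: "e \<in> carrier E \<Longrightarrow> additive DD EBt (eta e)"
  unfolding eta_def[abs_def] by (rule D.AF.lift_additive[OF EB_ab eta_bal])

lemma eta_pure: "e \<in> carrier E \<Longrightarrow> a \<in> carrier A \<Longrightarrow> b \<in> carrier B \<Longrightarrow> eta e (D.q a b) = kpure k E B (rE e a) b"
  unfolding eta_def by (rule D.AF.lift_pure[OF EB_ab eta_bal])

lemma eta_closed [simp]: "e \<in> carrier E \<Longrightarrow> t \<in> carrier DD \<Longrightarrow> eta e t \<in> carrier EBt"
  by (rule additive_closed[OF eta_additive])

lemma eta_add_left:
  assumes "e \<in> carrier E" "e' \<in> carrier E" "t \<in> carrier DD"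
  shows "eta (e \<oplus>\<^bsub>E\<^esub> e') t = eta e t \<oplus>\<^bsub>EBt\<^esub> eta e' t"
  by (rule D.AF.additive_ext[OF EB_ab eta_additive additive_plus[OF EB_ab eta_additive eta_additive] assms(3)])
    (use assms in \<open>simp_all add: eta_pure rE_add_left EB.pure_add_left\<close>)

lemma eta_smult:
  assumes "c \<in> carrier k" "e \<in> carrier E" "t \<in> carrier DD"
  shows "eta (c \<odot>\<^bsub>E\<^esub> e) t = eta e (c \<odot>\<^bsub>DD\<^esub> t)"
  by (rule D.AF.additive_ext[OF EB_ab eta_additive additive_compose[OF D.AF.ksmult_additive eta_additive] assms(3)])
    (use assms in \<open>simp_all add: eta_pure rE_smult_left rE_smult_right D.AF.ksmult_pure\<close>)

lemma eta_lm:
  assumes "a \<in> carrier A" "e \<in> carrier E" "t \<in> carrier DD"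
  shows "eta (rE e a) t = eta e (D.lm a t)"
  by (rule D.AF.additive_ext[OF EB_ab eta_additive additive_compose[OF D.lm_additive eta_additive] assms(3)])
    (use assms in \<open>simp_all add: eta_pure rE_mult D.lm_pure\<close>)

lemma eta_rm:
  assumes "e \<in> carrier E" "t \<in> carrier DD" "\<beta> \<in> carrier B"
  shows "tens_lift EBt (\<lambda>\<alpha> b. kpure k E B (rE e \<alpha>) (b \<otimes>\<^bsub>B\<^esub> \<beta>)) t = eta e (D.rm t \<beta>)"
proof (rule D.AF.lift_unique[OF EB_ab _ additive_compose[OF D.rm_additive eta_additive] assms(2)])
  show "kbalanced k A B EBt (\<lambda>\<alpha> b. kpure k E B (rE e \<alpha>) (b \<otimes>\<^bsub>B\<^esub> \<beta>))"
    by (rule balancedI)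
      (use assms in \<open>simp_all add: rE_add_right rE_smult_right EB.pure_add_left EB.pure_add_right EB.pure_balanced
        D.rF_smult_left UB.A.l_distr D.rF_add_left\<close>)
qed (use assms in \<open>simp_all add: D.rm_pure eta_pure\<close>)

lemma D_act_smult:
  assumes "c \<in> carrier k" "u \<in> carrier DD" "t \<in> carrier DD"
  shows "D.act (c \<odot>\<^bsub>DD\<^esub> u) t = c \<odot>\<^bsub>DD\<^esub> D.act u t"
proof -
  have c: "c \<odot>\<^bsub>A\<^esub> \<one>\<^bsub>A\<^esub> \<in> carrier A" using assms(1) by simp
  \<comment> \<open>A scalar acts as left multiplication by c1 in A, and left multiplication
    commutes with the twisted product.\<close>
  have "c \<odot>\<^bsub>DD\<^esub> s = D.lm (c \<odot>\<^bsub>A\<^esub> \<one>\<^bsub>A\<^esub>) s" if "s \<in> carrier DD" for s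
    using that assms(1) D.AF.ksmult_closed by (simp add: D.lm_smult)
  then show ?thesis using assms c by (simp add: D.act_lm)
qed

definition actE where "actE u d = tens_lift EBt (\<lambda>e b.
    tens_lift EBt (\<lambda>\<alpha> \<beta>. tens_lift EBt (\<lambda>\<alpha>R bR. kpure k E B (rE e \<alpha>R) (bR \<otimes>\<^bsub>B\<^esub> \<beta>)) (R (kpure k B A b \<alpha>))) d) u"

lemma actE_bal:
  assumes "d \<in> carrier DD"
  shows "kbalanced k E B EBt (\<lambda>e b. eta e (D.act (D.q \<one>\<^bsub>A\<^esub> b) d))"
proof (rule balancedI)
  fix e c b assume h: "e \<in> carrier E" "c \<in> carrier k" "b \<in> carrier B"
  have "D.q \<one>\<^bsub>A\<^esub> (c \<odot>\<^bsub>B\<^esub> b) = c \<odot>\<^bsub>DD\<^esub> D.q \<one>\<^bsub>A\<^esub> b"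
    using h by (simp add: D.AF.ksmult_pure D.AF.pure_balanced)
  then show "eta (c \<odot>\<^bsub>E\<^esub> e) (D.act (D.q \<one>\<^bsub>A\<^esub> b) d) = eta e (D.act (D.q \<one>\<^bsub>A\<^esub> (c \<odot>\<^bsub>B\<^esub> b)) d)"
    using h assms by (simp add: D_act_smult eta_smult)
qed (use assms in \<open>simp_all add: eta_add_left D.AF.pure_add_right D.act_add_left additive_add[OF eta_additive]\<close>)

text \<open>The action is rewritten as (e \<otimes> b) \<cdot> d = (e \<otimes> 1) \<cdot> ((1
  \<otimes> b) d). All twisting then happens inside the algebra, from which the module axioms are
  inherited.\<close>

lemma actE_inner:
  assumes "e \<in> carrier E" "b \<in> carrier B" "d \<in> carrier DD"
  shows "tens_lift EBt (\<lambda>\<alpha> \<beta>. tens_lift EBt (\<lambda>\<alpha>R bR. kpure k E B (rE e \<alpha>R) (bR \<otimes>\<^bsub>B\<^esub> \<beta>)) (R (kpure k B A b \<alpha>))) d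
    = eta e (D.act (D.q \<one>\<^bsub>A\<^esub> b) d)"
proof -
  have "tens_lift EBt (\<lambda>\<alpha> \<beta>. tens_lift EBt (\<lambda>\<alpha>R bR. kpure k E B (rE e \<alpha>R) (bR \<otimes>\<^bsub>B\<^esub> \<beta>)) (R (kpure k B A b \<alpha>))) d
    = tens_lift EBt (\<lambda>\<alpha> \<beta>. eta e (D.lm \<one>\<^bsub>A\<^esub> (D.rm (D.\<rho> b \<alpha>) \<beta>))) d"
    by (rule D.AF.lift_cong[OF EB_ab assms(3)]) (use assms in \<open>simp_all add: eta_rm\<close>)
  also have "\<dots> = eta e (tens_lift DD (\<lambda>\<alpha> \<beta>. D.lm \<one>\<^bsub>A\<^esub> (D.rm (D.\<rho> b \<alpha>) \<beta>)) d)"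
    by (rule D.AF.lift_push[OF D.AF_ab EB_ab eta_additive assms(3), symmetric]) (use assms in simp_all)
  also have "\<dots> = eta e (D.act (D.q \<one>\<^bsub>A\<^esub> b) d)"
    using assms by (simp only: D.act_pure_left UA.A.one_closed)
  finally show ?thesis .
qed

lemma actE_eq:
  assumes "u \<in> carrier EBt" "d \<in> carrier DD"
  shows "actE u d = tens_lift EBt (\<lambda>e b. eta e (D.act (D.q \<one>\<^bsub>A\<^esub> b) d)) u"
  unfolding actE_def by (rule EB.lift_cong[OF EB_ab assms(1)]) (use assms in \<open>simp_all add: actE_inner\<close>)

lemma actE_additive_left: "d \<in> carrier DD \<Longrightarrow> additive EBt EBt (\<lambda>u. actE u d)"
  by (rule additive_cong[OF EB.lift_additive[OF EB_ab actE_bal] EB_ab actE_eq])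

lemma actE_pure:
  assumes "e \<in> carrier E" "b \<in> carrier B" "d \<in> carrier DD"
  shows "actE (kpure k E B e b) d = eta e (D.act (D.q \<one>\<^bsub>A\<^esub> b) d)"
  using EB.lift_pure[OF EB_ab actE_bal[OF assms(3)] assms(1,2)] assms by (simp add: actE_eq)

lemma actE_closed [simp]: "u \<in> carrier EBt \<Longrightarrow> d \<in> carrier DD \<Longrightarrow> actE u d \<in> carrier EBt"
  by (rule additive_closed[OF actE_additive_left])

lemma actE_zero: "d \<in> carrier DD \<Longrightarrow> actE \<zero>\<^bsub>EBt\<^esub> d = \<zero>\<^bsub>EBt\<^esub>"
  by (rule additive_zero[OF EB_ab EB_ab actE_additive_left])

lemma D_one_act: "d \<in> carrier DD \<Longrightarrow> D.act (D.q \<one>\<^bsub>A\<^esub> \<one>\<^bsub>B\<^esub>) d = d"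
  by (rule D.AF.additive_ext[OF D.AF_ab D.act_additive_right additive_id])
    (simp_all add: D.act_pure D.\<rho>_one(2) D.rm_pure D.lm_pure)

lemma actE_one: "e \<in> carrier E \<Longrightarrow> d \<in> carrier DD \<Longrightarrow> actE (kpure k E B e \<one>\<^bsub>B\<^esub>) d = eta e d"
  by (simp add: actE_pure D_one_act)

lemma actE_eta:
  assumes "e \<in> carrier E" "y \<in> carrier DD" "x \<in> carrier DD"
  shows "actE (eta e y) x = eta e (D.act y x)"
proof (rule D.AF.additive_ext[OF EB_ab additive_compose[OF eta_additive actE_additive_left]
      additive_compose[OF D.act_additive_left eta_additive] assms(2)])
  fix a b assume h: "a \<in> carrier A" "b \<in> carrier B"
  have "actE (eta e (D.q a b)) x = eta e (D.lm a (D.act (D.q \<one>\<^bsub>A\<^esub> b) x))"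
    using h assms by (simp add: eta_pure actE_pure eta_lm)
  also have "\<dots> = eta e (D.act (D.lm a (D.q \<one>\<^bsub>A\<^esub> b)) x)"
    using h assms by (simp only: D.act_lm D.AF.pure_closed UA.A.one_closed)
  finally show "actE (eta e (D.q a b)) x = eta e (D.act (D.q a b) x)"
    using h by (simp add: D.lm_pure)
qed (use assms in simp_all)

lemma F_act_zero: "d \<in> carrier DD \<Longrightarrow> F.act \<zero>\<^bsub>AFt\<^esub> d = \<zero>\<^bsub>AFt\<^esub>"
  by (rule additive_zero[OF F.AF_ab F.AF_ab F.act_additive_left])

section \<open>The direct sum and its forms\<close>

abbreviation PM where "PM \<equiv> prod_module k A B E F"
abbreviation pact where "pact \<equiv> prod_act k A B R E rE F rF \<tau>"

lemma pact_eq: "pact m d = (actE (fst m) d, F.act (snd m) d)"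
  by (simp add: prod_act_def actE_def twisted_act_def)

lemma PM_simps [simp]:
  "m \<in> carrier PM \<longleftrightarrow> fst m \<in> carrier EBt \<and> snd m \<in> carrier AFt"
  "m \<oplus>\<^bsub>PM\<^esub> m' = (fst m \<oplus>\<^bsub>EBt\<^esub> fst m', snd m \<oplus>\<^bsub>AFt\<^esub> snd m')"
  "\<zero>\<^bsub>PM\<^esub> = (\<zero>\<^bsub>EBt\<^esub>, \<zero>\<^bsub>AFt\<^esub>)"
  by (auto simp: prod_module_def direct_sum_def case_prod_beta' mem_Times_iff)

lemma PM_ab: "abelian_group PM"
  unfolding prod_module_def by (rule direct_sum_abelian[OF EB_ab F.AF_ab])

lemma TA_simps [simp]: "carrier (twisted_algebra k A B R) = carrier DD"
  by (simp add: twisted_algebra_def)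

lemma TC_abelian: "abelian_group TC"
proof (rule abelian_groupI)
  fix x assume "x \<in> carrier TC"
  then show "\<exists>y\<in>carrier TC. y \<oplus>\<^bsub>TC\<^esub> x = \<zero>\<^bsub>TC\<^esub>"
    by (intro bexI[of _ "\<ominus>\<^bsub>W\<^esub> x"]) (simp_all add: W.AF.MN.l_neg)
qed (simp_all add: W.AF.MN.a_ac)

sublocale T: form_space "twisted_algebra k A B R" TC PM pact
proof (intro form_space.intro form_space_axioms.intro)
  show "abelian_group PM" by (rule PM_ab)
  show "abelian_group TC" by (rule TC_abelian)
qed (simp_all add: pact_eq W.act_add_left W.act_add_right W.act_assoc)

lemma pforms_eq: "prod_forms k A B R Rt E rE F rF \<tau> = T.FT"
  by (simp add: prod_forms_def)

lemma pfpure_eq: "prod_fpure k A B R Rt E rE F rF \<tau> m \<phi> \<omega> = T.fp m (w \<phi> \<omega>)"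
  by (simp add: prod_fpure_def)

end

text \<open>Reads an additive map back from its values on pure tensors. It is meant for maps such as
  \<open>\<kappa>\<close>, which go through \<open>\<sigma>\<close> and have no explicit formula at
  a \<otimes> f.\<close>

lemma (in tensor) lift_comp_pure:
  fixes U :: "('k, 'u, 'z) module_scheme"
  assumes "abelian_group U" "additive MN U \<phi>"
  shows "balanced S M r N l U (\<lambda>m n. \<phi> (pure m n))"
    and "t \<in> carrier MN \<Longrightarrow> tens_lift U (\<lambda>m n. \<phi> (pure m n)) t = \<phi> t"
proof -
  show bal: "balanced S M r N l U (\<lambda>m n. \<phi> (pure m n))"
    by (rule balancedI)
      (simp_all add: additive_closed[OF assms(2)] additive_add[OF assms(2)] pure_add_left pure_add_right pure_balanced)
  show "t \<in> carrier MN \<Longrightarrow> tens_lift U (\<lambda>m n. \<phi> (pure m n)) t = \<phi> t"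
    by (rule lift_unique[OF assms(1) bal assms(2)]) simp_all
qed

section \<open>The product connection\<close>

locale connection_setting = product_setting k A B R Rt E rE F rF \<tau>
  for k :: "('k, 'z) ring_scheme" and A :: "('k, 'a, 'x) module_scheme" and B :: "('k, 'b, 'y) module_scheme"
    and R :: "('b, 'a) tensor \<Rightarrow> ('a, 'b) tensor"
    and Rt :: "(('k, 'b) uform, ('k, 'a) uform) tensor \<Rightarrow> (('k, 'a) uform, ('k, 'b) uform) tensor"
    and E :: "('k, 'e, 'u) module_scheme" and rE :: "'e \<Rightarrow> 'a \<Rightarrow> 'e"
    and F :: "('k, 'f, 'v) module_scheme" and rF :: "'f \<Rightarrow> 'b \<Rightarrow> 'f"
    and \<tau> :: "('f, 'a) tensor \<Rightarrow> ('a, 'f) tensor" +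
  fixes nabE :: "'e \<Rightarrow> ('e, ('k, 'a) uform) tensor" and nabF :: "'f \<Rightarrow> ('f, ('k, 'b) uform) tensor"
  assumes E_conn: "right_connection k A (universal_calculus k A) E rE nabE"
    and F_conn: "right_connection k B (universal_calculus k B) F rF nabF"
    and compat: "twisting_compatible k A B Rt F rF \<tau> nabF"
begin

sublocale FE: connection A WA E rE nabE
  by (rule UA.connection_universal[OF E_mod E_conn])

sublocale FF: connection B WB F rF nabF
  by (rule UB.connection_universal[OF F.F_mod F_conn])

section \<open>Generators, and the relations between their tensors with forms\<close>

abbreviation gE where "gE e \<equiv> elemE k A B E F e \<one>\<^bsub>B\<^esub>"
abbreviation eF where "eF \<equiv> elemF k A B E F"
abbreviation gF where "gF \<equiv> elemF k A B E F \<one>\<^bsub>A\<^esub>"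
abbreviation TT where "TT \<equiv> T.FT"
abbreviation oA where "oA \<equiv> \<one>\<^bsub>universal_calculus k A\<^esub>"
abbreviation oB where "oB \<equiv> \<one>\<^bsub>universal_calculus k B\<^esub>"

lemmas T_ab = T.FT_ab

declare PM_simps [simp del]

lemma gE_closed [simp]: "e \<in> carrier E \<Longrightarrow> gE e \<in> carrier PM"
  by (simp add: elemE_def PM_simps)

lemma eF_closed [simp]: "a \<in> carrier A \<Longrightarrow> f \<in> carrier F \<Longrightarrow> eF a f \<in> carrier PM"
  by (simp add: elemF_def PM_simps)

lemma gE_add: "e \<in> carrier E \<Longrightarrow> e' \<in> carrier E \<Longrightarrow> gE (e \<oplus>\<^bsub>E\<^esub> e') = gE e \<oplus>\<^bsub>PM\<^esub> gE e'"
  by (simp add: elemE_def EB.pure_add_left PM_simps)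

lemma eF_add_left: "a \<in> carrier A \<Longrightarrow> a' \<in> carrier A \<Longrightarrow> f \<in> carrier F \<Longrightarrow> eF (a \<oplus>\<^bsub>A\<^esub> a') f = eF a f \<oplus>\<^bsub>PM\<^esub> eF a' f"
  by (simp add: elemF_def F.AF.pure_add_left PM_simps)

lemma eF_add_right: "a \<in> carrier A \<Longrightarrow> f \<in> carrier F \<Longrightarrow> f' \<in> carrier F \<Longrightarrow> eF a (f \<oplus>\<^bsub>F\<^esub> f') = eF a f \<oplus>\<^bsub>PM\<^esub> eF a f'"
  by (simp add: elemF_def F.AF.pure_add_right PM_simps)

lemma pact_gE: "e \<in> carrier E \<Longrightarrow> x \<in> carrier DD \<Longrightarrow> pact (gE e) x = (eta e x, \<zero>\<^bsub>AFt\<^esub>)"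
  by (simp add: pact_eq elemE_def actE_one F_act_zero)

lemma pact_eF: "a \<in> carrier A \<Longrightarrow> f \<in> carrier F \<Longrightarrow> x \<in> carrier DD \<Longrightarrow> pact (eF a f) x = (\<zero>\<^bsub>EBt\<^esub>, F.act (F.q a f) x)"
  by (simp add: pact_eq elemF_def actE_zero)

lemma gE_rE: "e \<in> carrier E \<Longrightarrow> a \<in> carrier A \<Longrightarrow> gE (rE e a) = pact (gE e) (D.q a \<one>\<^bsub>B\<^esub>)"
  by (simp add: pact_gE eta_pure) (simp add: elemE_def)

lemma eF_rF: "a \<in> carrier A \<Longrightarrow> f \<in> carrier F \<Longrightarrow> b \<in> carrier B \<Longrightarrow> eF a (rF f b) = pact (eF a f) (D.q \<one>\<^bsub>A\<^esub> b)"
  by (simp add: pact_eF F.act_one_right F.rm_pure) (simp add: elemF_def)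

lemma gF_tw: "f \<in> carrier F \<Longrightarrow> a \<in> carrier A \<Longrightarrow> (\<zero>\<^bsub>EBt\<^esub>, F.tw f a) = pact (gF f) (D.q a \<one>\<^bsub>B\<^esub>)"
  by (simp add: pact_eF F.act_gen)

text \<open>The scalar c as an element of the twisted tensor product. The relations of the tensor
  product over that algebra mention only its own elements, so this is how a scalar crosses from the
  module to the forms.\<close>

abbreviation cD where "cD c \<equiv> D.q (c \<odot>\<^bsub>A\<^esub> \<one>\<^bsub>A\<^esub>) \<one>\<^bsub>B\<^esub>"

lemma gE_smult: "c \<in> carrier k \<Longrightarrow> e \<in> carrier E \<Longrightarrow> gE (c \<odot>\<^bsub>E\<^esub> e) = pact (gE e) (cD c)"
  by (simp add: pact_gE eta_pure rE_smult_right rE_one) (simp add: elemE_def)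

lemma eF_smult_swap: "c \<in> carrier k \<Longrightarrow> a \<in> carrier A \<Longrightarrow> f \<in> carrier F \<Longrightarrow> eF (c \<odot>\<^bsub>A\<^esub> a) f = eF a (c \<odot>\<^bsub>F\<^esub> f)"
  by (simp add: elemF_def F.AF.pure_balanced)

lemma gF_smult: "c \<in> carrier k \<Longrightarrow> f \<in> carrier F \<Longrightarrow> gF (c \<odot>\<^bsub>F\<^esub> f) = pact (gF f) (cD c)"
  by (simp add: pact_eF F.act_gen F.tw_smult F.tw_one F.AF.ksmult_pure F.AF.pure_balanced) (simp add: elemF_def)

lemma wm_left: "\<phi> \<in> carrier WA \<Longrightarrow> \<psi> \<in> carrier WA \<Longrightarrow> \<omega> \<in> carrier WB \<Longrightarrow>
    wm (w \<phi> oB) (w \<psi> \<omega>) = w (\<phi> \<otimes>\<^bsub>WA\<^esub> \<psi>) \<omega>"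
  by (simp add: W.act_pure W.\<rho>_one(2) W.rm_pure W.lm_pure)

lemma wm_right: "\<phi> \<in> carrier WA \<Longrightarrow> \<eta> \<in> carrier WB \<Longrightarrow> \<omega> \<in> carrier WB \<Longrightarrow>
    wm (w \<phi> \<eta>) (w oA \<omega>) = w \<phi> (\<eta> \<otimes>\<^bsub>WB\<^esub> \<omega>)"
  by (simp add: W.act_pure W.\<rho>_one(1) W.rm_pure W.lm_pure)

lemma iD_left: "a \<in> carrier A \<Longrightarrow> iD (D.q a \<one>\<^bsub>B\<^esub>) = w (iA a) oB"
  by (simp add: iD_pure UB.incl_one)

lemma iD_right: "b \<in> carrier B \<Longrightarrow> iD (D.q \<one>\<^bsub>A\<^esub> b) = w oA (iB b)"
  by (simp add: iD_pure UA.incl_one)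

lemma fp_gE_rE:
  assumes "e \<in> carrier E" "a \<in> carrier A" "\<phi> \<in> carrier WA" "\<eta> \<in> carrier WB"
  shows "T.fp (gE (rE e a)) (w \<phi> \<eta>) = T.fp (gE e) (w (iA a \<otimes>\<^bsub>WA\<^esub> \<phi>) \<eta>)"
  unfolding gE_rE[OF assms(1,2)]
  using T.fp_act[of "gE e" "D.q a \<one>\<^bsub>B\<^esub>" "w \<phi> \<eta>"] assms by (simp add: iD_left wm_left)

lemma fp_eF_rF:
  assumes "a \<in> carrier A" "f \<in> carrier F" "b \<in> carrier B" "x \<in> carrier W"
  shows "T.fp (eF a (rF f b)) x = T.fp (eF a f) (wm (w oA (iB b)) x)"
  unfolding eF_rF[OF assms(1-3)]
  using T.fp_act[of "eF a f" "D.q \<one>\<^bsub>A\<^esub> b" x] assms by (simp add: iD_right)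

lemma fp_gF_tw:
  assumes "f \<in> carrier F" "a \<in> carrier A" "\<phi> \<in> carrier WA" "\<eta> \<in> carrier WB"
  shows "T.fp (\<zero>\<^bsub>EBt\<^esub>, F.tw f a) (w \<phi> \<eta>) = T.fp (gF f) (w (iA a \<otimes>\<^bsub>WA\<^esub> \<phi>) \<eta>)"
  unfolding gF_tw[OF assms(1,2)]
  using T.fp_act[of "gF f" "D.q a \<one>\<^bsub>B\<^esub>" "w \<phi> \<eta>"] assms by (simp add: iD_left wm_left)

lemma wm_cD:
  assumes "c \<in> carrier k" "\<phi> \<in> carrier WA" "\<eta> \<in> carrier WB"
  shows "wm (iD (cD c)) (w \<phi> \<eta>) = w (c \<odot>\<^bsub>WA\<^esub> \<phi>) \<eta>"
  using assms by (simp add: iD_left wm_left UA.incl_smult UA.incl_one UA.W_smult)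

lemma fp_gE_smult:
  assumes "c \<in> carrier k" "e \<in> carrier E" "\<phi> \<in> carrier WA" "\<eta> \<in> carrier WB"
  shows "T.fp (gE (c \<odot>\<^bsub>E\<^esub> e)) (w \<phi> \<eta>) = T.fp (gE e) (w (c \<odot>\<^bsub>WA\<^esub> \<phi>) \<eta>)"
  unfolding gE_smult[OF assms(1,2)]
  using T.fp_act[of "gE e" "cD c" "w \<phi> \<eta>"] assms by (simp add: wm_cD)

lemma fp_gF_smult:
  assumes "c \<in> carrier k" "f \<in> carrier F" "\<phi> \<in> carrier WA" "\<eta> \<in> carrier WB"
  shows "T.fp (gF (c \<odot>\<^bsub>F\<^esub> f)) (w \<phi> \<eta>) = T.fp (gF f) (w (c \<odot>\<^bsub>WA\<^esub> \<phi>) \<eta>)"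
  unfolding gF_smult[OF assms(1,2)]
  using T.fp_act[of "gF f" "cD c" "w \<phi> \<eta>"] assms by (simp add: wm_cD)

lemma Tfp_add_left: "m \<in> carrier PM \<Longrightarrow> m' \<in> carrier PM \<Longrightarrow> x \<in> carrier W \<Longrightarrow>
    T.fp (m \<oplus>\<^bsub>PM\<^esub> m') x = T.fp m x \<oplus>\<^bsub>TT\<^esub> T.fp m' x"
  using T.pure_add_left by simp

lemma Tfp_add_right: "m \<in> carrier PM \<Longrightarrow> x \<in> carrier W \<Longrightarrow> y \<in> carrier W \<Longrightarrow>
    T.fp m (x \<oplus>\<^bsub>W\<^esub> y) = T.fp m x \<oplus>\<^bsub>TT\<^esub> T.fp m y"
  using T.pure_add_right by simp

lemma Tfp_closed [simp]: "m \<in> carrier PM \<Longrightarrow> x \<in> carrier W \<Longrightarrow> T.fp m x \<in> carrier TT"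
  using T.pure_closed by simp

lemma Tfp_additive_right: "m \<in> carrier PM \<Longrightarrow> additive W TT (T.fp m)"
  by (rule additiveI) (simp_all add: Tfp_add_right)

lemma Tfact_pure: "m \<in> carrier PM \<Longrightarrow> x \<in> carrier W \<Longrightarrow> y \<in> carrier W \<Longrightarrow>
    T.fact (T.fp m x) y = T.fp m (wm x y)"
  using T.fact_pure by simp

lemma Tfact_closed [simp]: "t \<in> carrier TT \<Longrightarrow> x \<in> carrier W \<Longrightarrow> T.fact t x \<in> carrier TT"
  using T.fact_closed by simp

lemma Tfact_additive: "x \<in> carrier W \<Longrightarrow> additive TT TT (\<lambda>t. T.fact t x)"
  using T.fact_additive by simp

lemma Tfact_add_right: "t \<in> carrier TT \<Longrightarrow> x \<in> carrier W \<Longrightarrow> y \<in> carrier W \<Longrightarrow>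
    T.fact t (x \<oplus>\<^bsub>W\<^esub> y) = T.fact t x \<oplus>\<^bsub>TT\<^esub> T.fact t y"
  using T.fact_add_right by simp

lemma Tfact_additive_right: "t \<in> carrier TT \<Longrightarrow> additive W TT (T.fact t)"
  by (rule additiveI) (simp_all add: Tfact_add_right)

lemma Tfact_fact: "t \<in> carrier TT \<Longrightarrow> x \<in> carrier W \<Longrightarrow> y \<in> carrier W \<Longrightarrow>
    T.fact (T.fact t x) y = T.fact t (wm x y)"
  using T.fact_fact by simp

lemmas Tfact_add_left = additive_add[OF Tfact_additive]

text \<open>The inclusion of E-valued forms followed by right multiplication by an arbitrary form
  \<eta> on B. At \<eta> = b it is the map in the statement; at \<eta> = db it is the cross term of
  the curvature.\<close>

definition iE where "iE \<eta> t = tens_lift TT (\<lambda>e \<omega>. T.fp (gE e) (w \<omega> \<eta>)) t"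

lemma iE_bal: "\<eta> \<in> carrier WB \<Longrightarrow>
    balanced (carrier A) E rE WA (\<lambda>x w. iA x \<otimes>\<^bsub>WA\<^esub> w) TT (\<lambda>e \<omega>. T.fp (gE e) (w \<omega> \<eta>))"
  by (rule balancedI)
    (simp_all add: gE_add Tfp_add_left Tfp_add_right W.AF.pure_add_left fp_gE_rE)

lemma iE_additive: "\<eta> \<in> carrier WB \<Longrightarrow> additive FE.FT TT (iE \<eta>)"
  unfolding iE_def[abs_def] by (rule FE.lift_additive[OF T_ab iE_bal])

lemma iE_pure: "\<eta> \<in> carrier WB \<Longrightarrow> e \<in> carrier E \<Longrightarrow> \<omega> \<in> carrier WA \<Longrightarrow> iE \<eta> (FE.fp e \<omega>) = T.fp (gE e) (w \<omega> \<eta>)"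
  unfolding iE_def by (rule FE.lift_pure[OF T_ab iE_bal])

lemma iE_closed [simp]: "\<eta> \<in> carrier WB \<Longrightarrow> t \<in> carrier FE.FT \<Longrightarrow> iE \<eta> t \<in> carrier TT"
  by (rule additive_closed[OF iE_additive])

lemma iE_fact:
  assumes "\<eta> \<in> carrier WB" "t \<in> carrier FE.FT" "\<omega> \<in> carrier WA"
  shows "iE \<eta> (FE.fact t \<omega>) = T.fact (iE oB t) (w \<omega> \<eta>)"
  by (rule FE.additive_ext[OF T_ab additive_compose[OF FE.fact_additive iE_additive]
        additive_compose[OF iE_additive Tfact_additive] assms(2)])
    (use assms in \<open>simp_all add: FE.fact_pure iE_pure Tfact_pure wm_left\<close>)

lemma iE_eq:
  assumes "\<eta> \<in> carrier WB" "t \<in> carrier FE.FT"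
  shows "iE \<eta> t = T.fact (iE oB t) (w oA \<eta>)"
  by (rule FE.additive_ext[OF T_ab iE_additive
        additive_compose[OF iE_additive Tfact_additive] assms(2)])
    (use assms in \<open>simp_all add: iE_pure Tfact_pure wm_left\<close>)

lemma iE_add_left:
  assumes "\<eta> \<in> carrier WB" "\<eta>' \<in> carrier WB" "t \<in> carrier FE.FT"
  shows "iE (\<eta> \<oplus>\<^bsub>WB\<^esub> \<eta>') t = iE \<eta> t \<oplus>\<^bsub>TT\<^esub> iE \<eta>' t"
  using assms iE_eq[OF UB.W.a_closed[OF assms(1,2)] assms(3)]
  by (simp add: iE_eq[OF assms(1,3)] iE_eq[OF assms(2,3)] W.AF.pure_add_right Tfact_add_right)

lemma iE_smult:
  assumes "c \<in> carrier k" "\<eta> \<in> carrier WB" "t \<in> carrier FE.FT"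
  shows "iE \<eta> (c \<odot>\<^bsub>FE.FT\<^esub> t) = iE (c \<odot>\<^bsub>WB\<^esub> \<eta>) t"
  unfolding iE_def
  by (rule FE.lift_smult[OF E.smult_additive_module _ T_ab iE_bal iE_bal])
    (use assms in \<open>simp_all add: rE_smult_left fp_gE_smult W.AF.pure_balanced\<close>)

lemma inclE_eq: "inclE_act k A B R Rt E rE F rF \<tau> t b = iE (iB b) t"
  by (simp add: inclE_act_def iE_def pforms_eq pfpure_eq)

lemma nabE_smult: "c \<in> carrier k \<Longrightarrow> e \<in> carrier E \<Longrightarrow> nabE (c \<odot>\<^bsub>E\<^esub> e) = c \<odot>\<^bsub>FE.FT\<^esub> nabE e"
  using E_conn unfolding right_connection_def linear_over_def by blast

lemma nabF_smult: "c \<in> carrier k \<Longrightarrow> f \<in> carrier F \<Longrightarrow> nabF (c \<odot>\<^bsub>F\<^esub> f) = c \<odot>\<^bsub>FF.FT\<^esub> nabF f"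
  using F_conn unfolding right_connection_def linear_over_def by blast

lemmas nabE_add = additive_add[OF FE.nab_additive]
lemmas nabF_add = additive_add[OF FF.nab_additive]

section \<open>The first summand of the connection\<close>

definition nab1 where "nab1 u = tens_lift TT (\<lambda>e b. iE (iB b) (nabE e) \<oplus>\<^bsub>TT\<^esub> T.fp (gE e) (w oA (dB (iB b)))) u"

lemma nab1_bal: "kbalanced k E B TT (\<lambda>e b. iE (iB b) (nabE e) \<oplus>\<^bsub>TT\<^esub> T.fp (gE e) (w oA (dB (iB b))))"
proof (rule balancedI)
  fix m m' n assume "m \<in> carrier E" "m' \<in> carrier E" "n \<in> carrier B"
  then show "iE (iB n) (nabE (m \<oplus>\<^bsub>E\<^esub> m')) \<oplus>\<^bsub>TT\<^esub> T.fp (gE (m \<oplus>\<^bsub>E\<^esub> m')) (w oA (dB (iB n))) =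
      (iE (iB n) (nabE m) \<oplus>\<^bsub>TT\<^esub> T.fp (gE m) (w oA (dB (iB n)))) \<oplus>\<^bsub>TT\<^esub>
      (iE (iB n) (nabE m') \<oplus>\<^bsub>TT\<^esub> T.fp (gE m') (w oA (dB (iB n))))"
    by (simp add: nabE_add additive_add[OF iE_additive] gE_add Tfp_add_left T.MN.a_ac)
next
  fix m n n' assume "m \<in> carrier E" "n \<in> carrier B" "n' \<in> carrier B"
  then show "iE (iB (n \<oplus>\<^bsub>B\<^esub> n')) (nabE m) \<oplus>\<^bsub>TT\<^esub> T.fp (gE m) (w oA (dB (iB (n \<oplus>\<^bsub>B\<^esub> n')))) =
      (iE (iB n) (nabE m) \<oplus>\<^bsub>TT\<^esub> T.fp (gE m) (w oA (dB (iB n)))) \<oplus>\<^bsub>TT\<^esub>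
      (iE (iB n') (nabE m) \<oplus>\<^bsub>TT\<^esub> T.fp (gE m) (w oA (dB (iB n'))))"
    by (simp add: UB.incl_add UB.dif_add iE_add_left W.AF.pure_add_right Tfp_add_right T.MN.a_ac)
next
  fix e c b assume "e \<in> carrier E" "c \<in> carrier k" "b \<in> carrier B"
  then show "iE (iB b) (nabE (c \<odot>\<^bsub>E\<^esub> e)) \<oplus>\<^bsub>TT\<^esub> T.fp (gE (c \<odot>\<^bsub>E\<^esub> e)) (w oA (dB (iB b))) =
      iE (iB (c \<odot>\<^bsub>B\<^esub> b)) (nabE e) \<oplus>\<^bsub>TT\<^esub> T.fp (gE e) (w oA (dB (iB (c \<odot>\<^bsub>B\<^esub> b))))"
    by (simp add: nabE_smult iE_smult UB.incl_smult UB.dif_smult fp_gE_smult W.AF.pure_balanced)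
qed simp

lemma nab1_additive: "additive EBt TT nab1"
  unfolding nab1_def[abs_def] by (rule EB.lift_additive[OF T_ab nab1_bal])

lemma nab1_pure: "e \<in> carrier E \<Longrightarrow> b \<in> carrier B \<Longrightarrow>
    nab1 (kpure k E B e b) = iE (iB b) (nabE e) \<oplus>\<^bsub>TT\<^esub> T.fp (gE e) (w oA (dB (iB b)))"
  unfolding nab1_def by (rule EB.lift_pure[OF T_ab nab1_bal])

lemma nab1_closed [simp]: "u \<in> carrier EBt \<Longrightarrow> nab1 u \<in> carrier TT"
  by (rule additive_closed[OF nab1_additive])

text \<open>At y = a \<otimes> b the Leibniz rule of \<nabla> on E, applied to ea, contributes e
  \<otimes> da; together with the term of ea \<otimes> db this completes d(a \<otimes> b).\<close>

lemma nab1_eta: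
  assumes "e \<in> carrier E" "y \<in> carrier DD"
  shows "nab1 (eta e y) = T.fact (iE oB (nabE e)) (iD y) \<oplus>\<^bsub>TT\<^esub> T.fp (gE e) (dW (iD y))"
proof (rule D.AF.additive_ext[OF T_ab additive_compose[OF eta_additive nab1_additive]
      additive_plus[OF T_ab additive_compose[OF iD_additive Tfact_additive_right]
        additive_compose[OF iD_additive additive_compose[OF dW_additive Tfp_additive_right]]] assms(2)])
  fix a b assume h: "a \<in> carrier A" "b \<in> carrier B"
  have "nab1 (eta e (D.q a b)) = iE (iB b) (nabE (rE e a)) \<oplus>\<^bsub>TT\<^esub> T.fp (gE (rE e a)) (w oA (dB (iB b)))"
    using h assms by (simp add: eta_pure nab1_pure)
  also have "iE (iB b) (nabE (rE e a)) =
      T.fact (iE oB (nabE e)) (w (iA a) (iB b)) \<oplus>\<^bsub>TT\<^esub> T.fp (gE e) (w (dA (iA a)) (iB b))"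
    using h assms by (simp add: FE.nab_act additive_add[OF iE_additive] iE_fact iE_pure)
  also have "T.fp (gE (rE e a)) (w oA (dB (iB b))) = T.fp (gE e) (w (iA a) (dB (iB b)))"
    using h assms by (simp add: fp_gE_rE)
  finally show "nab1 (eta e (D.q a b)) =
      T.fact (iE oB (nabE e)) (iD (D.q a b)) \<oplus>\<^bsub>TT\<^esub> T.fp (gE e) (dW (iD (D.q a b)))"
    using h assms by (simp add: iD_pure dW_pure Tfp_add_right T.MN.a_assoc)
qed (use assms in simp_all)

lemma eta_gen: "e \<in> carrier E \<Longrightarrow> b \<in> carrier B \<Longrightarrow> kpure k E B e b = eta e (D.q \<one>\<^bsub>A\<^esub> b)"
  by (simp add: eta_pure rE_one)

lemma fp_gen_act:
  assumes "m \<in> carrier PM" "y \<in> carrier DD" "x \<in> carrier W"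
  shows "T.fp (pact m y) x = T.fp m (wm (iD y) x)"
  using T.fp_act[of m y x] assms by simp

lemma inl_inr_closed: "u \<in> carrier EBt \<Longrightarrow> (u, \<zero>\<^bsub>AFt\<^esub>) \<in> carrier PM" "v \<in> carrier AFt \<Longrightarrow> (\<zero>\<^bsub>EBt\<^esub>, v) \<in> carrier PM"
  by (simp_all add: PM_simps(1))

lemma Tfp_inl_additive: "x \<in> carrier W \<Longrightarrow> additive EBt TT (\<lambda>u. T.fp (u, \<zero>\<^bsub>AFt\<^esub>) x)"
  using Tfp_add_left[of "(u, \<zero>\<^bsub>AFt\<^esub>)" "(v, \<zero>\<^bsub>AFt\<^esub>)" x for u v]
  by (intro additiveI) (simp_all add: inl_inr_closed PM_simps(2))

lemma Tfp_inr_additive: "x \<in> carrier W \<Longrightarrow> additive AFt TT (\<lambda>v. T.fp (\<zero>\<^bsub>EBt\<^esub>, v) x)"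
  using Tfp_add_left[of "(\<zero>\<^bsub>EBt\<^esub>, u)" "(\<zero>\<^bsub>EBt\<^esub>, v)" x for u v]
  by (intro additiveI) (simp_all add: inl_inr_closed PM_simps(2))

text \<open>The Leibniz rule for \<open>\<nabla>(g \<cdot> y) = N \<cdot> y + g \<otimes> dy\<close> amounts to associativity of the action.\<close>

lemma leibniz_from_generator:
  assumes "N \<in> carrier TT" "g \<in> carrier PM" "y \<in> carrier DD" "x \<in> carrier DD"
  shows "T.fact N (iD (D.act y x)) \<oplus>\<^bsub>TT\<^esub> T.fp g (dW (iD (D.act y x))) =
    T.fact (T.fact N (iD y) \<oplus>\<^bsub>TT\<^esub> T.fp g (dW (iD y))) (iD x) \<oplus>\<^bsub>TT\<^esub> T.fp (pact g y) (dW (iD x))"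
  using assms
  by (simp add: iD_mult dW_iD_mult Tfact_add_left Tfact_fact Tfact_pure fp_gen_act Tfp_add_right T.MN.a_assoc)

lemma nab1_act:
  assumes "u \<in> carrier EBt" "x \<in> carrier DD"
  shows "nab1 (actE u x) = T.fact (nab1 u) (iD x) \<oplus>\<^bsub>TT\<^esub> T.fp (u, \<zero>\<^bsub>AFt\<^esub>) (dW (iD x))"
proof (rule EB.additive_ext[OF T_ab additive_compose[OF actE_additive_left nab1_additive]
      additive_plus[OF T_ab additive_compose[OF nab1_additive Tfact_additive] Tfp_inl_additive] assms(1)])
  fix e b assume h: "e \<in> carrier E" "b \<in> carrier B"
  have y: "D.q \<one>\<^bsub>A\<^esub> b \<in> carrier DD" using h by simp
  show "nab1 (actE (kpure k E B e b) x) =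
      T.fact (nab1 (kpure k E B e b)) (iD x) \<oplus>\<^bsub>TT\<^esub> T.fp (kpure k E B e b, \<zero>\<^bsub>AFt\<^esub>) (dW (iD x))"
    using h assms leibniz_from_generator[of "iE oB (nabE e)" "gE e" "D.q \<one>\<^bsub>A\<^esub> b" x] y
    by (simp add: eta_gen actE_eta nab1_eta pact_gE)
qed (use assms in simp_all)

end

section \<open>The second summand of the connection, and the use of compatibility\<close>

context connection_setting
begin

definition LF where "LF a t = tens_lift TT (\<lambda>f \<eta>. T.fp (eF a f) (w oA \<eta>)) t"

lemma LF_bal: "a \<in> carrier A \<Longrightarrow>
    balanced (carrier B) F rF WB (\<lambda>x w. iB x \<otimes>\<^bsub>WB\<^esub> w) TT (\<lambda>f \<eta>. T.fp (eF a f) (w oA \<eta>))"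
  by (rule balancedI)
    (simp_all add: eF_add_right Tfp_add_left Tfp_add_right W.AF.pure_add_right fp_eF_rF wm_right)

lemma LF_additive: "a \<in> carrier A \<Longrightarrow> additive FF.FT TT (LF a)"
  unfolding LF_def[abs_def] by (rule FF.lift_additive[OF T_ab LF_bal])

lemma LF_pure: "a \<in> carrier A \<Longrightarrow> f \<in> carrier F \<Longrightarrow> \<eta> \<in> carrier WB \<Longrightarrow> LF a (FF.fp f \<eta>) = T.fp (eF a f) (w oA \<eta>)"
  unfolding LF_def by (rule FF.lift_pure[OF T_ab LF_bal])

lemma LF_closed [simp]: "a \<in> carrier A \<Longrightarrow> t \<in> carrier FF.FT \<Longrightarrow> LF a t \<in> carrier TT"
  by (rule additive_closed[OF LF_additive])

lemmas LF_add = additive_add[OF LF_additive]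

lemma LF_add_left:
  assumes "a \<in> carrier A" "a' \<in> carrier A" "t \<in> carrier FF.FT"
  shows "LF (a \<oplus>\<^bsub>A\<^esub> a') t = LF a t \<oplus>\<^bsub>TT\<^esub> LF a' t"
  by (rule FF.additive_ext[OF T_ab LF_additive additive_plus[OF T_ab LF_additive LF_additive] assms(3)])
    (use assms in \<open>simp_all add: LF_pure eF_add_left Tfp_add_left\<close>)

lemma FF_smult_pure: "c \<in> carrier k \<Longrightarrow> f \<in> carrier F \<Longrightarrow> \<eta> \<in> carrier WB \<Longrightarrow>
    c \<odot>\<^bsub>FF.FT\<^esub> FF.fp f \<eta> = FF.fp (c \<odot>\<^bsub>F\<^esub> f) \<eta>"
  by (rule FF.smult_pure[OF F.F.smult_additive_module]) (simp_all add: F.rF_smult_left)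

lemma FF_smult_additive: "c \<in> carrier k \<Longrightarrow> additive FF.FT FF.FT (\<lambda>t. c \<odot>\<^bsub>FF.FT\<^esub> t)"
  by (rule FF.smult_additive[OF F.F.smult_additive_module]) (simp_all add: F.rF_smult_left)

lemma LF_smult:
  assumes "c \<in> carrier k" "a \<in> carrier A" "t \<in> carrier FF.FT"
  shows "LF (c \<odot>\<^bsub>A\<^esub> a) t = LF a (c \<odot>\<^bsub>FF.FT\<^esub> t)"
  by (rule FF.additive_ext[OF T_ab LF_additive additive_compose[OF FF_smult_additive LF_additive] assms(3)])
    (use assms in \<open>simp_all add: LF_pure FF_smult_pure eF_smult_swap\<close>)

lemma LF_fact:
  assumes "a \<in> carrier A" "t \<in> carrier FF.FT" "\<eta> \<in> carrier WB"
  shows "LF a (FF.fact t \<eta>) = T.fact (LF a t) (w oA \<eta>)"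
  by (rule FF.additive_ext[OF T_ab additive_compose[OF FF.fact_additive LF_additive]
        additive_compose[OF LF_additive Tfact_additive] assms(2)])
    (use assms in \<open>simp_all add: FF.fact_pure LF_pure Tfact_pure wm_right\<close>)

lemma act_inclF_eq: "act_inclF k A B R Rt E rE F rF \<tau> a t = LF a t"
  by (simp add: act_inclF_def LF_def pforms_eq pfpure_eq)

sublocale AFW: ktensor k A FF.FT
  by unfold_locales (simp_all add: additive_closed[OF FF_smult_additive])

abbreviation \<sigma> where "\<sigma> \<equiv> inv_into (carrier (ktens k F A)) \<tau>"

lemma \<sigma>_\<tau>: "s \<in> carrier (ktens k F A) \<Longrightarrow> \<sigma> (\<tau> s) = s"
  using \<tau>_bij by (simp add: bij_betw_def inv_into_f_f)

lemma \<tau>_\<sigma>: "u \<in> carrier AFt \<Longrightarrow> \<tau> (\<sigma> u) = u"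
  using \<tau>_bij by (simp add: bij_betw_def f_inv_into_f)

lemma \<sigma>_closed [simp]: "u \<in> carrier AFt \<Longrightarrow> \<sigma> u \<in> carrier (ktens k F A)"
  using \<tau>_bij by (metis bij_betw_def inv_into_into)

lemma \<tau>_cases:
  assumes "u \<in> carrier AFt"
  obtains s where "s \<in> carrier (ktens k F A)" "u = \<tau> s"
  using \<tau>_\<sigma>[OF assms] \<sigma>_closed[OF assms] by metis

lemma \<sigma>_additive: "additive AFt (ktens k F A) \<sigma>"
proof (rule additiveI)
  fix x y assume h: "x \<in> carrier AFt" "y \<in> carrier AFt"
  have c: "\<sigma> x \<oplus>\<^bsub>ktens k F A\<^esub> \<sigma> y \<in> carrier (ktens k F A)" using h by simp
  have "\<tau> (\<sigma> x \<oplus>\<^bsub>ktens k F A\<^esub> \<sigma> y) = x \<oplus>\<^bsub>AFt\<^esub> y"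
    using h by (simp add: additive_add[OF F.\<tau>_additive] \<tau>_\<sigma>)
  then show "\<sigma> (x \<oplus>\<^bsub>AFt\<^esub> y) = \<sigma> x \<oplus>\<^bsub>ktens k F A\<^esub> \<sigma> y"
    using \<sigma>_\<tau>[OF c] by simp
qed simp

text \<open>As \<tau> is onto, the elements \<tau>(f \<otimes> a) can replace pure tensors as
  generators. They are the right ones wherever \<open>\<sigma>\<close> occurs, since
  \<open>\<sigma>\<close> sends \<tau>(f \<otimes> a) back to f \<otimes> a.\<close>

lemma tau_ext:
  assumes "abelian_group U" "additive AFt U \<phi>" "additive AFt U \<psi>" "u \<in> carrier AFt"
    and "\<And>f a. f \<in> carrier F \<Longrightarrow> a \<in> carrier A \<Longrightarrow> \<phi> (F.tw f a) = \<psi> (F.tw f a)"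
  shows "\<phi> u = \<psi> u"
proof -
  obtain s where s: "s \<in> carrier (ktens k F A)" "u = \<tau> s" using \<tau>_cases[OF assms(4)] .
  have "\<phi> (\<tau> s) = \<psi> (\<tau> s)"
    by (rule F.FA.additive_ext[OF assms(1) additive_compose[OF F.\<tau>_additive assms(2)]
          additive_compose[OF F.\<tau>_additive assms(3)] s(1)]) (rule assms(5))
  then show ?thesis by (simp add: s(2))
qed

text \<open>The term of \<nabla> at a \<otimes> f that differentiates on the A side, as a function
  of \<open>\<sigma>\<close>(a \<otimes> f) in F \<otimes> A. Composed with \<open>\<sigma>\<close>
  it becomes \<open>\<kappa>\<close>, which is explicit on the elements \<tau>(f \<otimes>
  a).\<close>

definition KF where "KF s = tens_lift TT (\<lambda>f a. T.fp (gF f) (w (dA (iA a)) oB)) s"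

lemma KF_bal: "kbalanced k F A TT (\<lambda>f a. T.fp (gF f) (w (dA (iA a)) oB))"
  by (rule balancedI)
    (simp_all add: eF_add_right Tfp_add_left Tfp_add_right UA.incl_add UA.dif_add W.AF.pure_add_left
      fp_gF_smult UA.incl_smult UA.dif_smult)

lemma KF_additive: "additive (ktens k F A) TT KF"
  unfolding KF_def[abs_def] by (rule F.FA.lift_additive[OF T_ab KF_bal])

lemma KF_pure: "f \<in> carrier F \<Longrightarrow> a \<in> carrier A \<Longrightarrow> KF (kpure k F A f a) = T.fp (gF f) (w (dA (iA a)) oB)"
  unfolding KF_def by (rule F.FA.lift_pure[OF T_ab KF_bal])

abbreviation \<kappa> where "\<kappa> u \<equiv> KF (\<sigma> u)"

lemma \<kappa>_additive: "additive AFt TT (\<lambda>u. \<kappa> u)"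
  by (rule additive_compose[OF \<sigma>_additive KF_additive])

lemma \<kappa>_closed [simp]: "u \<in> carrier AFt \<Longrightarrow> \<kappa> u \<in> carrier TT"
  by (rule additive_closed[OF \<kappa>_additive])

lemma \<kappa>_tw: "f \<in> carrier F \<Longrightarrow> a \<in> carrier A \<Longrightarrow> \<kappa> (F.tw f a) = T.fp (gF f) (w (dA (iA a)) oB)"
  by (simp add: \<sigma>_\<tau> KF_pure)

text \<open>The part of the second summand that comes from \<nabla> on F. It is separated from
  \<open>\<kappa>\<close> because \<open>\<kappa>\<close> is computed by inverting \<tau>, while
  this part is computed from the compatibility condition.\<close>

definition \<nu> where "\<nu> u = tens_lift TT (\<lambda>a f. LF a (nabF f)) u"

lemma \<nu>_bal: "kbalanced k A F TT (\<lambda>a f. LF a (nabF f))"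
  by (rule balancedI) (simp_all add: LF_add_left LF_add nabF_add LF_smult nabF_smult)

lemma \<nu>_additive: "additive AFt TT \<nu>"
  unfolding \<nu>_def[abs_def] by (rule F.AF.lift_additive[OF T_ab \<nu>_bal])

definition nab2 where "nab2 u = tens_lift TT (\<lambda>a f. LF a (nabF f) \<oplus>\<^bsub>TT\<^esub> \<kappa> (F.q a f)) u"

lemma balanced_plus:
  assumes "abelian_group U" "kbalanced k A F U f" "kbalanced k A F U g"
  shows "kbalanced k A F U (\<lambda>m n. f m n \<oplus>\<^bsub>U\<^esub> g m n)"
  using assms unfolding balanced_def by (auto intro: additive_plus)

lemma nab2_bal: "kbalanced k A F TT (\<lambda>a f. LF a (nabF f) \<oplus>\<^bsub>TT\<^esub> \<kappa> (F.q a f))"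
  by (rule balanced_plus[OF T_ab \<nu>_bal F.AF.lift_comp_pure(1)[OF T_ab \<kappa>_additive]])

lemma nab2_additive: "additive AFt TT nab2"
  unfolding nab2_def[abs_def] by (rule F.AF.lift_additive[OF T_ab nab2_bal])

lemma nab2_pure: "a \<in> carrier A \<Longrightarrow> f \<in> carrier F \<Longrightarrow> nab2 (F.q a f) = LF a (nabF f) \<oplus>\<^bsub>TT\<^esub> \<kappa> (F.q a f)"
  unfolding nab2_def by (rule F.AF.lift_pure[OF T_ab nab2_bal])

lemma nab2_closed [simp]: "u \<in> carrier AFt \<Longrightarrow> nab2 u \<in> carrier TT"
  by (rule additive_closed[OF nab2_additive])

lemma nab2_eq: "u \<in> carrier AFt \<Longrightarrow> nab2 u = \<nu> u \<oplus>\<^bsub>TT\<^esub> \<kappa> u"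
  by (rule F.AF.additive_ext[OF T_ab nab2_additive additive_plus[OF T_ab \<nu>_additive \<kappa>_additive]])
    (simp_all add: nab2_pure \<nu>_def F.AF.lift_pure[OF T_ab \<nu>_bal])

text \<open>The additive map induced by \<open>V\<close> is applied to both sides of the
  compatibility condition and moved inward through the nested lifts, one layer at a time. As
  \<open>lift_push\<close> keeps the chosen representatives, the intermediate integrands need only
  have values in the carrier.\<close>

lemma compat_push:
  assumes V: "kbalanced k A FF.FT TT V" and h: "f \<in> carrier F" "a \<in> carrier A"
  shows "tens_lift TT (\<lambda>a' f'. V a' (nabF f')) (F.tw f a) =
    tens_lift TT (\<lambda>f' \<eta>. tens_lift TT (\<lambda>aR \<eta>R. tens_lift TT (\<lambda>a2 f2. V a2 (FF.fp f2 \<eta>R))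
      (F.tw f' (UA.deg0 aR))) (rt \<eta> (iA a))) (nabF f)"
proof -
  let ?X = "ktens k A FF.FT"
  let ?q = "kpure k A FF.FT"
  let ?x = "\<lambda>f' aR \<eta>R. tens_lift ?X (\<lambda>a2 f2. ?q a2 (FF.fp f2 \<eta>R)) (F.tw f' (UA.deg0 aR))"
  let ?v = "\<lambda>f' aR \<eta>R. tens_lift TT (\<lambda>a2 f2. V a2 (FF.fp f2 \<eta>R)) (F.tw f' (UA.deg0 aR))"
  let ?y = "\<lambda>f' \<eta>. tens_lift ?X (?x f') (rt \<eta> (iA a))"
  let ?u = "\<lambda>f' \<eta>. tens_lift TT (?v f') (rt \<eta> (iA a))"
  define \<Lambda> where "\<Lambda> = tens_lift TT V"
  have \<Lambda>: "additive ?X TT \<Lambda>" unfolding \<Lambda>_def by (rule AFW.lift_additive[OF T_ab V])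
  have \<Lambda>_pure: "\<Lambda> (?q a' t) = V a' t" if "a' \<in> carrier A" "t \<in> carrier FF.FT" for a' t
    unfolding \<Lambda>_def by (rule AFW.lift_pure[OF T_ab V that])
  have V_closed: "V a' t \<in> carrier TT" if "a' \<in> carrier A" "t \<in> carrier FF.FT" for a' t
    using additive_closed[OF \<Lambda> AFW.pure_closed[OF that]] \<Lambda>_pure[OF that] by simp
  note X_ab = AFW.MN.abelian_group_axioms
  have eq: "tens_lift ?X (\<lambda>a' f'. ?q a' (nabF f')) (F.tw f a) =
      tens_lift ?X (\<lambda>f' \<eta>. ?y f' \<eta>) (nabF f)"
    using compat h unfolding twisting_compatible_def Let_def by blast
  have c3: "?x f' aR \<eta>R \<in> carrier ?X"
    if "f' \<in> carrier F" "aR \<in> carrier WA" "\<eta>R \<in> carrier WB" for f' aR \<eta>R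
    by (rule F.AF.lift_closed[OF X_ab]) (use that in simp_all)
  have c2: "?y f' \<eta> \<in> carrier ?X"
    if "f' \<in> carrier F" "\<eta> \<in> carrier WB" for f' \<eta>
    by (rule W.AF.lift_closed[OF X_ab]) (use that h c3 in simp_all)
  have p3: "\<Lambda> (?x f' aR \<eta>R) = ?v f' aR \<eta>R"
    if "f' \<in> carrier F" "aR \<in> carrier WA" "\<eta>R \<in> carrier WB" for f' aR \<eta>R
  proof -
    have t: "F.tw f' (UA.deg0 aR) \<in> carrier AFt" using that by simp
    have "\<Lambda> (?x f' aR \<eta>R) =
      tens_lift TT (\<lambda>a2 f2. \<Lambda> (?q a2 (FF.fp f2 \<eta>R))) (F.tw f' (UA.deg0 aR))"
      by (rule F.AF.lift_push[OF X_ab T_ab \<Lambda> t]) (use that in simp)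
    also have "\<dots> = ?v f' aR \<eta>R"
      by (rule F.AF.lift_cong[OF T_ab t]) (use that V_closed in \<open>simp_all add: \<Lambda>_pure\<close>)
    finally show ?thesis .
  qed
  have p2: "\<Lambda> (?y f' \<eta>) = ?u f' \<eta>"
    if "f' \<in> carrier F" "\<eta> \<in> carrier WB" for f' \<eta>
  proof -
    have t: "rt \<eta> (iA a) \<in> carrier W" using that h by simp
    have "\<Lambda> (?y f' \<eta>) =
      tens_lift TT (\<lambda>aR \<eta>R. \<Lambda> (?x f' aR \<eta>R)) (rt \<eta> (iA a))"
      by (rule W.AF.lift_push[OF X_ab T_ab \<Lambda> t]) (rule c3[OF that(1)])
    also have "\<dots> = ?u f' \<eta>"
      by (rule W.AF.lift_cong[OF T_ab t p3[OF that(1)] additive_closed[OF \<Lambda> c3[OF that(1)]]])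
    finally show ?thesis .
  qed
  have "tens_lift TT (\<lambda>a' f'. V a' (nabF f')) (F.tw f a) = tens_lift TT (\<lambda>a' f'. \<Lambda> (?q a' (nabF f'))) (F.tw f a)"
    by (rule F.AF.lift_cong[OF T_ab]) (use h V_closed in \<open>simp_all add: \<Lambda>_pure\<close>)
  also have "\<dots> = \<Lambda> (tens_lift ?X (\<lambda>a' f'. ?q a' (nabF f')) (F.tw f a))"
    by (rule F.AF.lift_push[OF X_ab T_ab \<Lambda>, symmetric]) (use h in simp_all)
  also have "\<dots> = tens_lift TT (\<lambda>f' \<eta>. \<Lambda> (?y f' \<eta>)) (nabF f)"
    unfolding eq by (rule FF.lift_push[OF X_ab T_ab \<Lambda> FF.nab_closed[OF h(1)] c2])
  also have "\<dots> = tens_lift TT (\<lambda>f' \<eta>. ?u f' \<eta>) (nabF f)"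
    by (rule FF.lift_cong[OF T_ab FF.nab_closed[OF h(1)] p2 additive_closed[OF \<Lambda> c2]])
  finally show ?thesis .
qed

lemma lin_incl_deg0: "linear_over k WA WA (\<lambda>x. iA (UA.deg0 x))"
  by (auto simp: linear_over_def UA.deg0_add UA.incl_add UA.deg0_smult UA.incl_smult)

lemma lin_comp: "linear_over k M N f \<Longrightarrow> linear_over k N P g \<Longrightarrow> linear_over k M P (\<lambda>x. g (f x))"
  by (auto simp: linear_over_def Pi_iff)

text \<open>If \<open>V\<close> factors through maps \<psi> that are explicit on \<tau>(f \<otimes>
  a), the inner sum over \<tau> collapses and leaves g applied to the A side of the extended
  twisting. With g the identity this computes \<nabla> at \<tau>(f \<otimes> a); with g = d it
  computes the cross terms.\<close>

lemma compat_eval: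
  assumes V: "kbalanced k A FF.FT TT V" and h: "f \<in> carrier F" "a \<in> carrier A"
    and g: "linear_over k WA WA g" and \<psi>: "\<And>\<eta>. \<eta> \<in> carrier WB \<Longrightarrow> additive AFt TT (\<psi> \<eta>)"
    and V_pure: "\<And>a f \<eta>. a \<in> carrier A \<Longrightarrow> f \<in> carrier F \<Longrightarrow> \<eta> \<in> carrier WB \<Longrightarrow> V a (FF.fp f \<eta>) = \<psi> \<eta> (F.q a f)"
    and \<psi>_tw: "\<And>f a \<eta>. f \<in> carrier F \<Longrightarrow> a \<in> carrier A \<Longrightarrow> \<eta> \<in> carrier WB \<Longrightarrow>
      \<psi> \<eta> (F.tw f a) = T.fp (gF f) (w (g (iA a)) \<eta>)"
  shows "tens_lift TT (\<lambda>a' f'. V a' (nabF f')) (F.tw f a) =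
    tens_lift TT (\<lambda>f' \<eta>. T.fp (gF f') (tmap g idf (rt \<eta> (iA a)))) (nabF f)"
proof -
  note lg = lin_comp[OF lin_incl_deg0 g]
  have g_closed: "g x \<in> carrier WA" if "x \<in> carrier WA" for x
    using g that by (auto simp: linear_over_def)
  have inner: "tens_lift TT (\<lambda>aR \<eta>R. tens_lift TT (\<lambda>a2 f2. V a2 (FF.fp f2 \<eta>R)) (F.tw f' (UA.deg0 aR))) (rt \<eta> (iA a))
      = T.fp (gF f') (tmap g idf (rt \<eta> (iA a)))" (is "?l = _")
    if "f' \<in> carrier F" "\<eta> \<in> carrier WB" for f' \<eta>
  proof -
    have t: "rt \<eta> (iA a) \<in> carrier W" using that h by simp
    have lv: "tens_lift TT (\<lambda>a2 f2. V a2 (FF.fp f2 \<eta>R)) (F.tw f' (UA.deg0 aR)) =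
        T.fp (gF f') (w (g (iA (UA.deg0 aR))) \<eta>R)" if r: "aR \<in> carrier WA" "\<eta>R \<in> carrier WB" for aR \<eta>R
    proof -
      have u: "F.tw f' (UA.deg0 aR) \<in> carrier AFt" using r \<open>f' \<in> carrier F\<close> by simp
      have "tens_lift TT (\<lambda>a2 f2. V a2 (FF.fp f2 \<eta>R)) (F.tw f' (UA.deg0 aR)) =
        tens_lift TT (\<lambda>a2 f2. \<psi> \<eta>R (F.q a2 f2)) (F.tw f' (UA.deg0 aR))"
        by (rule F.AF.lift_cong[OF T_ab u])
          (use r additive_closed[OF \<psi>[OF r(2)]] in \<open>simp_all add: V_pure\<close>)
      also have "\<dots> = \<psi> \<eta>R (F.tw f' (UA.deg0 aR))"
        by (rule F.AF.lift_comp_pure(2)[OF T_ab \<psi>[OF r(2)] u])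
      finally show ?thesis using r \<open>f' \<in> carrier F\<close> by (simp add: \<psi>_tw)
    qed
    have "?l = tens_lift TT (\<lambda>aR \<eta>R. T.fp (gF f') (w (g (iA (UA.deg0 aR))) \<eta>R)) (rt \<eta> (iA a))"
      by (rule W.AF.lift_cong[OF T_ab t]) (use that in \<open>simp_all add: lv g_closed\<close>)
    also have "\<dots> = T.fp (gF f') (tmap (\<lambda>x. g (iA (UA.deg0 x))) idf (rt \<eta> (iA a)))"
      unfolding tmap_def
      by (rule W.AF.lift_push[OF W_ab T_ab Tfp_additive_right t, symmetric]) (use that in \<open>simp_all add: g_closed\<close>)
    \<comment> \<open>By \<open>rt_span_A\<close> the A side has degree zero, where projecting to A
      and including again changes nothing.\<close>
    also have "tmap (\<lambda>x. g (iA (UA.deg0 x))) idf (rt \<eta> (iA a)) = tmap g idf (rt \<eta> (iA a))"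
      by (rule SA_eq[OF W_ab tmap_additive[OF lg lin(1)] tmap_additive[OF g lin(1)] rt_span_A[OF that(2) h(2)]])
        (simp add: tmap_pure[OF lg lin(1)] tmap_pure[OF g lin(1)])
    finally show ?thesis .
  qed
  show ?thesis unfolding compat_push[OF V h]
    by (rule FF.lift_cong[OF T_ab FF.nab_closed[OF h(1)] inner])
      (use h in \<open>simp_all add: inner tmap_closed[OF g lin(1)]\<close>)
qed

lemma LF_kbal: "kbalanced k A FF.FT TT LF"
  by (rule balancedI) (simp_all add: LF_add_left LF_add LF_smult)

lemma LF_one_fact:
  assumes "f \<in> carrier F" "x \<in> carrier W"
  shows "tens_lift TT (\<lambda>f' \<eta>. T.fp (gF f') (wm (w oA \<eta>) x)) (nabF f) = T.fact (LF \<one>\<^bsub>A\<^esub> (nabF f)) x"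
proof -
  have "T.fact (LF \<one>\<^bsub>A\<^esub> (nabF f)) x = tens_lift TT (\<lambda>f' \<eta>. T.fact (T.fp (gF f') (w oA \<eta>)) x) (nabF f)"
    unfolding LF_def
    by (rule FF.lift_push[OF T_ab T_ab Tfact_additive[OF assms(2)] FF.nab_closed[OF assms(1)]]) simp
  also have "\<dots> = tens_lift TT (\<lambda>f' \<eta>. T.fp (gF f') (wm (w oA \<eta>) x)) (nabF f)"
    by (rule FF.lift_cong[OF T_ab FF.nab_closed[OF assms(1)]]) (use assms in \<open>simp_all add: Tfact_pure\<close>)
  finally show ?thesis by simp
qed

lemma rt_wm: "\<eta> \<in> carrier WB \<Longrightarrow> \<phi> \<in> carrier WA \<Longrightarrow> rt \<eta> \<phi> = wm (w oA \<eta>) (w \<phi> oB)"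
  by (simp add: wm_one_left)

text \<open>Compatibility with V = \<open>LF\<close> and g the identity. The twisting of \<eta> past
  a is the product (1 \<otimes> \<eta>)(a \<otimes> 1), so the result is the value at 1 \<otimes> f
  multiplied by a on the right.\<close>

lemma \<nu>_tw:
  assumes "f \<in> carrier F" "a \<in> carrier A"
  shows "\<nu> (F.tw f a) = T.fact (LF \<one>\<^bsub>A\<^esub> (nabF f)) (w (iA a) oB)"
proof -
  have tid: "tmap (\<lambda>x. x) idf t = t" if "t \<in> carrier W" for t
    by (rule W.AF.additive_ext[OF W_ab tmap_additive[OF lin(1) lin(1)] additive_id that])
      (simp add: tmap_pure[OF lin(1) lin(1)])
  have "\<nu> (F.tw f a) = tens_lift TT (\<lambda>f' \<eta>. T.fp (gF f') (tmap (\<lambda>x. x) idf (rt \<eta> (iA a)))) (nabF f)"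
    unfolding \<nu>_def
  proof (rule compat_eval[OF LF_kbal assms lin(1), where \<psi> = "\<lambda>\<eta> u. T.fp (\<zero>\<^bsub>EBt\<^esub>, u) (w oA \<eta>)"])
    show "additive AFt TT (\<lambda>u. T.fp (\<zero>\<^bsub>EBt\<^esub>, u) (w oA \<eta>))" if "\<eta> \<in> carrier WB" for \<eta>
      by (rule Tfp_inr_additive) (use that in simp)
    show "LF a (FF.fp f \<eta>) = T.fp (\<zero>\<^bsub>EBt\<^esub>, F.q a f) (w oA \<eta>)"
      if "a \<in> carrier A" "f \<in> carrier F" "\<eta> \<in> carrier WB" for a f \<eta>
      using that by (simp add: LF_pure elemF_def)
    show "T.fp (\<zero>\<^bsub>EBt\<^esub>, F.tw f a) (w oA \<eta>) = T.fp (gF f) (w (iA a) \<eta>)"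
      if "f \<in> carrier F" "a \<in> carrier A" "\<eta> \<in> carrier WB" for f a \<eta>
      using that by (simp add: fp_gF_tw)
  qed
  also have "\<dots> = tens_lift TT (\<lambda>f' \<eta>. T.fp (gF f') (wm (w oA \<eta>) (w (iA a) oB))) (nabF f)"
    by (rule FF.lift_cong[OF T_ab]) (use assms in \<open>simp_all add: tid rt_wm[symmetric]\<close>)
  also have "\<dots> = T.fact (LF \<one>\<^bsub>A\<^esub> (nabF f)) (w (iA a) oB)"
    by (rule LF_one_fact) (use assms in simp_all)
  finally show ?thesis .
qed

lemma nab2_tw:
  assumes "f \<in> carrier F" "a \<in> carrier A"
  shows "nab2 (F.tw f a) = T.fact (LF \<one>\<^bsub>A\<^esub> (nabF f)) (w (iA a) oB) \<oplus>\<^bsub>TT\<^esub> T.fp (gF f) (w (dA (iA a)) oB)"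
  using assms by (simp add: nab2_eq \<nu>_tw \<kappa>_tw)

lemma dW_left: "\<phi> \<in> carrier WA \<Longrightarrow> dW (w \<phi> oB) = w (dA \<phi>) oB"
  by (simp add: dW_pure UB.dif_one)

lemma dW_right: "\<eta> \<in> carrier WB \<Longrightarrow> dW (w oA \<eta>) = w oA (dB \<eta>)"
  by (simp add: dW_pure UA.dif_one)

text \<open>By surjectivity of \<open>R\<close> it suffices to take \<open>y = R(b \<otimes> a)\<close>, where \<open>(1 \<otimes> f) \<cdot> y = \<tau>(fb \<otimes> a)\<close>.\<close>

lemma nab2_gen:
  assumes "f \<in> carrier F" "y \<in> carrier DD"
  shows "nab2 (F.act (F.q \<one>\<^bsub>A\<^esub> f) y) =
    T.fact (LF \<one>\<^bsub>A\<^esub> (nabF f)) (iD y) \<oplus>\<^bsub>TT\<^esub> T.fp (gF f) (dW (iD y))"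
proof -
  have q1: "F.q \<one>\<^bsub>A\<^esub> f \<in> carrier AFt" using assms by simp
  obtain s where s: "s \<in> carrier (ktens k B A)" "y = R s" using R_surj assms(2) by auto
  have "nab2 (F.act (F.q \<one>\<^bsub>A\<^esub> f) (R s)) =
    T.fact (LF \<one>\<^bsub>A\<^esub> (nabF f)) (iD (R s)) \<oplus>\<^bsub>TT\<^esub> T.fp (gF f) (dW (iD (R s)))"
  proof (rule D.BA.additive_ext[OF T_ab
        additive_compose[OF D.R_additive additive_compose[OF F.act_additive_right[OF q1] nab2_additive]]
        additive_compose[OF D.R_additive additive_plus[OF T_ab additive_compose[OF iD_additive Tfact_additive_right]
        additive_compose[OF iD_additive additive_compose[OF dW_additive Tfp_additive_right]]]] s(1)])
    fix b a assume h: "b \<in> carrier B" "a \<in> carrier A"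
    let ?b = "w oA (iB b)" and ?a = "w (iA a) oB"
    have iDR: "iD (D.\<rho> b a) = wm ?b ?a" using h by (simp add: rt_incl[symmetric] rt_wm)
    have dR: "dW (wm ?b ?a) = wm (w oA (dB (iB b))) ?a \<oplus>\<^bsub>W\<^esub> wm ?b (w (dA (iA a)) oB)"
      using dW_iD_mult[of "D.q \<one>\<^bsub>A\<^esub> b" ?a] h by (simp add: iD_right dW_left dW_right)
    \<comment> \<open>The Leibniz rule of \<nabla> on F at fb; its extra term f \<otimes> db
      supplies the derivative of the b in y, while the term of \<open>\<kappa>\<close> supplies that
      of a.\<close>
    have L: "LF \<one>\<^bsub>A\<^esub> (nabF (rF f b)) = T.fact (LF \<one>\<^bsub>A\<^esub> (nabF f)) ?b \<oplus>\<^bsub>TT\<^esub> T.fp (gF f) (w oA (dB (iB b)))"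
      using h assms by (simp add: FF.nab_act LF_add LF_fact LF_pure)
    have "nab2 (F.act (F.q \<one>\<^bsub>A\<^esub> f) (D.\<rho> b a)) =
        T.fact (LF \<one>\<^bsub>A\<^esub> (nabF (rF f b))) ?a \<oplus>\<^bsub>TT\<^esub> T.fp (gF (rF f b)) (w (dA (iA a)) oB)"
      using h assms by (simp add: F.tw_act_act[symmetric] nab2_tw)
    also have "T.fact (LF \<one>\<^bsub>A\<^esub> (nabF (rF f b))) ?a =
        T.fact (LF \<one>\<^bsub>A\<^esub> (nabF f)) (wm ?b ?a) \<oplus>\<^bsub>TT\<^esub> T.fp (gF f) (wm (w oA (dB (iB b))) ?a)"
      unfolding L using h assms by (simp add: Tfact_add_left Tfact_fact Tfact_pure)
    also have "T.fp (gF (rF f b)) (w (dA (iA a)) oB) = T.fp (gF f) (wm ?b (w (dA (iA a)) oB))"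
      using h assms by (simp add: fp_eF_rF)
    finally show "nab2 (F.act (F.q \<one>\<^bsub>A\<^esub> f) (D.\<rho> b a)) =
        T.fact (LF \<one>\<^bsub>A\<^esub> (nabF f)) (iD (D.\<rho> b a)) \<oplus>\<^bsub>TT\<^esub> T.fp (gF f) (dW (iD (D.\<rho> b a)))"
      unfolding iDR dR using h assms by (simp add: Tfp_add_right T.MN.a_assoc)
  qed (use assms in simp_all)
  then show ?thesis by (simp add: s(2))
qed

text \<open>For v = \<tau>(f \<otimes> a) = (1 \<otimes> f) \<cdot> (a \<otimes> 1) the action of x
  leads to (1 \<otimes> f) \<cdot> ((a \<otimes> 1) x). This is why \<open>nab2_gen\<close> is
  needed for arbitrary y and not only for y = a \<otimes> 1.\<close>

lemma nab2_act:
  assumes "v \<in> carrier AFt" "x \<in> carrier DD"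
  shows "nab2 (F.act v x) = T.fact (nab2 v) (iD x) \<oplus>\<^bsub>TT\<^esub> T.fp (\<zero>\<^bsub>EBt\<^esub>, v) (dW (iD x))"
proof (rule tau_ext[OF T_ab additive_compose[OF F.act_additive_left nab2_additive]
      additive_plus[OF T_ab additive_compose[OF nab2_additive Tfact_additive] Tfp_inr_additive] assms(1)])
  fix f a assume h: "f \<in> carrier F" "a \<in> carrier A"
  have y: "D.q a \<one>\<^bsub>B\<^esub> \<in> carrier DD" using h by simp
  show "nab2 (F.act (F.tw f a) x) =
      T.fact (nab2 (F.tw f a)) (iD x) \<oplus>\<^bsub>TT\<^esub> T.fp (\<zero>\<^bsub>EBt\<^esub>, F.tw f a) (dW (iD x))"
    using h assms leibniz_from_generator[of "LF \<one>\<^bsub>A\<^esub> (nabF f)" "gF f" "D.q a \<one>\<^bsub>B\<^esub>" x] y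
    by (simp add: F.act_gen[symmetric] F.act_assoc nab2_gen pact_eF)
qed (use assms in simp_all)

section \<open>The product connection satisfies the Leibniz rule over the twisted calculus\<close>

abbreviation nab where "nab \<equiv> prod_connection k A B R Rt E rE F rF \<tau> nabE nabF"

lemma nab_eq: "nab m = nab1 (fst m) \<oplus>\<^bsub>TT\<^esub> nab2 (snd m)"
  by (simp add: prod_connection_def Let_def pforms_eq pfpure_eq inclE_eq act_inclF_eq nab1_def nab2_def KF_def)

lemma PM_cases:
  assumes "m \<in> carrier PM"
  shows "fst m \<in> carrier EBt" "snd m \<in> carrier AFt"
  using assms by (simp_all add: PM_simps)

lemma PM_split: "m \<in> carrier PM \<Longrightarrow> m = (fst m, \<zero>\<^bsub>AFt\<^esub>) \<oplus>\<^bsub>PM\<^esub> (\<zero>\<^bsub>EBt\<^esub>, snd m)"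
  by (simp add: PM_simps)

lemma nab_act:
  assumes "m \<in> carrier PM" "x \<in> carrier DD"
  shows "nab (pact m x) = T.fact (nab m) (iD x) \<oplus>\<^bsub>TT\<^esub> T.fp m (dW (iD x))"
proof -
  note c = PM_cases[OF assms(1)]
  have "T.fp m (dW (iD x)) = T.fp (fst m, \<zero>\<^bsub>AFt\<^esub>) (dW (iD x)) \<oplus>\<^bsub>TT\<^esub> T.fp (\<zero>\<^bsub>EBt\<^esub>, snd m) (dW (iD x))"
    using Tfp_add_left[OF inl_inr_closed(1)[OF c(1)] inl_inr_closed(2)[OF c(2)], of "dW (iD x)"] assms
    unfolding PM_split[OF assms(1), symmetric] by simp
  then show ?thesis using c assms
    by (simp add: nab_eq pact_eq nab1_act nab2_act Tfact_add_left T.MN.a_ac inl_inr_closed)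
qed

sublocale C: connection "twisted_algebra k A B R" TC PM pact nab
proof unfold_locales
  show "additive PM TT nab"
    by (rule additiveI)
      (simp_all add: nab_eq PM_cases PM_simps(2) additive_add[OF nab1_additive] additive_add[OF nab2_additive] T.MN.a_ac)
next
  show "additive TC TC dW"
    using dW_additive by (simp add: additive_def hom_def)
qed (simp_all add: nab_act dW_iD_mult)

end

section \<open>The curvature of the product connection\<close>

context connection_setting
begin

lemma Cext_pure: "m \<in> carrier PM \<Longrightarrow> x \<in> carrier W \<Longrightarrow>
    C.ext (T.fp m x) = T.fact (nab m) x \<oplus>\<^bsub>TT\<^esub> T.fp m (dW x)"
  using C.ext_pure by simp

lemmas Cext_add = additive_add[OF C.ext_additive]

lemma iB_one: "iB \<one>\<^bsub>B\<^esub> = oB"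
  by (rule UB.incl_one)

lemma Tfp_zero_right: "m \<in> carrier PM \<Longrightarrow> T.fp m \<zero>\<^bsub>W\<^esub> = \<zero>\<^bsub>TT\<^esub>"
  by (rule additive_zero[OF W_ab T_ab Tfp_additive_right])

lemma Tfp_minus_right: "m \<in> carrier PM \<Longrightarrow> x \<in> carrier W \<Longrightarrow> T.fp m (\<ominus>\<^bsub>W\<^esub> x) = \<ominus>\<^bsub>TT\<^esub> T.fp m x"
  by (rule additive_minus[OF W_ab T_ab Tfp_additive_right])

lemma nab_gE: "e \<in> carrier E \<Longrightarrow> nab (gE e) = iE oB (nabE e)"
  using additive_zero[OF F.AF_ab T_ab nab2_additive]
  by (simp add: nab_eq elemE_def nab1_pure iB_one UB.dif_one) (simp add: elemE_def[symmetric] Tfp_zero_right)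

lemma nab_eF: "a \<in> carrier A \<Longrightarrow> f \<in> carrier F \<Longrightarrow> nab (eF a f) = LF a (nabF f) \<oplus>\<^bsub>TT\<^esub> \<kappa> (F.q a f)"
  using additive_zero[OF EB_ab T_ab nab1_additive]
  by (simp add: nab_eq elemF_def nab2_pure)

text \<open>Here 1 \<otimes> f = \<tau>(f \<otimes> 1) and d1 = 0.\<close>

lemma \<kappa>_one: "f \<in> carrier F \<Longrightarrow> \<kappa> (F.q \<one>\<^bsub>A\<^esub> f) = \<zero>\<^bsub>TT\<^esub>"
  using \<kappa>_tw[of f "\<one>\<^bsub>A\<^esub>"] by (simp add: F.tw_one UA.incl_one UA.dif_one Tfp_zero_right)

lemma nab_gF: "f \<in> carrier F \<Longrightarrow> nab (gF f) = LF \<one>\<^bsub>A\<^esub> (nabF f)"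
  by (simp add: nab_eF \<kappa>_one)

lemma nabE_degree: "e \<in> carrier E \<Longrightarrow>
    nabE e \<in> span_in FE.FT {FE.fp m v | m v. m \<in> carrier E \<and> v \<in> grade WA 1}"
  using E_conn unfolding right_connection_def forms_comp_def by blast

lemma nabF_degree: "f \<in> carrier F \<Longrightarrow>
    nabF f \<in> span_in FF.FT {FF.fp m v | m v. m \<in> carrier F \<and> v \<in> grade WB 1}"
  using F_conn unfolding right_connection_def forms_comp_def by blast

lemma dW_oA_d: "\<eta> \<in> carrier WB \<Longrightarrow> dW (w oA (dB \<eta>)) = \<zero>\<^bsub>W\<^esub>"
  by (simp add: dW_right UB.dif_dif)

text \<open>The extended \<nabla> commutes with the inclusion except for the term in d\<eta>, whose
  sign depends on the degree of the A form. As the values of \<nabla> on E are spanned by terms of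
  degree one, that sign is -1; the identity is therefore stated for \<open>nabE e\<close> and proved
  on this span.\<close>

lemma ext_iE:
  assumes "e \<in> carrier E" "\<eta> \<in> carrier WB"
  shows "C.ext (iE \<eta> (nabE e)) = iE \<eta> (FE.ext (nabE e)) \<oplus>\<^bsub>TT\<^esub> \<ominus>\<^bsub>TT\<^esub> iE (dB \<eta>) (nabE e)"
proof (rule additive_eq_on_span[OF FE.FT_ab T_ab _ _ _ _ nabE_degree[OF assms(1)]])
  show "additive FE.FT TT (\<lambda>t. C.ext (iE \<eta> t))"
    by (rule additive_compose[OF iE_additive[OF assms(2)] C.ext_additive])
  show "additive FE.FT TT (\<lambda>t. iE \<eta> (FE.ext t) \<oplus>\<^bsub>TT\<^esub> \<ominus>\<^bsub>TT\<^esub> iE (dB \<eta>) t)"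
    by (rule additive_plus[OF T_ab additive_compose[OF FE.ext_additive iE_additive[OF assms(2)]]
          additive_uminus[OF T_ab iE_additive]]) (use assms in simp)
  show "{FE.fp m v | m v. m \<in> carrier E \<and> v \<in> grade WA 1} \<subseteq> carrier FE.FT"
    using UA.grade_subset by auto
  fix t assume "t \<in> {FE.fp m v | m v. m \<in> carrier E \<and> v \<in> grade WA 1}"
  then obtain m v where t: "t = FE.fp m v" "m \<in> carrier E" "v \<in> grade WA 1" by auto
  have v: "v \<in> carrier WA" using t(3) UA.grade_subset by blast
  have "dW (w v \<eta>) = w (dA v) \<eta> \<oplus>\<^bsub>W\<^esub> \<ominus>\<^bsub>W\<^esub> w v (dB \<eta>)"
    using v assms by (simp add: dW_pure UA.sign_grade1[OF t(3)] W.AF.pure_minus_left)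
  then have "C.ext (iE \<eta> t) =
      T.fact (iE oB (nabE m)) (w v \<eta>) \<oplus>\<^bsub>TT\<^esub> (T.fp (gE m) (w (dA v) \<eta>) \<oplus>\<^bsub>TT\<^esub> \<ominus>\<^bsub>TT\<^esub> T.fp (gE m) (w v (dB \<eta>)))"
    using t v assms by (simp add: iE_pure Cext_pure nab_gE Tfp_add_right Tfp_minus_right)
  then show "C.ext (iE \<eta> t) = iE \<eta> (FE.ext t) \<oplus>\<^bsub>TT\<^esub> \<ominus>\<^bsub>TT\<^esub> iE (dB \<eta>) t"
    using t v assms by (simp add: FE.ext_pure additive_add[OF iE_additive] iE_fact iE_pure T.MN.a_assoc)
qed

lemma curvature_E:
  assumes "e \<in> carrier E" "b \<in> carrier B"
  shows "C.ext (nab1 (kpure k E B e b)) = iE (iB b) (FE.ext (nabE e))"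
proof -
  \<comment> \<open>The other cross term: d(db) = 0, so only the connection acts, on the generator e
    \<otimes> 1.\<close>
  have "C.ext (T.fp (gE e) (w oA (dB (iB b)))) = iE (dB (iB b)) (nabE e)"
    using assms iE_eq[of "dB (iB b)" "nabE e"]
    by (simp add: Cext_pure nab_gE dW_oA_d Tfp_zero_right)
  then show ?thesis
    using assms by (simp add: nab1_pure Cext_add ext_iE T.MN.a_assoc T.MN.l_neg)
qed

text \<open>\<open>VF\<close> is the failure of \<open>\<nabla>\<close> to commute with \<open>t \<mapsto> a \<cdot> i\<^sub>F(t)\<close>; \<open>VF_\<kappa>\<close> says that, evaluated at
  \<open>\<nabla>\<^sup>F f\<close>, it cancels what \<open>\<nabla>\<close> makes of the second summand \<open>\<kappa>(a \<otimes> f)\<close> of \<open>\<nabla>\<^sub>2(a \<otimes> f)\<close>.\<close>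

definition VF where "VF a t = C.ext (LF a t) \<oplus>\<^bsub>TT\<^esub> \<ominus>\<^bsub>TT\<^esub> LF a (FF.ext t)"

lemma VF_additive: "a \<in> carrier A \<Longrightarrow> additive FF.FT TT (VF a)"
  unfolding VF_def[abs_def]
  by (rule additive_plus[OF T_ab additive_compose[OF LF_additive C.ext_additive]
        additive_uminus[OF T_ab additive_compose[OF FF.ext_additive LF_additive]]])

text \<open>Of \<nabla>(a \<otimes> f), the part from \<nabla> on F, together with the derivative of
  \<eta>, reproduces the extended connection of F. What remains is the \<open>\<kappa>\<close> part
  times \<eta>.\<close>

lemma VF_pure:
  assumes "a \<in> carrier A" "f \<in> carrier F" "\<eta> \<in> carrier WB"
  shows "VF a (FF.fp f \<eta>) = T.fact (\<kappa> (F.q a f)) (w oA \<eta>)"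
proof -
  let ?x = "T.fact (LF a (nabF f)) (w oA \<eta>)" and ?y = "T.fact (\<kappa> (F.q a f)) (w oA \<eta>)"
    and ?z = "T.fp (eF a f) (w oA (dB \<eta>))"
  have c: "?x \<in> carrier TT" "?y \<in> carrier TT" "?z \<in> carrier TT" using assms by simp_all
  have "C.ext (LF a (FF.fp f \<eta>)) = (?x \<oplus>\<^bsub>TT\<^esub> ?y) \<oplus>\<^bsub>TT\<^esub> ?z"
    using assms by (simp add: LF_pure Cext_pure nab_eF Tfact_add_left dW_right)
  also have "\<dots> = ?y \<oplus>\<^bsub>TT\<^esub> (?x \<oplus>\<^bsub>TT\<^esub> ?z)" using c by (simp add: T.MN.a_ac)
  finally have "C.ext (LF a (FF.fp f \<eta>)) = ?y \<oplus>\<^bsub>TT\<^esub> (?x \<oplus>\<^bsub>TT\<^esub> ?z)" .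
  moreover have "LF a (FF.ext (FF.fp f \<eta>)) = ?x \<oplus>\<^bsub>TT\<^esub> ?z"
    using assms by (simp add: FF.ext_pure LF_add LF_fact LF_pure)
  ultimately show ?thesis using c by (simp only: VF_def T.MN.a_assoc T.MN.a_closed T.MN.a_inv_closed T.MN.r_neg T.MN.r_zero)
qed

text \<open>Makes \<open>VF\<close> admissible as the \<open>V\<close> of
  \<open>compat_eval\<close>. Additivity comes from the definition; scalars are compared on pure
  forms, where \<open>VF_pure\<close> lets them pass between a and f inside
  \<open>\<kappa>\<close>.\<close>

lemma VF_bal: "kbalanced k A FF.FT TT VF"
proof (rule balancedI)
  fix a a' t assume "a \<in> carrier A" "a' \<in> carrier A" "t \<in> carrier FF.FT"
  then show "VF (a \<oplus>\<^bsub>A\<^esub> a') t = VF a t \<oplus>\<^bsub>TT\<^esub> VF a' t"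
    by (simp add: VF_def LF_add_left Cext_add T.MN.minus_add T.MN.a_ac)
next
  fix a c t assume h: "a \<in> carrier A" "c \<in> carrier k" "t \<in> carrier FF.FT"
  then have "c \<odot>\<^bsub>A\<^esub> a \<in> carrier A" by simp
  then show "VF (c \<odot>\<^bsub>A\<^esub> a) t = VF a (c \<odot>\<^bsub>FF.FT\<^esub> t)"
    by (intro FF.additive_ext[OF T_ab VF_additive additive_compose[OF FF_smult_additive VF_additive] h(3)])
      (use h in \<open>simp_all add: VF_pure FF_smult_pure F.AF.pure_balanced\<close>)
qed (simp_all add: additive_closed[OF VF_additive] additive_add[OF VF_additive])

lemma VF_nabF_bal: "kbalanced k A F TT (\<lambda>a f. VF a (nabF f))"
proof (rule balancedI)
  fix a c f assume h: "a \<in> carrier A" "c \<in> carrier k" "f \<in> carrier F"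
  then show "VF (c \<odot>\<^bsub>A\<^esub> a) (nabF f) = VF a (nabF (c \<odot>\<^bsub>F\<^esub> f))"
    using VF_bal unfolding balanced_def by (simp add: nabF_smult)
next
  fix a a' f assume "a \<in> carrier A" "a' \<in> carrier A" "f \<in> carrier F"
  then show "VF (a \<oplus>\<^bsub>A\<^esub> a') (nabF f) = VF a (nabF f) \<oplus>\<^bsub>TT\<^esub> VF a' (nabF f)"
    using VF_bal additive_add[of A TT "\<lambda>m. VF m (nabF f)"] unfolding balanced_def by simp
qed (simp_all add: additive_closed[OF VF_additive] additive_add[OF VF_additive] nabF_add)

text \<open>The extension axiom for da inserts a sign on the B side, but here d must act on the A
  side alone. Applying the sign to \<eta> beforehand compensates: it passes through the twisting
  with a by \<open>rt_sign_left\<close>, and its square is the identity.\<close>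

lemma tmap_dA_rt:
  assumes "\<eta> \<in> carrier WB" "a \<in> carrier A"
  shows "tmap dA idf (rt \<eta> (iA a)) = rt (UB.sign \<eta>) (dA (iA a))"
proof -
  have "tmap dA UB.sign (S2 t) = tmap dA idf t" if "t \<in> carrier W" for t
    by (rule W.AF.additive_ext[OF W_ab additive_compose[OF S2_additive tmap_additive[OF lin(2) lin(5)]]
          tmap_additive[OF lin(2) lin(1)] that])
      (simp add: S2_pure tmap_pure[OF lin(2) lin(5)] tmap_pure[OF lin(2) lin(1)] UB.sign_sign)
  then show ?thesis using assms by (simp add: rt_dA rt_sign_left)
qed

text \<open>Compatibility with V = \<open>VF\<close> and g = d turns the sum into tensors of the f'
  with the twisting of the signed \<eta> past da. Since \<open>nabF f\<close> is spanned by terms of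
  degree one, the sign is -1, and the unsigned twisting is the product (1 \<otimes> \<eta>)(da
  \<otimes> 1).\<close>

lemma VF_tw:
  assumes "f \<in> carrier F" "a \<in> carrier A"
  shows "tens_lift TT (\<lambda>a' f'. VF a' (nabF f')) (F.tw f a) = \<ominus>\<^bsub>TT\<^esub> T.fact (LF \<one>\<^bsub>A\<^esub> (nabF f)) (w (dA (iA a)) oB)"
proof -
  let ?d = "dA (iA a)"
  let ?g = "\<lambda>f' \<eta>. T.fp (gF f') (rt (UB.sign \<eta>) ?d)"
  have d: "?d \<in> carrier WA" using assms by simp
  \<comment> \<open>Balanced over B because the sign map is multiplicative and fixes b, and a left
    factor b leaves the twisting as left multiplication by 1 \<otimes> b.\<close>
  have bal: "balanced (carrier B) F rF WB (\<lambda>x w. iB x \<otimes>\<^bsub>WB\<^esub> w) TT ?g"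
    by (rule balancedI)
      (use d in \<open>simp_all add: eF_add_right Tfp_add_left Tfp_add_right UB.sign_add W.\<rho>_add fp_eF_rF
        UB.sign_mult W.tw_act_act\<close>)
  have "tens_lift TT (\<lambda>a' f'. VF a' (nabF f')) (F.tw f a) =
      tens_lift TT (\<lambda>f' \<eta>. T.fp (gF f') (tmap dA idf (rt \<eta> (iA a)))) (nabF f)"
  proof (rule compat_eval[OF VF_bal assms lin(2), where \<psi> = "\<lambda>\<eta> u. T.fact (\<kappa> u) (w oA \<eta>)"])
    show "additive AFt TT (\<lambda>u. T.fact (\<kappa> u) (w oA \<eta>))" if "\<eta> \<in> carrier WB" for \<eta>
      by (rule additive_compose[OF \<kappa>_additive Tfact_additive]) (use that in simp)
    show "VF a (FF.fp f \<eta>) = T.fact (\<kappa> (F.q a f)) (w oA \<eta>)"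
      if "a \<in> carrier A" "f \<in> carrier F" "\<eta> \<in> carrier WB" for a f \<eta>
      by (rule VF_pure[OF that])
    show "T.fact (\<kappa> (F.tw f a)) (w oA \<eta>) = T.fp (gF f) (w (dA (iA a)) \<eta>)"
      if "f \<in> carrier F" "a \<in> carrier A" "\<eta> \<in> carrier WB" for f a \<eta>
      using that by (simp add: \<kappa>_tw Tfact_pure wm_left)
  qed
  also have "\<dots> = tens_lift TT ?g (nabF f)"
    by (rule FF.lift_cong[OF T_ab]) (use assms in \<open>simp_all add: tmap_dA_rt\<close>)
  also have "\<dots> = \<ominus>\<^bsub>TT\<^esub> T.fact (LF \<one>\<^bsub>A\<^esub> (nabF f)) (w ?d oB)"
  proof (rule additive_eq_on_span[OF FF.FT_ab T_ab FF.lift_additive[OF T_ab bal] _ _ _ nabF_degree[OF assms(1)]])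
    show "additive FF.FT TT (\<lambda>t. \<ominus>\<^bsub>TT\<^esub> T.fact (LF \<one>\<^bsub>A\<^esub> t) (w ?d oB))"
      by (rule additive_uminus[OF T_ab additive_compose[OF LF_additive Tfact_additive]]) (use d in simp_all)
    show "{FF.fp m v | m v. m \<in> carrier F \<and> v \<in> grade WB 1} \<subseteq> carrier FF.FT"
      using UB.grade_subset by auto
    fix t assume "t \<in> {FF.fp m v | m v. m \<in> carrier F \<and> v \<in> grade WB 1}"
    then obtain m v where t: "t = FF.fp m v" "m \<in> carrier F" "v \<in> grade WB 1" by auto
    have v: "v \<in> carrier WB" using t(3) UB.grade_subset by blast
    have "tens_lift TT ?g t = T.fp (gF m) (rt (UB.sign v) ?d)"
      unfolding t(1) by (rule FF.lift_pure[OF T_ab bal t(2) v])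
    then show "tens_lift TT ?g t = \<ominus>\<^bsub>TT\<^esub> T.fact (LF \<one>\<^bsub>A\<^esub> t) (w ?d oB)"
      using t v d by (simp add: UB.sign_grade1[OF t(3)] rt_minus_left Tfp_minus_right LF_pure Tfact_pure wm_one_left)
  qed
  finally show ?thesis .
qed

lemma VF_\<kappa>:
  assumes "u \<in> carrier AFt"
  shows "tens_lift TT (\<lambda>a' f'. VF a' (nabF f')) u \<oplus>\<^bsub>TT\<^esub> C.ext (\<kappa> u) = \<zero>\<^bsub>TT\<^esub>"
proof (rule tau_ext[OF T_ab additive_plus[OF T_ab F.AF.lift_additive[OF T_ab VF_nabF_bal]
        additive_compose[OF \<kappa>_additive C.ext_additive]] _ assms])
  show "additive AFt TT (\<lambda>u. \<zero>\<^bsub>TT\<^esub>)" by (rule additiveI) simp_all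
  fix f a assume h: "f \<in> carrier F" "a \<in> carrier A"
  \<comment> \<open>Since d(da) = 0, only the connection acts, on the generator 1 \<otimes>
    f.\<close>
  have "C.ext (\<kappa> (F.tw f a)) = T.fact (LF \<one>\<^bsub>A\<^esub> (nabF f)) (w (dA (iA a)) oB)"
    using h by (simp add: \<kappa>_tw Cext_pure nab_gF dW_left UA.dif_dif Tfp_zero_right)
  then show "tens_lift TT (\<lambda>a' f'. VF a' (nabF f')) (F.tw f a) \<oplus>\<^bsub>TT\<^esub> C.ext (\<kappa> (F.tw f a)) = \<zero>\<^bsub>TT\<^esub>"
    using h by (simp add: VF_tw T.MN.l_neg)
qed

lemma curvature_F:
  assumes "a \<in> carrier A" "f \<in> carrier F"
  shows "C.ext (nab2 (F.q a f)) = LF a (FF.ext (nabF f))"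
proof -
  let ?x = "C.ext (LF a (nabF f))" and ?y = "C.ext (\<kappa> (F.q a f))" and ?z = "LF a (FF.ext (nabF f))"
  have c: "?x \<in> carrier TT" "?y \<in> carrier TT" "?z \<in> carrier TT" using assms by simp_all
  have "(?x \<oplus>\<^bsub>TT\<^esub> \<ominus>\<^bsub>TT\<^esub> ?z) \<oplus>\<^bsub>TT\<^esub> ?y = \<zero>\<^bsub>TT\<^esub>"
    using VF_\<kappa>[of "F.q a f"] assms F.AF.lift_pure[OF T_ab VF_nabF_bal assms] by (simp add: VF_def)
  then have "(?x \<oplus>\<^bsub>TT\<^esub> ?y) \<oplus>\<^bsub>TT\<^esub> \<ominus>\<^bsub>TT\<^esub> ?z = \<zero>\<^bsub>TT\<^esub>" using c by (simp add: T.MN.a_ac)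
  then have "?x \<oplus>\<^bsub>TT\<^esub> ?y = ?z"
    using c T.MN.minus_equality[of "?x \<oplus>\<^bsub>TT\<^esub> ?y" "\<ominus>\<^bsub>TT\<^esub> ?z"] by simp
  then show ?thesis using assms by (simp add: nab2_pure Cext_add)
qed

theorem curvature_product:
  assumes "e \<in> carrier E" "b \<in> carrier B" "a \<in> carrier A" "f \<in> carrier F"
  shows "curvature (twisted_algebra k A B R) TC PM pact nab (kpure k E B e b, F.q a f) =
    inclE_act k A B R Rt E rE F rF \<tau> (curvature A WA E rE nabE e) b
    \<oplus>\<^bsub>prod_forms k A B R Rt E rE F rF \<tau>\<^esub>
    act_inclF k A B R Rt E rE F rF \<tau> a (curvature B WB F rF nabF f)"
proof -
  have "nab (kpure k E B e b, F.q a f) = nab1 (kpure k E B e b) \<oplus>\<^bsub>TT\<^esub> nab2 (F.q a f)"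
    by (simp add: nab_eq)
  then show ?thesis
    unfolding curvature_def inclE_eq act_inclF_eq pforms_eq
    using assms by (simp add: Cext_add curvature_E curvature_F)
qed

end

theorem theorem3p1:
  fixes k :: "'k ring"
    and A :: "('k, 'a) module" and B :: "('k, 'b) module"
    and E :: "('k, 'e) module" and rE :: "'e \<Rightarrow> 'a \<Rightarrow> 'e"
    and F :: "('k, 'f) module" and rF :: "'f \<Rightarrow> 'b \<Rightarrow> 'f"
    and R :: "('b, 'a) tensor \<Rightarrow> ('a, 'b) tensor"
    and Rt :: "(('k, 'b) uform, ('k, 'a) uform) tensor \<Rightarrow> (('k, 'a) uform, ('k, 'b) uform) tensor"
    and \<tau> :: "('f, 'a) tensor \<Rightarrow> ('a, 'f) tensor"
    and nabE :: "'e \<Rightarrow> ('e, ('k, 'a) uform) tensor"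
    and nabF :: "'f \<Rightarrow> ('f, ('k, 'b) uform) tensor"
  assumes "field k"
    and "algebra_over k A" and "algebra_over k B"
    and "twisting_map k A B R"
    and "bij_betw R (carrier (ktens k B A)) (carrier (ktens k A B))"
    and "twisting_extension k A B R Rt"
    and "right_module k A E rE"
    and "right_connection k A (universal_calculus k A) E rE nabE"
    and "right_module k B F rF"
    and "right_connection k B (universal_calculus k B) F rF nabF"
    and "module_twisting_map k A B R F rF \<tau>"
    and "bij_betw \<tau> (carrier (ktens k F A)) (carrier (ktens k A F))"
    and "twisting_compatible k A B Rt F rF \<tau> nabF"
  shows "\<forall>e \<in> carrier E. \<forall>b \<in> carrier B. \<forall>a \<in> carrier A. \<forall>f \<in> carrier F.
    curvature (twisted_algebra k A B R) (twisted_calculus k A B Rt)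
      (prod_module k A B E F) (prod_act k A B R E rE F rF \<tau>)
      (prod_connection k A B R Rt E rE F rF \<tau> nabE nabF)
      (kpure k E B e b, kpure k A F a f) =
    inclE_act k A B R Rt E rE F rF \<tau>
      (curvature A (universal_calculus k A) E rE nabE e) b
    \<oplus>\<^bsub>prod_forms k A B R Rt E rE F rF \<tau>\<^esub>
    act_inclF k A B R Rt E rE F rF \<tau> a
      (curvature B (universal_calculus k B) F rF nabF f)"
proof -
  interpret k: field k by fact
  interpret A: ring A using assms(2) by (simp add: algebra_over_def)
  interpret A: module k A using assms(2) by (simp add: algebra_over_def)
  interpret B: ring B using assms(3) by (simp add: algebra_over_def)
  interpret B: module k B using assms(3) by (simp add: algebra_over_def)
  interpret F: module k F using assms(9) by (simp add: right_module_def)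
  interpret E: module k E using assms(7) by (simp add: right_module_def)
  have self: "twisted_module k A B B (\<lambda>b b'. b \<otimes>\<^bsub>B\<^esub> b') R R"
    by (rule twisted_module_self[OF k.is_cring assms(2,3,4)])
  interpret Fp: twisted_module_pre k A B F rF R \<tau>
    by unfold_locales (use assms right_module_self[OF assms(3)] in simp_all)
  \<comment> \<open>The only missing condition is the unit rule, which the surjectivity half of the
    bijectivity of \<tau> provides.\<close>
  have "twisted_module k A B F rF R \<tau>"
    by unfold_locales (rule Fp.surj_tw_one, use assms(12) in \<open>simp_all add: bij_betw_def\<close>)
  then have Fa: "twisted_action k A B F rF R \<tau>"
    using self by (simp add: twisted_action_def)
  have dga: "twisted_dga k A B R Rt"
    using universal_intro[OF k.is_cring assms(2)] universal_intro[OF k.is_cring assms(3)] assms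
    by (simp add: twisted_dga_def twisted_dga_axioms_def)
  interpret connection_setting k A B R Rt E rE F rF \<tau> nabE nabF
    using dga Fa assms E.module_axioms
    by (simp add: connection_setting_def connection_setting_axioms_def product_setting_def
        product_setting_axioms_def bij_betw_def)
  show ?thesis by (intro ballI curvature_product)
qed

end
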